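(* Let $\alpha>\tfrac12$, $M>0$, $\eta>1$, $\rho>0$, and suppose $\lceil n^{\frac1{2\alpha}}\rceil\le p$. Let the data be $n$ i.i.d. copies of a mean-zero $p$-variate sub-Gaussian random vector with constant $\rho$ and precision matrix $\Omega$. Then the local cropping estimator $\tilde\Omega_k^{\rm op}$ with bandwidth $k$ satisfies $$\sup_{\Omega\in\mathcal P_\alpha(\eta,M)}\mathbb E\|\tilde\Omega_k^{\rm op}-\Omega\|_{\rm op}^2\ \le\ Ck^{-2\alpha+1}+C\,\frac{\log p+k}{n}.$$ When $k=\lceil n^{\frac1{2\alpha}}\rceil$, $$\sup_{\Omega\in\mathcal P_\alpha(\eta,M)}\mathbb E\|\tilde\Omega_k^{\rm op}-\Omega\|_{\rm op}^2\ \le\ Cn^{-\frac{2\alpha-1}{2\alpha}}+C\,\frac{\log p}{n}.$$ Here $C>0$ is a constant depending only on $\alpha,\eta,M,\rho$.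
   Context: Parameter space: a positive definite $p\times p$ matrix $\Omega$ has a unique decomposition $\Omega=(I-A)^TD^{-1}(I-A)$ with $A=[a_{ij}]$ strictly lower triangular and $D$ diagonal positive. $\mathcal P_\alpha(\eta,M)$ is the set of symmetric $\Omega$ with $\eta^{-1}\le\lambda_{\min}(\Omega)\le\lambda_{\max}(\Omega)<\eta$ and $\max_i\sum_{j<i-k}|a_{ij}|<Mk^{-\alpha}$ for all $k\in[p]=\{1,\dots,p\}$ (an empty sum is $0$). Sub-Gaussian with constant $\rho$: $\mathbb P\{|v^T(X-\mathbb EX)|>t\}\le 2\exp(-t^2/(2\rho))$ for all $t>0$ and all unit vectors $v$. $\|\cdot\|_{\rm op}$ is the operator (spectral) norm. For a symmetric matrix $S=U\Lambda U^T$ (eigendecomposition, $\Lambda={\rm diag}(\lambda_i)$), $\mathbf P_\eta(S)=U\,{\rm diag}(\lambda_i^* )\,U^T$ with $\lambda_i^*=\min\{\max\{\lambda_i,\eta^{-1}\},\eta\}$. Local cropping estimator. Let $\mathbf Z\in\mathbb R^{n\times p}$ be the data matrix with the $n$ observations as rows, and let $k$ be a positive integer bandwidth. For a block size $b\in\{k,2k\}$ and an integer $m$ with $2-b\le m\le p$, let $J=\{m-b,\dots,m+2b-1\}\cap[p]$ and $I=\{m,\dots,m+b-1\}\cap[p]$ (indices outside $[p]$ are discarded). Let $\tilde\Sigma$ be $\mathbf P_\eta$ applied to the principal submatrix of $\frac1n\mathbf Z^T\mathbf Z$ with index set $J$, and let $\tilde\Omega_m^{(b)}$ be the principal submatrix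 of $\tilde\Sigma^{-1}$ corresponding to the index set $I$. Let $\mathbf E_m(\tilde\Omega_m^{(b)})$ be the $p\times p$ matrix equal to $\tilde\Omega_m^{(b)}$ on $I\times I$ and zero elsewhere. Then $$\tilde\Omega_k^{\rm op}=\mathbf P_\eta\Big(\frac1k\Big(\sum_{m=2-2k}^{p}\mathbf E_m(\tilde\Omega_m^{(2k)})-\sum_{m=2-k}^{p}\mathbf E_m(\tilde\Omega_m^{(k)})\Big)\Big).$$ *)

theory Defs
  imports
    "HOL-Probability.Probability"
    "Jordan_Normal_Form.Spectral_Radius"
    "Jordan_Normal_Form.DL_Submatrix"
    "Jordan_Normal_Form.Gauss_Jordan_Elimination"
begin

text \<open>The dimension \<open>p\<close> varies under the constant, so matrices are those of
  Jordan_Normal_Form. Their indices start at 0: row or coordinate \<open>i\<close> here is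
  number \<open>i + 1\<close> in the usual 1-based numbering.\<close>

definition unit_vecs :: "nat \<Rightarrow> real Matrix.vec set" where
  "unit_vecs p = {v \<in> carrier_vec p. scalar_prod v v = 1}"

definition op_norm :: "real Matrix.mat \<Rightarrow> real" where
  "op_norm A =
     (SUP v \<in> unit_vecs (dim_col A). sqrt (scalar_prod (A *\<^sub>v v) (A *\<^sub>v v)))"

subsection \<open>Parameter space\<close>

definition cholesky_decomp ::
  "nat \<Rightarrow> real Matrix.mat \<Rightarrow> real Matrix.mat \<Rightarrow> (nat \<Rightarrow> real) \<Rightarrow> bool" where
  "cholesky_decomp p \<Omega> A d \<longleftrightarrow>
     A \<in> carrier_mat p p \<and>
     (\<forall>i<p. \<forall>j<p. i \<le> j \<longrightarrow> A $$ (i,j) = 0) \<and>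
     (\<forall>i<p. d i > 0) \<and>
     \<Omega> = (1\<^sub>m p - A)\<^sup>T * mat_diag p (\<lambda>i. 1 / d i) * (1\<^sub>m p - A)"

text \<open>The decomposition is unique, so the existential quantifier speaks about the
  Cholesky factor of \<open>\<Omega>\<close>. The condition \<open>j + k < i\<close> is \<open>j < i - k\<close>.\<close>

definition precision_class :: "nat \<Rightarrow> real \<Rightarrow> real \<Rightarrow> real \<Rightarrow> real Matrix.mat set" where
  "precision_class p \<alpha> \<eta> M =
     {\<Omega> \<in> carrier_mat p p. \<Omega>\<^sup>T = \<Omega> \<and>
        1 / \<eta> \<le> Min (spectrum \<Omega>) \<and> Max (spectrum \<Omega>) < \<eta> \<and>
        (\<exists>A d. cholesky_decomp p \<Omega> A d \<and>
           (\<forall>k\<in>{1..p}.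
              Max ((\<lambda>i. \<Sum>j | j + k < i. \<bar>A $$ (i,j)\<bar>) ` {..<p})
                < M * real k powr (- \<alpha>)))}"

subsection \<open>Sub-Gaussian laws with a given precision matrix\<close>

text \<open>A law of a \<open>p\<close>-variate random vector is a probability measure on the product
  space of functions on \<open>{..<p}\<close>.\<close>

definition mean_vec :: "nat \<Rightarrow> (nat \<Rightarrow> real) measure \<Rightarrow> real Matrix.vec" where
  "mean_vec p \<mu> = Matrix.vec p (\<lambda>i. \<integral>x. x i \<partial>\<mu>)"

definition cov_mat :: "nat \<Rightarrow> (nat \<Rightarrow> real) measure \<Rightarrow> real Matrix.mat" where
  "cov_mat p \<mu> = Matrix.mat p p (\<lambda>(i,j).
     \<integral>x. (x i - (\<integral>y. y i \<partial>\<mu>)) * (x j - (\<integral>y. y j \<partial>\<mu>)) \<partial>\<mu>)"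

definition sub_gaussian :: "nat \<Rightarrow> real \<Rightarrow> (nat \<Rightarrow> real) measure \<Rightarrow> bool" where
  "sub_gaussian p \<rho> \<mu> \<longleftrightarrow>
     (\<forall>t>0. \<forall>v\<in>unit_vecs p.
        measure \<mu> {x \<in> space \<mu>. \<bar>scalar_prod v (Matrix.vec p x - mean_vec p \<mu>)\<bar> > t}
          \<le> 2 * exp (- t\<^sup>2 / (2 * \<rho>)))"

definition data_laws :: "nat \<Rightarrow> real \<Rightarrow> real Matrix.mat \<Rightarrow> (nat \<Rightarrow> real) measure set" where
  "data_laws p \<rho> \<Omega> =
     {\<mu>. prob_space \<mu> \<and> sets \<mu> = sets (\<Pi>\<^sub>M i\<in>{..<p}. (borel :: real measure)) \<and>
         mean_vec p \<mu> = 0\<^sub>v p \<and> sub_gaussian p \<rho> \<mu> \<and>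
         inverts_mat (cov_mat p \<mu>) \<Omega> \<and> inverts_mat \<Omega> (cov_mat p \<mu>)}"

subsection \<open>Local cropping estimator\<close>

text \<open>The value of \<open>spectral_clip\<close> does not depend on the chosen eigendecomposition.\<close>

definition spectral_clip :: "real \<Rightarrow> real Matrix.mat \<Rightarrow> real Matrix.mat" where
  "spectral_clip \<eta> S = (SOME B. \<exists>U l.
     U \<in> carrier_mat (dim_row S) (dim_row S) \<and>
     U\<^sup>T * U = 1\<^sub>m (dim_row S) \<and> U * U\<^sup>T = 1\<^sub>m (dim_row S) \<and>
     S = U * mat_diag (dim_row S) l * U\<^sup>T \<and>
     B = U * mat_diag (dim_row S) (\<lambda>i. min (max (l i) (1 / \<eta>)) \<eta>) * U\<^sup>T)"

definition sample_cov :: "nat \<Rightarrow> nat \<Rightarrow> (nat \<Rightarrow> nat \<Rightarrow> real) \<Rightarrow> real Matrix.mat" where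
  "sample_cov n p z =
     (let Z = Matrix.mat n p (\<lambda>(i,j). z i j) in (1 / real n) \<cdot>\<^sub>m (Z\<^sup>T * Z))"

text \<open>\<open>window p l u\<close> is \<open>{l..u} \<inter> {1..p}\<close>, shifted to 0-based indices.\<close>

definition window :: "nat \<Rightarrow> int \<Rightarrow> int \<Rightarrow> nat set" where
  "window p l u = {i. i < p \<and> l \<le> int i + 1 \<and> int i + 1 \<le> u}"

text \<open>\<open>pos S i\<close> is the row number that index \<open>i \<in> S\<close> gets in a submatrix with
  index set \<open>S\<close>.\<close>

definition pos :: "nat set \<Rightarrow> nat \<Rightarrow> nat" where
  "pos S i = card {a \<in> S. a < i}"

definition local_precision ::
  "real \<Rightarrow> nat \<Rightarrow> real Matrix.mat \<Rightarrow> nat \<Rightarrow> int \<Rightarrow> real Matrix.mat" where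
  "local_precision \<eta> p S b m =
     (let J = window p (m - int b) (m + 2 * int b - 1);
          I = window p m (m + int b - 1);
          \<Sigma> = spectral_clip \<eta> (submatrix S J J)
      in submatrix (the (mat_inverse \<Sigma>)) (pos J ` I) (pos J ` I))"

definition embed_block ::
  "nat \<Rightarrow> nat \<Rightarrow> int \<Rightarrow> real Matrix.mat \<Rightarrow> real Matrix.mat" where
  "embed_block p b m B =
     (let I = window p m (m + int b - 1)
      in Matrix.mat p p (\<lambda>(r,s). if r \<in> I \<and> s \<in> I then B $$ (pos I r, pos I s) else 0))"

definition block_sum :: "real \<Rightarrow> nat \<Rightarrow> real Matrix.mat \<Rightarrow> nat \<Rightarrow> real Matrix.mat" where
  "block_sum \<eta> p S b = Matrix.mat p p (\<lambda>(r,s).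
     \<Sum>m = 2 - int b..int p. embed_block p b m (local_precision \<eta> p S b m) $$ (r,s))"

definition cropping_estimator ::
  "real \<Rightarrow> nat \<Rightarrow> nat \<Rightarrow> nat \<Rightarrow> (nat \<Rightarrow> nat \<Rightarrow> real) \<Rightarrow> real Matrix.mat" where
  "cropping_estimator \<eta> n p k z =
     (let S = sample_cov n p z
      in spectral_clip \<eta> ((1 / real k) \<cdot>\<^sub>m (block_sum \<eta> p S (2 * k) - block_sum \<eta> p S k)))"

subsection \<open>Worst-case risk\<close>

text \<open>The product measure is the joint law of \<open>n\<close> i.i.d. observations. \<open>\<Omega>\<close> does not
  determine the law of an observation, so the supremum is over both. In \<open>ennreal\<close>
  neither the expectation nor the suprema can take a default value.\<close>

definition max_risk :: "real \<Rightarrow> real \<Rightarrow> real \<Rightarrow> real \<Rightarrow> nat \<Rightarrow> nat \<Rightarrow> nat \<Rightarrow> ennreal" where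
  "max_risk \<alpha> \<eta> M \<rho> n p k =
     (SUP \<Omega> \<in> precision_class p \<alpha> \<eta> M. SUP \<mu> \<in> data_laws p \<rho> \<Omega>.
        \<integral>\<^sup>+z. ennreal ((op_norm (cropping_estimator \<eta> n p k z - \<Omega>))\<^sup>2)
          \<partial>(\<Pi>\<^sub>M i\<in>{..<n}. \<mu>))"

end

theory Submission
  imports Defs "Jordan_Normal_Form.Schur_Decomposition"
begin

text \<open>
  Let \<open>k\<close> be the bandwidth. Truncating the Cholesky factor \<open>A\<close> at distance \<open>k\<close> from the diagonal
  gives a matrix \<open>B = (I - A\<^sub>1)\<^sup>T D\<inverse> (I - A\<^sub>1)\<close> that vanishes beyond distance \<open>k\<close>, and a weighted
  Schur test for \<open>A - A\<^sub>1\<close> shows \<open>\<parallel>\<Omega> - B\<parallel> = O(k powr (1/2 - \<alpha>))\<close>. For a banded matrix local inversion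
  and the cropping weights would be exact, so each local block is compared with \<open>B\<close>: its error is
  bounded by \<open>\<parallel>\<Omega> - B\<parallel>\<close> plus the deviation of the local sample covariance. Averaging the blocks
  loses only a factor 3, and clipping at most doubles a distance. The local deviations are bounded
  by their values on lattice nets of the unit balls, whose joint exponential moment is controlled by
  the sub-Gaussian assumption. If \<open>ln p + k > n\<close>, the bound \<open>2 \<eta>\<close> on the error suffices.
\<close>

section \<open>Spectral theorem for real symmetric matrices\<close>

text \<open>The class constrains the rows of \<open>A\<close>, while a column is controlled only
  entry by entry. This asymmetry costs the factor \<open>k powr (1/2)\<close> in the truncation
  error and is where \<open>\<alpha> > 1/2\<close> enters. The cut is made in the factor because a
  banded triangular factor has a banded product, and its error reaches \<open>\<Omega>\<close>
  through bounded factors. A block of the estimator inverts a marginal covariance, whose inverse is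
  not a block of \<open>\<Omega>\<close>. For a precision matrix of bandwidth \<open>k\<close>,
  however, the two differ only within distance \<open>k\<close> of the edges of \<open>J\<close>,
  and the margins of \<open>J\<close> around \<open>I\<close> are at least that wide. The term
  \<open>ln p + k\<close> is the logarithm of the total number of net points: there are about
  \<open>p\<close> windows, each with \<open>exp (O(k))\<close> points. Squares of sub-Gaussian
  variables have exponential moments only for exponents of order at most \<open>1 / \<rho>\<close>.
  The exponent that suits the maximum is of order \<open>sqrt ((ln p + k) / n) / \<rho>\<close> and
  is admissible only for \<open>ln p + k \<le> n\<close>; hence the separate case.\<close>

lemma symmetric_eigenvector:
  fixes S :: "real mat"
  assumes S: "S \<in> carrier_mat n n" and sym: "S\<^sup>T = S" and n: "n > 0"
  shows "\<exists>v e. v \<in> carrier_vec n \<and> v \<noteq> 0\<^sub>v n \<and> S *\<^sub>v v = e \<cdot>\<^sub>v v"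
proof -
  define C where "C = map_mat complex_of_real S"
  have C: "C \<in> carrier_mat n n" using S by (auto simp: C_def)
  obtain \<mu> where "\<mu> \<in> spectrum C" using spectrum_non_empty[OF C n] by auto
  then obtain w where w: "w \<in> carrier_vec n" "w \<noteq> 0\<^sub>v n" "C *\<^sub>v w = \<mu> \<cdot>\<^sub>v w"
    using C unfolding spectrum_def eigenvalue_def eigenvector_def by auto
  define x y where "x = (\<lambda>i. Re (w $ i))" and "y = (\<lambda>i. Im (w $ i))"
  have Cw: "(\<Sum>j<n. complex_of_real (S $$ (i,j)) * w $ j) = \<mu> * w $ i" if "i < n" for i
  proof -
    have "(C *\<^sub>v w) $ i = (\<Sum>j<n. C $$ (i,j) * w $ j)"
      using C w(1) that by (simp add: scalar_prod_def atLeast0LessThan)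
    then show ?thesis
      using arg_cong[OF w(3), of "\<lambda>v. v $ i"] w(1) that S by (simp add: C_def)
  qed
  have Sx: "(\<Sum>j<n. S $$ (i,j) * x j) = Re \<mu> * x i - Im \<mu> * y i"
    and Sy: "(\<Sum>j<n. S $$ (i,j) * y j) = Re \<mu> * y i + Im \<mu> * x i" if "i < n" for i
    using arg_cong[OF Cw[OF that], of Re] arg_cong[OF Cw[OF that], of Im]
    by (simp_all add: x_def y_def)
  have symS: "S $$ (i,j) = S $$ (j,i)" if "i < n" "j < n" for i j
    using sym S that by (metis index_transpose_mat(1) carrier_matD)
  \<comment> \<open>Evaluating the form \<open>x S y\<close> in both orders gives
    \<open>Im \<mu> * (|x|^2 + |y|^2) = 0\<close>. So the eigenvalue is real, and the real or the
    imaginary part of \<open>w\<close> is a real eigenvector.\<close>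
  have "(\<Sum>i<n. x i * (\<Sum>j<n. S $$ (i,j) * y j)) = (\<Sum>i<n. \<Sum>j<n. x i * S $$ (i,j) * y j)"
    by (simp add: sum_distrib_left mult.assoc)
  also have "\<dots> = (\<Sum>j<n. \<Sum>i<n. x i * S $$ (i,j) * y j)" by (rule sum.swap)
  also have "\<dots> = (\<Sum>j<n. y j * (\<Sum>i<n. S $$ (j,i) * x i))"
    unfolding sum_distrib_left by (intro sum.cong refl) (simp add: symS mult_ac)
  finally have "(\<Sum>i<n. x i * (Re \<mu> * y i + Im \<mu> * x i)) = (\<Sum>j<n. y j * (Re \<mu> * x j - Im \<mu> * y j))"
    using Sx Sy by simp
  then have "Im \<mu> * (\<Sum>i<n. x i ^ 2 + y i ^ 2) = 0"
    by (simp add: algebra_simps sum.distrib sum_subtractf sum_distrib_left power2_eq_square)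
  moreover have "(\<Sum>i<n. x i ^ 2 + y i ^ 2) \<noteq> 0"
  proof
    assume "(\<Sum>i<n. x i ^ 2 + y i ^ 2) = 0"
    then have "\<forall>i<n. x i ^ 2 + y i ^ 2 = 0"
      by (subst (asm) sum_nonneg_eq_0_iff) auto
    then have "\<forall>i<n. w $ i = 0" by (auto simp: x_def y_def complex_eq_iff sum_power2_eq_zero_iff)
    then show False using w(1,2) by (metis eq_vecI carrier_vecD index_zero_vec)
  qed
  ultimately have mu: "Im \<mu> = 0" by simp
  have ev: "S *\<^sub>v Matrix.vec n z = Re \<mu> \<cdot>\<^sub>v Matrix.vec n z" if "z = x \<or> z = y" for z
    using that S Sx Sy mu
    by (intro eq_vecI) (auto simp: scalar_prod_def atLeast0LessThan)
  have "Matrix.vec n x \<noteq> 0\<^sub>v n \<or> Matrix.vec n y \<noteq> 0\<^sub>v n"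
  proof (rule ccontr)
    assume "\<not> ?thesis"
    then have z: "Matrix.vec n x = 0\<^sub>v n" "Matrix.vec n y = 0\<^sub>v n" by auto
    have "w $ i = 0" if "i < n" for i
    proof -
      have "x i = 0" "y i = 0"
        using arg_cong[OF z(1), of "\<lambda>v. v $ i"] arg_cong[OF z(2), of "\<lambda>v. v $ i"] that by auto
      then show ?thesis by (simp add: x_def y_def complex_eq_iff)
    qed
    then show False using w(1,2) by (metis eq_vecI carrier_vecD index_zero_vec)
  qed
  then show ?thesis using ev by (metis vec_carrier)
qed

text \<open>Gram-Schmidt keeps the first vector of a basis that starts with \<open>v\<close>;
  normalizing the resulting vectors gives the columns of \<open>W\<close>.\<close>

lemma orthonormal_completion:
  fixes v :: "real Matrix.vec"
  assumes v: "v \<in> carrier_vec n" "v \<noteq> 0\<^sub>v n"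
  shows "\<exists>W c. W \<in> carrier_mat n n \<and> W\<^sup>T * W = 1\<^sub>m n \<and> W * W\<^sup>T = 1\<^sub>m n \<and>
    Matrix.col W 0 = c \<cdot>\<^sub>v v"
proof -
  interpret cof_vec_space n "TYPE(real)" .
  define b where "b = basis_completion v"
  define ws where "ws = gram_schmidt n b"
  note bc = basis_completion[OF v, folded b_def]
  have n: "n > 0" using v by (cases n) auto
  obtain vs where bv: "b = v # vs" using bc(6,7) n by (cases b) auto
  have gs: "set ws \<subseteq> carrier_vec n" "corthogonal ws" "length ws = n"
    using gram_schmidt_result[OF bc(2,4,5) ws_def] bc(6) by auto
  have hd: "hd ws = v"
    using gram_schmidt_hd[OF v(1), of vs] bv by (simp add: ws_def)
  define W where "W = Matrix.mat n n (\<lambda>(i,j). ws ! j $ i / sqrt (ws ! j \<bullet> ws ! j))"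
  have W: "W \<in> carrier_mat n n" by (simp add: W_def)
  have wc: "ws ! j \<in> carrier_vec n" if "j < n" for j using gs that by auto
  have orth: "ws ! i \<bullet> ws ! j = 0 \<longleftrightarrow> i \<noteq> j" if "i < n" "j < n" for i j
    using corthogonalD[OF gs(2), of i j] gs(3) that by simp
  have pos: "ws ! j \<bullet> ws ! j > 0" if "j < n" for j
  proof -
    have "ws ! j \<bullet> ws ! j \<ge> 0" by (auto simp: scalar_prod_def intro!: sum_nonneg)
    then show ?thesis using orth[OF that that] by simp
  qed
  have WW: "W\<^sup>T * W = 1\<^sub>m n"
  proof (rule eq_matI)
    fix i j assume "i < dim_row (1\<^sub>m n :: real mat)" "j < dim_col (1\<^sub>m n :: real mat)"
    then have ij: "i < n" "j < n" by auto
    have "(W\<^sup>T * W) $$ (i,j) = (ws ! i \<bullet> ws ! j) / (sqrt (ws ! i \<bullet> ws ! i) * sqrt (ws ! j \<bullet> ws ! j))"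
      using ij wc[of i] wc[of j] by (simp add: scalar_prod_def W_def sum_divide_distrib)
    then show "(W\<^sup>T * W) $$ (i,j) = 1\<^sub>m n $$ (i,j)"
      using orth[OF ij] pos[of i] ij by (cases "i = j") (auto simp: real_sqrt_mult[symmetric])
  qed (use W in auto)
  have WW': "W * W\<^sup>T = 1\<^sub>m n"
    using mat_mult_left_right_inverse[OF _ W WW] W by auto
  have "Matrix.col W 0 = (1 / sqrt (v \<bullet> v)) \<cdot>\<^sub>v v"
  proof -
    have "ws ! 0 = v" using hd gs(3) n by (metis hd_conv_nth list.size(3) less_irrefl)
    then show ?thesis using n v by (intro eq_vecI) (auto simp: W_def)
  qed
  then show ?thesis using W WW WW' by blast
qed

text \<open>Deflation: in an orthonormal basis whose first vector is an eigenvector, the first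
  column is \<open>e\<close> times a unit vector, symmetry clears the first row, and the induction
  hypothesis diagonalizes the remaining block \<open>T\<close>.\<close>

lemma spectral_theorem_real_symmetric:
  fixes S :: "real mat"
  assumes "S \<in> carrier_mat n n" and "S\<^sup>T = S"
  shows "\<exists>U l. U \<in> carrier_mat n n \<and> U\<^sup>T * U = 1\<^sub>m n \<and> U * U\<^sup>T = 1\<^sub>m n \<and>
    S = U * mat_diag n l * U\<^sup>T"
  using assms
proof (induction n arbitrary: S)
  case 0
  then show ?case by (intro exI[of _ "1\<^sub>m 0"] exI[of _ "\<lambda>_. 0"]) auto
next
  case (Suc m)
  define n where "n = Suc m"
  note S = Suc.prems(1)[folded n_def]
  note sym = Suc.prems(2)
  obtain v e where v: "v \<in> carrier_vec n" "v \<noteq> 0\<^sub>v n" "S *\<^sub>v v = e \<cdot>\<^sub>v v"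
    using symmetric_eigenvector[OF S sym] by (auto simp: n_def)
  obtain W c where W[simp]: "W \<in> carrier_mat n n" and WW: "W\<^sup>T * W = 1\<^sub>m n" "W * W\<^sup>T = 1\<^sub>m n"
    and col: "Matrix.col W 0 = c \<cdot>\<^sub>v v"
    using orthonormal_completion[OF v(1,2)] by blast
  have mc[simp]: "X * Y \<in> carrier_mat n n" if "X \<in> carrier_mat n n" "Y \<in> carrier_mat n n" for X Y :: "real mat"
    using that by (rule mult_carrier_mat)
  have Wt[simp]: "W\<^sup>T \<in> carrier_mat n n" using W by simp
  define A where "A = W\<^sup>T * S * W"
  have A[simp]: "A \<in> carrier_mat n n" using W S by (simp add: A_def)
  have At: "A\<^sup>T = A"
    unfolding A_def using W S sym
    by (subst transpose_mult[of _ n n _ n]; (subst transpose_mult[of _ n n _ n])?) (auto simp: assoc_mult_mat[of _ n n _ n _ n])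
  have S_eq: "S = W * A * W\<^sup>T"
  proof -
    have "W * A * W\<^sup>T = (W * W\<^sup>T) * S * (W * W\<^sup>T)"
      unfolding A_def using W S Wt by (simp add: assoc_mult_mat[of _ n n _ n _ n])
    then show ?thesis using WW S by simp
  qed
  have A0: "A $$ (i,0) = (if i = 0 then e else 0)" if i: "i < n" for i
  proof -
    have "A = W\<^sup>T * (S * W)" using W S Wt by (simp add: A_def assoc_mult_mat[of _ n n _ n _ n])
    then have "A $$ (i,0) = Matrix.row (W\<^sup>T) i \<bullet> Matrix.col (S * W) 0"
      using i W S by (auto simp: n_def)
    also have "Matrix.col (S * W) 0 = S *\<^sub>v Matrix.col W 0"
      using W S by (intro col_mult2) (auto simp: n_def)
    also have "\<dots> = e \<cdot>\<^sub>v Matrix.col W 0"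
      using v S by (auto simp: col mult_mat_vec smult_smult_assoc mult.commute)
    also have "Matrix.row (W\<^sup>T) i \<bullet> (e \<cdot>\<^sub>v Matrix.col W 0) = e * (W\<^sup>T * W) $$ (i,0)"
      using i W by (auto simp: n_def)
    finally show ?thesis using i by (auto simp: WW n_def)
  qed
  have A0': "A $$ (0,i) = (if i = 0 then e else 0)" if i: "i < n" for i
  proof -
    have "A $$ (0,i) = A\<^sup>T $$ (i,0)" using i A[THEN carrier_matD(1)] A[THEN carrier_matD(2)] by (simp add: n_def)
    then show ?thesis using A0[OF i] At by simp
  qed
  define T where "T = Matrix.mat m m (\<lambda>(i,j). A $$ (Suc i, Suc j))"
  have T: "T \<in> carrier_mat m m" by (simp add: T_def)
  have "T\<^sup>T = T"
  proof (rule eq_matI)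
    fix i j assume "i < dim_row T" "j < dim_col T"
    then show "T\<^sup>T $$ (i,j) = T $$ (i,j)"
      using At A by (auto simp: T_def) (metis Suc_less_eq At A carrier_matD index_transpose_mat(1) n_def)
  qed (auto simp: T_def)
  then obtain V l where V[simp]: "V \<in> carrier_mat m m" and VV: "V\<^sup>T * V = 1\<^sub>m m" "V * V\<^sup>T = 1\<^sub>m m"
    and T_eq: "T = V * mat_diag m l * V\<^sup>T"
    using Suc.IH[OF T] by blast
  define E where "E = Matrix.mat 1 1 (\<lambda>_. e)"
  define F where "F = four_block_mat (1\<^sub>m 1) (0\<^sub>m 1 m) (0\<^sub>m m 1) V"
  define l' where "l' = (\<lambda>i. case i of 0 \<Rightarrow> e | Suc i \<Rightarrow> l i)"
  have E[simp]: "E \<in> carrier_mat (Suc 0) (Suc 0)" by (simp add: E_def)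
  have mcm[simp]: "X * Y \<in> carrier_mat m m" if "X \<in> carrier_mat m m" "Y \<in> carrier_mat m m" for X Y :: "real mat"
    using that by (rule mult_carrier_mat)
  have F[simp]: "F \<in> carrier_mat n n"
    using four_block_carrier_mat[OF one_carrier_mat[of 1] V] by (simp add: F_def n_def)
  have Ft: "F\<^sup>T = four_block_mat (1\<^sub>m 1) (0\<^sub>m 1 m) (0\<^sub>m m 1) (V\<^sup>T)"
    unfolding F_def by (subst transpose_four_block_mat[of _ 1 1 _ m _ m]) auto
  have D: "mat_diag n l' = four_block_mat E (0\<^sub>m 1 m) (0\<^sub>m m 1) (mat_diag m l)"
    by (rule eq_matI) (auto simp: E_def l'_def n_def mat_diag_def split: nat.splits)
  have A_eq0: "A = four_block_mat E (0\<^sub>m 1 m) (0\<^sub>m m 1) T"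
    by (rule eq_matI) (use A A0 A0' in \<open>auto simp: E_def T_def n_def\<close>)
  have one: "four_block_mat (1\<^sub>m 1) (0\<^sub>m 1 m) (0\<^sub>m m 1) (1\<^sub>m m) = (1\<^sub>m n :: real mat)"
    by (rule eq_matI) (auto simp: n_def)
  have zs: "1\<^sub>m (Suc 0) * E = E" "E + 0\<^sub>m (Suc 0) (Suc 0) = E"
    "0\<^sub>m m (Suc 0) * E = 0\<^sub>m m (Suc 0)" "E * 0\<^sub>m (Suc 0) m = 0\<^sub>m (Suc 0) m" "E * 1\<^sub>m (Suc 0) = E"
    "0\<^sub>m (Suc 0) m * X = 0\<^sub>m (Suc 0) m" "X * 0\<^sub>m m (Suc 0) = 0\<^sub>m m (Suc 0)"
    if "X \<in> carrier_mat m m" for X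
    using that E by (simp_all add: left_mult_zero_mat[of _ _ m] right_mult_zero_mat[of _ m m]
        left_mult_one_mat[OF E] right_mult_one_mat[OF E] right_add_zero_mat[OF E]
        left_mult_zero_mat[OF E] right_mult_zero_mat[OF E] del: mult_carrier_mat)
  have Dm: "mat_diag m l \<in> carrier_mat m m" by simp
  have Vt: "V\<^sup>T \<in> carrier_mat m m" and VD: "V * mat_diag m l \<in> carrier_mat m m" by simp_all
  have FD: "F * mat_diag n l' = four_block_mat E (0\<^sub>m 1 m) (0\<^sub>m m 1) (V * mat_diag m l)"
    unfolding F_def D by (subst mult_four_block_mat[of _ 1 1 _ m _ m _ _ 1 _ m]) (auto simp: zs[OF V] zs[OF Dm])
  have A_eq: "A = F * mat_diag n l' * F\<^sup>T"
    unfolding FD Ft A_eq0 T_eq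
    by (subst mult_four_block_mat[of _ 1 1 _ m _ m _ _ 1 _ m]) (auto simp: zs[OF Vt] zs[OF VD])
  have FF: "F\<^sup>T * F = 1\<^sub>m n"
    unfolding Ft unfolding F_def
    by (subst mult_four_block_mat[of _ 1 1 _ m _ m _ _ 1 _ m]) (auto simp: VV n_def zs[OF Vt] zs[OF V])
  have FF': "F * F\<^sup>T = 1\<^sub>m n"
    unfolding Ft unfolding F_def
    by (subst mult_four_block_mat[of _ 1 1 _ m _ m _ _ 1 _ m]) (auto simp: VV n_def zs[OF Vt] zs[OF V])
  define U where "U = W * F"
  have U: "U \<in> carrier_mat n n" by (simp add: U_def)
  have Ut: "U\<^sup>T = F\<^sup>T * W\<^sup>T" unfolding U_def by (rule transpose_mult[of _ n n _ n]) auto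
  have Fts: "F\<^sup>T \<in> carrier_mat n n" by simp
  have "U\<^sup>T * U = F\<^sup>T * (W\<^sup>T * W) * F"
    unfolding Ut unfolding U_def using Fts by (simp add: assoc_mult_mat[of _ n n _ n _ n])
  then have UU: "U\<^sup>T * U = 1\<^sub>m n" using FF right_mult_one_mat[OF Fts] by (simp add: WW)
  have "U * U\<^sup>T = W * (F * F\<^sup>T) * W\<^sup>T"
    unfolding Ut unfolding U_def using Fts by (simp add: assoc_mult_mat[of _ n n _ n _ n])
  then have UU': "U * U\<^sup>T = 1\<^sub>m n" using WW right_mult_one_mat[OF W] by (simp add: FF')
  have Dc: "mat_diag n l' \<in> carrier_mat n n" by simp
  have "S = U * mat_diag n l' * U\<^sup>T"
    unfolding S_eq A_eq Ut unfolding U_def using Fts Dc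
    by (simp add: assoc_mult_mat[of _ n n _ n _ n] del: mat_diag_dim)
  then show ?case using U UU UU' unfolding n_def by blast
qed

section \<open>Operator bounds and spectral clipping\<close>

text \<open>Entries are plain functions on arbitrary index sets, so blocks on different windows can
  be compared without renumbering. For empty \<open>J\<close> every \<open>c\<close> qualifies, even
  a negative one; hence the side conditions \<open>c \<ge> 0\<close> below.\<close>

definition op_bound :: "nat set \<Rightarrow> nat set \<Rightarrow> (nat \<Rightarrow> nat \<Rightarrow> real) \<Rightarrow> real \<Rightarrow> bool" where
  "op_bound I J A c \<longleftrightarrow> (\<forall>x. L2_set (\<lambda>i. \<Sum>j\<in>J. A i j * x j) I \<le> c * L2_set x J)"

lemma L2_set_sq: "(L2_set f A)\<^sup>2 = (\<Sum>i\<in>A. (f i)\<^sup>2)"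
  by (simp add: L2_set_def sum_nonneg)

lemma L2_set_cmult: "L2_set (\<lambda>i. c * f i) A = \<bar>c\<bar> * L2_set f A"
  by (simp add: L2_set_def power_mult_distrib sum_distrib_left[symmetric] real_sqrt_mult)

lemma abs_inner_le_L2_set: "\<bar>\<Sum>i\<in>A. f i * g i\<bar> \<le> L2_set f A * L2_set g A"
proof -
  have "\<bar>\<Sum>i\<in>A. f i * g i\<bar> \<le> (\<Sum>i\<in>A. \<bar>f i\<bar> * \<bar>g i\<bar>)"
    by (rule order_trans[OF sum_abs]) (simp add: abs_mult)
  also have "\<dots> \<le> L2_set f A * L2_set g A" by (rule L2_set_mult_ineq)
  finally show ?thesis .
qed

lemma op_boundD: "op_bound I J A c \<Longrightarrow> L2_set (\<lambda>i. \<Sum>j\<in>J. A i j * x j) I \<le> c * L2_set x J"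
  by (simp add: op_bound_def)

lemma op_bound_cong:
  "(\<And>i j. i \<in> I \<Longrightarrow> j \<in> J \<Longrightarrow> A i j = B i j) \<Longrightarrow> op_bound I J A c = op_bound I J B c"
  unfolding op_bound_def by (intro iff_allI) (simp cong: sum.cong L2_set_cong)

lemma op_bound_mono: "op_bound I J A c \<Longrightarrow> c \<le> d \<Longrightarrow> op_bound I J A d"
  unfolding op_bound_def by (meson L2_set_nonneg mult_right_mono order_trans)

text \<open>A vector on \<open>J'\<close> is extended by zero to \<open>J\<close>, and dropping rows
  only drops squares.\<close>

lemma op_bound_subset:
  assumes "op_bound I J A c" "I' \<subseteq> I" "J' \<subseteq> J" "finite I" "finite J"
  shows "op_bound I' J' A c"
  unfolding op_bound_def
proof
  fix x :: "nat \<Rightarrow> real"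
  define y where "y j = (if j \<in> J' then x j else 0)" for j
  have eq: "(\<Sum>j\<in>J. A i j * y j) = (\<Sum>j\<in>J'. A i j * x j)" for i
    using assms by (intro sum.mono_neutral_cong_right) (auto simp: y_def)
  have y: "L2_set y J = L2_set x J'"
    unfolding L2_set_def using assms
    by (intro arg_cong[of _ _ sqrt] sum.mono_neutral_cong_right) (auto simp: y_def)
  have "L2_set (\<lambda>i. \<Sum>j\<in>J'. A i j * x j) I' \<le> L2_set (\<lambda>i. \<Sum>j\<in>J. A i j * y j) I"
    unfolding eq L2_set_def using assms by (intro real_sqrt_le_mono sum_mono2) auto
  also have "\<dots> \<le> c * L2_set y J" by (rule op_boundD[OF assms(1)])
  finally show "L2_set (\<lambda>i. \<Sum>j\<in>J'. A i j * x j) I' \<le> c * L2_set x J'" by (simp add: y)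
qed

lemma op_bound_comp:
  assumes "op_bound I J A a" "op_bound J K B b" "a \<ge> 0"
  shows "op_bound I K (\<lambda>i k. \<Sum>j\<in>J. A i j * B j k) (a * b)"
  unfolding op_bound_def
proof
  fix x :: "nat \<Rightarrow> real"
  have "(\<Sum>k\<in>K. (\<Sum>j\<in>J. A i j * B j k) * x k) = (\<Sum>j\<in>J. A i j * (\<Sum>k\<in>K. B j k * x k))" for i
    by (simp add: sum_distrib_left sum_distrib_right mult.assoc) (rule sum.swap)
  then have "L2_set (\<lambda>i. \<Sum>k\<in>K. (\<Sum>j\<in>J. A i j * B j k) * x k) I \<le> a * L2_set (\<lambda>j. \<Sum>k\<in>K. B j k * x k) J"
    using op_boundD[OF assms(1)] by simp
  also have "\<dots> \<le> a * (b * L2_set x K)" using op_boundD[OF assms(2)] assms(3) by (intro mult_left_mono)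
  finally show "L2_set (\<lambda>i. \<Sum>k\<in>K. (\<Sum>j\<in>J. A i j * B j k) * x k) I \<le> a * b * L2_set x K" by simp
qed

lemma op_bound_add:
  assumes "op_bound I J A a" "op_bound I J B b"
  shows "op_bound I J (\<lambda>i j. A i j + B i j) (a + b)"
  unfolding op_bound_def
proof
  fix x :: "nat \<Rightarrow> real"
  have "L2_set (\<lambda>i. \<Sum>j\<in>J. (A i j + B i j) * x j) I
      = L2_set (\<lambda>i. (\<Sum>j\<in>J. A i j * x j) + (\<Sum>j\<in>J. B i j * x j)) I"
    by (simp add: algebra_simps sum.distrib)
  also have "\<dots> \<le> L2_set (\<lambda>i. \<Sum>j\<in>J. A i j * x j) I + L2_set (\<lambda>i. \<Sum>j\<in>J. B i j * x j) I"
    by (rule L2_set_triangle_ineq)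
  also have "\<dots> \<le> (a + b) * L2_set x J"
    using op_boundD[OF assms(1)] op_boundD[OF assms(2)] by (simp add: distrib_right add_mono)
  finally show "L2_set (\<lambda>i. \<Sum>j\<in>J. (A i j + B i j) * x j) I \<le> (a + b) * L2_set x J" .
qed

lemma op_bound_cmult:
  assumes "op_bound I J A a"
  shows "op_bound I J (\<lambda>i j. t * A i j) (\<bar>t\<bar> * a)"
  unfolding op_bound_def
proof
  fix x :: "nat \<Rightarrow> real"
  have "L2_set (\<lambda>i. \<Sum>j\<in>J. t * A i j * x j) I = \<bar>t\<bar> * L2_set (\<lambda>i. \<Sum>j\<in>J. A i j * x j) I"
    by (simp add: L2_set_cmult[symmetric] sum_distrib_left mult.assoc)
  then show "L2_set (\<lambda>i. \<Sum>j\<in>J. t * A i j * x j) I \<le> \<bar>t\<bar> * a * L2_set x J"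
    using op_boundD[OF assms] by (simp add: mult.assoc mult_left_mono)
qed

lemma op_bound_diff:
  assumes "op_bound I J A a" "op_bound I J B b"
  shows "op_bound I J (\<lambda>i j. A i j - B i j) (a + b)"
  using op_bound_add[OF assms(1) op_bound_cmult[OF assms(2), of "-1"]] by simp

lemma op_bound_bilinear:
  assumes "op_bound I J A c"
  shows "\<bar>\<Sum>i\<in>I. \<Sum>j\<in>J. x i * A i j * y j\<bar> \<le> c * L2_set x I * L2_set y J"
proof -
  have "(\<Sum>i\<in>I. \<Sum>j\<in>J. x i * A i j * y j) = (\<Sum>i\<in>I. x i * (\<Sum>j\<in>J. A i j * y j))"
    by (simp add: sum_distrib_left mult.assoc)
  also have "\<bar>\<dots>\<bar> \<le> L2_set x I * L2_set (\<lambda>i. \<Sum>j\<in>J. A i j * y j) I" by (rule abs_inner_le_L2_set)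
  also have "\<dots> \<le> L2_set x I * (c * L2_set y J)"
    by (intro mult_left_mono op_boundD[OF assms]) simp
  finally show ?thesis by (simp add: mult_ac)
qed

text \<open>The bilinear form is tested with \<open>x = A y\<close>, and one factor
  \<open>L2_set x I\<close> is cancelled.\<close>

lemma op_boundI_bilinear:
  assumes "\<And>x y. \<bar>\<Sum>i\<in>I. \<Sum>j\<in>J. x i * A i j * y j\<bar> \<le> c * L2_set x I * L2_set y J" "c \<ge> 0"
  shows "op_bound I J A c"
  unfolding op_bound_def
proof
  fix y :: "nat \<Rightarrow> real"
  define x where "x i = (\<Sum>j\<in>J. A i j * y j)" for i
  have "(\<Sum>j\<in>J. x i * A i j * y j) = (x i)\<^sup>2" for i
    unfolding power2_eq_square x_def[of i] by (simp add: sum_distrib_left mult.assoc)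
  then have "(L2_set x I)\<^sup>2 = (\<Sum>i\<in>I. \<Sum>j\<in>J. x i * A i j * y j)"
    by (simp add: L2_set_sq)
  also have "\<dots> \<le> c * L2_set x I * L2_set y J" using assms(1)[of x y] by linarith
  finally have "L2_set x I * L2_set x I \<le> L2_set x I * (c * L2_set y J)"
    by (simp add: power2_eq_square mult_ac)
  then have "L2_set x I \<le> c * L2_set y J"
    using L2_set_nonneg[of x I] L2_set_nonneg[of y J] assms(2)
    by (cases "L2_set x I = 0") (auto simp: mult_le_cancel_left)
  then show "L2_set (\<lambda>i. \<Sum>j\<in>J. A i j * y j) I \<le> c * L2_set y J" by (simp add: x_def[abs_def])
qed

lemma op_bound_transpose:
  assumes "op_bound I J A c" "c \<ge> 0"
  shows "op_bound J I (\<lambda>j i. A i j) c"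
proof (rule op_boundI_bilinear[OF _ assms(2)])
  fix x y
  have "(\<Sum>j\<in>J. \<Sum>i\<in>I. x j * A i j * y i) = (\<Sum>i\<in>I. \<Sum>j\<in>J. y i * A i j * x j)"
    by (subst sum.swap) (simp add: mult_ac)
  then show "\<bar>\<Sum>j\<in>J. \<Sum>i\<in>I. x j * A i j * y i\<bar> \<le> c * L2_set x J * L2_set y I"
    using op_bound_bilinear[OF assms(1), of y x] by (simp add: mult_ac)
qed

section \<open>Quadratic forms and polarization\<close>

definition quad :: "nat set \<Rightarrow> (nat \<Rightarrow> nat \<Rightarrow> real) \<Rightarrow> (nat \<Rightarrow> real) \<Rightarrow> real" where
  "quad I A x = (\<Sum>i\<in>I. \<Sum>j\<in>I. x i * A i j * x j)"

lemma abs_quad_le: "op_bound I I A c \<Longrightarrow> \<bar>quad I A x\<bar> \<le> c * (L2_set x I)\<^sup>2"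
  using op_bound_bilinear[of I I A c x x] by (simp add: quad_def power2_eq_square mult.assoc)

lemma quad_polarization:
  assumes "\<And>i j. i \<in> I \<Longrightarrow> j \<in> I \<Longrightarrow> A i j = A j i"
  shows "quad I A (\<lambda>i. x i + y i) - quad I A (\<lambda>i. x i - y i) = 4 * (\<Sum>i\<in>I. \<Sum>j\<in>I. x i * A i j * y j)"
proof -
  have "quad I A (\<lambda>i. x i + y i) - quad I A (\<lambda>i. x i - y i)
      = 2 * (\<Sum>i\<in>I. \<Sum>j\<in>I. x i * A i j * y j) + 2 * (\<Sum>i\<in>I. \<Sum>j\<in>I. y i * A i j * x j)"
    unfolding quad_def sum_subtractf[symmetric] sum_distrib_left sum.distrib[symmetric]
    by (intro sum.cong refl) (simp add: algebra_simps)
  also have "(\<Sum>i\<in>I. \<Sum>j\<in>I. y i * A i j * x j) = (\<Sum>i\<in>I. \<Sum>j\<in>I. x i * A i j * y j)"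
    by (subst sum.swap, intro sum.cong refl) (use assms in \<open>simp add: mult_ac\<close>)
  finally show ?thesis by simp
qed

text \<open>Polarization and the parallelogram law bound the bilinear form by
  \<open>c / 2 * (|x|^2 + |y|^2)\<close>. Scaling both vectors to length 1 turns this into
  \<open>c * |x| * |y|\<close> without loss of a constant.\<close>

lemma op_boundI_quad:
  assumes sym: "\<And>i j. i \<in> I \<Longrightarrow> j \<in> I \<Longrightarrow> A i j = A j i"
    and q: "\<And>x. \<bar>quad I A x\<bar> \<le> c * (\<Sum>i\<in>I. (x i)\<^sup>2)" and c: "c \<ge> 0" and fin: "finite I"
  shows "op_bound I I A c"
proof (rule op_boundI_bilinear[OF _ c])
  fix x y :: "nat \<Rightarrow> real"
  let ?B = "\<lambda>x y. \<Sum>i\<in>I. \<Sum>j\<in>I. x i * A i j * y j"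
  have bd: "\<bar>?B x y\<bar> \<le> c / 2 * ((\<Sum>i\<in>I. (x i)\<^sup>2) + (\<Sum>i\<in>I. (y i)\<^sup>2))" for x y
  proof -
    have "4 * \<bar>?B x y\<bar> \<le> \<bar>quad I A (\<lambda>i. x i + y i)\<bar> + \<bar>quad I A (\<lambda>i. x i - y i)\<bar>"
      using quad_polarization[of I A x y, OF sym] by linarith
    also have "\<dots> \<le> c * (\<Sum>i\<in>I. (x i + y i)\<^sup>2) + c * (\<Sum>i\<in>I. (x i - y i)\<^sup>2)"
      by (intro add_mono q)
    also have "\<dots> = 2 * c * ((\<Sum>i\<in>I. (x i)\<^sup>2) + (\<Sum>i\<in>I. (y i)\<^sup>2))"
      unfolding sum_distrib_left sum.distrib[symmetric]
      by (intro sum.cong refl) (simp add: power2_eq_square algebra_simps)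
    finally show ?thesis by simp
  qed
  let ?a = "L2_set x I" and ?b = "L2_set y I"
  show "\<bar>?B x y\<bar> \<le> c * ?a * ?b"
  proof (cases "?a = 0 \<or> ?b = 0")
    case True
    then have "(\<forall>i\<in>I. x i = 0) \<or> (\<forall>i\<in>I. y i = 0)" by (simp add: L2_set_eq_0_iff[OF fin])
    then have "?B x y = 0" by (intro sum.neutral ballI) auto
    then show ?thesis using c by simp
  next
    case False
    then have ab: "?a > 0" "?b > 0" using L2_set_nonneg[of x I] L2_set_nonneg[of y I] by linarith+
    let ?x = "\<lambda>i. x i / ?a" and ?y = "\<lambda>i. y i / ?b"
    have n1: "(\<Sum>i\<in>I. (?x i)\<^sup>2) = 1" "(\<Sum>i\<in>I. (?y i)\<^sup>2) = 1"
      using ab by (simp_all only: power_divide sum_divide_distrib[symmetric] L2_set_sq[symmetric]) simp_all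
    have "x i * A i j * y j = ?a * ?b * (?x i * A i j * ?y j)" for i j
      using ab by simp
    then have "?B x y = ?a * ?b * ?B ?x ?y"
      by (simp only: sum_distrib_left)
    then have "\<bar>?B x y\<bar> = ?a * ?b * \<bar>?B ?x ?y\<bar>" using ab by (simp add: abs_mult)
    also have "\<dots> \<le> ?a * ?b * c" using bd[of ?x ?y] ab unfolding n1 by (intro mult_left_mono) auto
    finally show ?thesis by (simp add: mult_ac)
  qed
qed

section \<open>Functional calculus in an orthonormal basis\<close>

definition orthonormal_system :: "nat \<Rightarrow> (nat \<Rightarrow> nat \<Rightarrow> real) \<Rightarrow> bool" where
  "orthonormal_system d u \<longleftrightarrow>
     (\<forall>a<d. \<forall>b<d. (\<Sum>i<d. u a i * u b i) = (if a = b then 1 else 0)) \<and>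
     (\<forall>i<d. \<forall>j<d. (\<Sum>a<d. u a i * u a j) = (if i = j then 1 else 0))"

text \<open>The matrix with eigenvectors \<open>u a\<close> and eigenvalues \<open>f a\<close>.
  Clipping and inversion become operations on \<open>f\<close> alone.\<close>

definition spectral_sum :: "nat \<Rightarrow> (nat \<Rightarrow> nat \<Rightarrow> real) \<Rightarrow> (nat \<Rightarrow> real) \<Rightarrow> nat \<Rightarrow> nat \<Rightarrow> real" where
  "spectral_sum d u f i j = (\<Sum>a<d. f a * u a i * u a j)"

lemma quad_spectral_sum:
  "quad {..<d} (spectral_sum d u f) x = (\<Sum>a<d. f a * (\<Sum>i<d. u a i * x i)\<^sup>2)"
proof -
  have "quad {..<d} (spectral_sum d u f) x = (\<Sum>i<d. \<Sum>j<d. \<Sum>a<d. f a * (u a i * x i) * (u a j * x j))"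
    unfolding quad_def spectral_sum_def sum_distrib_left sum_distrib_right
    by (intro sum.cong refl) (simp add: mult_ac)
  also have "\<dots> = (\<Sum>i<d. \<Sum>a<d. \<Sum>j<d. f a * (u a i * x i) * (u a j * x j))"
    by (intro sum.cong refl sum.swap)
  also have "\<dots> = (\<Sum>a<d. \<Sum>i<d. \<Sum>j<d. f a * (u a i * x i) * (u a j * x j))" by (rule sum.swap)
  also have "\<dots> = (\<Sum>a<d. f a * (\<Sum>i<d. u a i * x i)\<^sup>2)"
    by (simp add: power2_eq_square sum_product sum_distrib_left mult_ac)
  finally show ?thesis .
qed

text \<open>For \<open>f = 1\<close> the spectral sum is the identity matrix, by the completeness
  half of \<open>orthonormal_system\<close>.\<close>

lemma parseval:
  assumes "orthonormal_system d u"
  shows "(\<Sum>a<d. (\<Sum>i<d. u a i * x i)\<^sup>2) = (\<Sum>i<d. (x i)\<^sup>2)"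
proof -
  have "quad {..<d} (spectral_sum d u (\<lambda>_. 1)) x = (\<Sum>i<d. \<Sum>j<d. x i * (if i = j then 1 else 0) * x j)"
    unfolding quad_def spectral_sum_def using assms
    by (intro sum.cong refl) (simp add: orthonormal_system_def)
  also have "\<dots> = (\<Sum>i<d. (x i)\<^sup>2)"
    by (intro sum.cong refl) (simp add: power2_eq_square if_distrib if_distribR cong: if_cong)
  finally show ?thesis by (simp add: quad_spectral_sum)
qed

lemma quad_spectral_sum_basis:
  assumes "orthonormal_system d u" "a < d"
  shows "quad {..<d} (spectral_sum d u f) (u a) = f a"
proof -
  have "quad {..<d} (spectral_sum d u f) (u a) = (\<Sum>b<d. f b * (if b = a then 1 else 0)\<^sup>2)"
    unfolding quad_spectral_sum using assms
    by (intro sum.cong refl) (simp add: orthonormal_system_def)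
  also have "\<dots> = f a" using assms(2) by (simp add: if_distrib if_distribR cong: if_cong)
  finally show ?thesis .
qed

lemma quad_spectral_sum_le:
  assumes "orthonormal_system d u" "\<And>a. a < d \<Longrightarrow> f a \<le> c"
  shows "quad {..<d} (spectral_sum d u f) x \<le> c * (\<Sum>i<d. (x i)\<^sup>2)"
proof -
  have "(\<Sum>i<d. (x i)\<^sup>2) = (\<Sum>a<d. (\<Sum>i<d. u a i * x i)\<^sup>2)" by (simp add: parseval[OF assms(1)])
  then show ?thesis
    unfolding quad_spectral_sum using assms(2)
    by (simp only: sum_distrib_left) (intro sum_mono mult_right_mono; simp)
qed

lemma quad_spectral_sum_ge:
  assumes "orthonormal_system d u" "\<And>a. a < d \<Longrightarrow> c \<le> f a"
  shows "c * (\<Sum>i<d. (x i)\<^sup>2) \<le> quad {..<d} (spectral_sum d u f) x"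
proof -
  have "(\<Sum>i<d. (x i)\<^sup>2) = (\<Sum>a<d. (\<Sum>i<d. u a i * x i)\<^sup>2)" by (simp add: parseval[OF assms(1)])
  then show ?thesis
    unfolding quad_spectral_sum using assms(2)
    by (simp only: sum_distrib_left) (intro sum_mono mult_right_mono; simp)
qed

lemma spectral_sum_sym: "spectral_sum d u f i j = spectral_sum d u f j i"
  by (simp add: spectral_sum_def mult_ac)

lemma op_bound_spectral_sum:
  assumes "orthonormal_system d u" "\<And>a. a < d \<Longrightarrow> \<bar>f a\<bar> \<le> c" "c \<ge> 0"
  shows "op_bound {..<d} {..<d} (spectral_sum d u f) c"
proof (rule op_boundI_quad)
  fix x
  show "\<bar>quad {..<d} (spectral_sum d u f) x\<bar> \<le> c * (\<Sum>i<d. (x i)\<^sup>2)"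
  proof -
    have "f a \<le> c" "- c \<le> f a" if "a < d" for a using assms(2)[OF that] by linarith+
    then show ?thesis
      using quad_spectral_sum_le[OF assms(1), of f c x] quad_spectral_sum_ge[OF assms(1), of "-c" f x]
      by (simp add: abs_le_iff)
  qed
qed (simp_all add: spectral_sum_sym assms(3))

lemma spectral_sum_mult:
  assumes "orthonormal_system d u" "i < d" "k < d"
  shows "(\<Sum>j<d. spectral_sum d u f i j * spectral_sum d u g j k) = spectral_sum d u (\<lambda>a. f a * g a) i k"
proof -
  have "(\<Sum>j<d. spectral_sum d u f i j * spectral_sum d u g j k)
      = (\<Sum>j<d. \<Sum>a<d. \<Sum>b<d. f a * g b * u a i * u b k * (u a j * u b j))"
    unfolding spectral_sum_def sum_product by (intro sum.cong refl) (simp add: mult_ac)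
  also have "\<dots> = (\<Sum>a<d. \<Sum>j<d. \<Sum>b<d. f a * g b * u a i * u b k * (u a j * u b j))" by (rule sum.swap)
  also have "\<dots> = (\<Sum>a<d. \<Sum>b<d. \<Sum>j<d. f a * g b * u a i * u b k * (u a j * u b j))"
    by (intro sum.cong refl sum.swap)
  also have "\<dots> = (\<Sum>a<d. \<Sum>b<d. f a * g b * u a i * u b k * (if a = b then 1 else 0))"
    using assms(1) unfolding sum_distrib_left[symmetric]
    by (intro sum.cong refl) (simp add: orthonormal_system_def)
  also have "\<dots> = spectral_sum d u (\<lambda>a. f a * g a) i k"
    unfolding spectral_sum_def by (intro sum.cong refl) (simp add: if_distrib if_distribR cong: if_cong)
  finally show ?thesis .
qed

lemma spectral_sum_one:
  assumes "orthonormal_system d u" "i < d" "j < d" "\<And>a. a < d \<Longrightarrow> f a = 1"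
  shows "spectral_sum d u f i j = (if i = j then 1 else 0)"
  using assms by (simp add: spectral_sum_def orthonormal_system_def)

lemma spectral_sum_of_mat:
  assumes U: "U \<in> carrier_mat d d" and "U\<^sup>T * U = 1\<^sub>m d" and "U * U\<^sup>T = 1\<^sub>m d"
  shows "orthonormal_system d (\<lambda>a i. U $$ (i,a))"
    and "i < d \<Longrightarrow> j < d \<Longrightarrow> (U * mat_diag d l * U\<^sup>T) $$ (i,j) = spectral_sum d (\<lambda>a i. U $$ (i,a)) l i j"
proof -
  have "(\<Sum>i<d. U $$ (i,a) * U $$ (i,b)) = (U\<^sup>T * U) $$ (a,b)" if "a < d" "b < d" for a b
    using U that by (simp add: scalar_prod_def atLeast0LessThan)
  moreover have "(\<Sum>a<d. U $$ (i,a) * U $$ (j,a)) = (U * U\<^sup>T) $$ (i,j)" if "i < d" "j < d" for i j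
    using U that by (simp add: scalar_prod_def atLeast0LessThan)
  ultimately show "orthonormal_system d (\<lambda>a i. U $$ (i,a))"
    using assms by (simp add: orthonormal_system_def)
next
  assume ij: "i < d" "j < d"
  have UD: "U * mat_diag d l = Matrix.mat d d (\<lambda>(i,j). U $$ (i,j) * l j)"
    using U by (simp add: mat_diag_mult_right)
  show "(U * mat_diag d l * U\<^sup>T) $$ (i,j) = spectral_sum d (\<lambda>a i. U $$ (i,a)) l i j"
    unfolding UD using ij U
    by (simp add: scalar_prod_def atLeast0LessThan spectral_sum_def mult_ac)
qed

lemma spectral_decomposition:
  fixes S :: "real mat"
  assumes "S \<in> carrier_mat d d" "S\<^sup>T = S"
  shows "\<exists>u l. orthonormal_system d u \<and> (\<forall>i<d. \<forall>j<d. S $$ (i,j) = spectral_sum d u l i j)"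
proof -
  obtain U l where "U \<in> carrier_mat d d" "U\<^sup>T * U = 1\<^sub>m d" "U * U\<^sup>T = 1\<^sub>m d" "S = U * mat_diag d l * U\<^sup>T"
    using spectral_theorem_real_symmetric[OF assms] by blast
  then show ?thesis using spectral_sum_of_mat[of U d] by blast
qed

text \<open>\<open>spectral_clip\<close> is a choice. The spectral theorem supplies a candidate, so
  the chosen value comes with an eigenbasis that it shares with \<open>S\<close>; all later facts
  about clipping are read off in such a basis.\<close>

lemma spectral_clip_decomposition:
  assumes S: "S \<in> carrier_mat d d" and sym: "S\<^sup>T = S"
  shows "spectral_clip \<eta> S \<in> carrier_mat d d \<and> (\<exists>u l. orthonormal_system d u \<and>
    (\<forall>i<d. \<forall>j<d. S $$ (i,j) = spectral_sum d u l i j) \<and>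
    (\<forall>i<d. \<forall>j<d. spectral_clip \<eta> S $$ (i,j) = spectral_sum d u (\<lambda>a. min (max (l a) (1 / \<eta>)) \<eta>) i j))"
proof -
  have d: "dim_row S = d" using S by simp
  obtain U0 l0 where U0: "U0 \<in> carrier_mat d d" "U0\<^sup>T * U0 = 1\<^sub>m d" "U0 * U0\<^sup>T = 1\<^sub>m d"
    "S = U0 * mat_diag d l0 * U0\<^sup>T"
    using spectral_theorem_real_symmetric[OF S sym] by blast
  have "\<exists>U l. U \<in> carrier_mat d d \<and> U\<^sup>T * U = 1\<^sub>m d \<and> U * U\<^sup>T = 1\<^sub>m d \<and>
     S = U * mat_diag d l * U\<^sup>T \<and>
     spectral_clip \<eta> S = U * mat_diag d (\<lambda>i. min (max (l i) (1 / \<eta>)) \<eta>) * U\<^sup>T"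
    unfolding spectral_clip_def d
    by (rule someI_ex, intro exI conjI) (rule U0 refl)+
  then obtain U l where
    U: "U \<in> carrier_mat d d" "U\<^sup>T * U = 1\<^sub>m d" "U * U\<^sup>T = 1\<^sub>m d" "S = U * mat_diag d l * U\<^sup>T"
    and B: "spectral_clip \<eta> S = U * mat_diag d (\<lambda>i. min (max (l i) (1 / \<eta>)) \<eta>) * U\<^sup>T"
    by (elim exE conjE)
  have "spectral_clip \<eta> S \<in> carrier_mat d d"
    unfolding B using U(1) by (intro mult_carrier_mat[of _ d d]) auto
  moreover have "\<forall>i<d. \<forall>j<d. S $$ (i,j) = spectral_sum d (\<lambda>a i. U $$ (i,a)) l i j"
    using spectral_sum_of_mat(2)[OF U(1-3)] U(4) by simp
  moreover have "\<forall>i<d. \<forall>j<d. spectral_clip \<eta> S $$ (i,j) =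
      spectral_sum d (\<lambda>a i. U $$ (i,a)) (\<lambda>a. min (max (l a) (1 / \<eta>)) \<eta>) i j"
    using spectral_sum_of_mat(2)[OF U(1-3)] B by simp
  ultimately show ?thesis using spectral_sum_of_mat(1)[OF U(1-3)] by (intro conjI exI)
qed

text \<open>Each eigenvalue \<open>l a\<close> of \<open>S\<close> is within \<open>\<epsilon>\<close> of the value in \<open>[1/\<eta>, \<eta>]\<close> that the form of
  \<open>T\<close> takes at the same eigenvector, so clipping moves it by at most \<open>\<epsilon>\<close>.\<close>

lemma spectral_clip_approx:
  assumes S: "S \<in> carrier_mat d d" and sym: "S\<^sup>T = S"
    and T: "\<And>x. 1 / \<eta> * (\<Sum>i<d. (x i)\<^sup>2) \<le> quad {..<d} T x" "\<And>x. quad {..<d} T x \<le> \<eta> * (\<Sum>i<d. (x i)\<^sup>2)"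
    and ST: "\<And>x. \<bar>quad {..<d} (\<lambda>i j. S $$ (i,j) - T i j) x\<bar> \<le> \<epsilon> * (\<Sum>i<d. (x i)\<^sup>2)"
    and e: "\<epsilon> \<ge> 0"
  shows "op_bound {..<d} {..<d} (\<lambda>i j. spectral_clip \<eta> S $$ (i,j) - S $$ (i,j)) \<epsilon>"
proof -
  obtain u l where u: "orthonormal_system d u"
    and Sl': "\<forall>i<d. \<forall>j<d. S $$ (i,j) = spectral_sum d u l i j"
    and B': "\<forall>i<d. \<forall>j<d.
      spectral_clip \<eta> S $$ (i,j) = spectral_sum d u (\<lambda>a. min (max (l a) (1 / \<eta>)) \<eta>) i j"
    using spectral_clip_decomposition[OF S sym, of \<eta>] by (elim conjE exE) (rule that; assumption)
  note Sl = Sl'[rule_format] and B = B'[rule_format]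
  define f where "f a = min (max (l a) (1 / \<eta>)) \<eta> - l a" for a
  have "\<bar>f a\<bar> \<le> \<epsilon>" if a: "a < d" for a
  proof -
    have n: "(\<Sum>i<d. (u a i)\<^sup>2) = 1" using u a by (simp add: orthonormal_system_def power2_eq_square)
    have "quad {..<d} (\<lambda>i j. S $$ (i,j) - T i j) (u a) = quad {..<d} (spectral_sum d u l) (u a) - quad {..<d} T (u a)"
      unfolding quad_def sum_subtractf[symmetric] by (intro sum.cong refl) (simp add: Sl algebra_simps)
    then have "\<bar>l a - quad {..<d} T (u a)\<bar> \<le> \<epsilon>"
      using ST[of "u a"] by (simp add: quad_spectral_sum_basis[OF u a] n)
    then show ?thesis using T(1)[of "u a"] T(2)[of "u a"] e by (auto simp: n f_def min_def max_def)
  qed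
  then have "op_bound {..<d} {..<d} (spectral_sum d u f) \<epsilon>" by (intro op_bound_spectral_sum u e)
  then show ?thesis
    by (rule op_bound_cong[THEN iffD1, rotated])
       (simp add: Sl B spectral_sum_def f_def left_diff_distrib sum_subtractf)
qed

lemma op_bound_spectral_clip:
  assumes "S \<in> carrier_mat d d" "S\<^sup>T = S" "\<eta> > 1"
  shows "op_bound {..<d} {..<d} (\<lambda>i j. spectral_clip \<eta> S $$ (i,j)) \<eta>"
proof -
  obtain u l where u: "orthonormal_system d u"
    and B': "\<forall>i<d. \<forall>j<d.
      spectral_clip \<eta> S $$ (i,j) = spectral_sum d u (\<lambda>a. min (max (l a) (1 / \<eta>)) \<eta>) i j"
    using spectral_clip_decomposition[OF assms(1,2), of \<eta>] by (elim conjE exE) (rule that; assumption)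
  note B = B'[rule_format]
  have "0 < 1 / \<eta>" using assms(3) by simp
  then have "\<bar>min (max (l a) (1 / \<eta>)) \<eta>\<bar> \<le> \<eta>" for a
    using assms(3) by linarith
  then have "op_bound {..<d} {..<d} (spectral_sum d u (\<lambda>a. min (max (l a) (1 / \<eta>)) \<eta>)) \<eta>"
    using assms(3) by (intro op_bound_spectral_sum u) auto
  then show ?thesis by (rule op_bound_cong[THEN iffD1, rotated]) (simp add: B)
qed

text \<open>Clipping keeps the eigenvalues at or above \<open>1 / \<eta>\<close>, so their
  reciprocals give an explicit inverse \<open>D\<close>. Its existence excludes \<open>None\<close>,
  and uniqueness of inverses identifies the returned \<open>C\<close> with \<open>D\<close>. Thus
  \<open>the (mat_inverse _)\<close> in the estimator is always a genuine inverse.\<close>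

lemma spectral_clip_inverse:
  assumes "S \<in> carrier_mat d d" "S\<^sup>T = S" "\<eta> > 1"
  shows "\<exists>C. mat_inverse (spectral_clip \<eta> S) = Some C \<and> C \<in> carrier_mat d d \<and>
    C * spectral_clip \<eta> S = 1\<^sub>m d \<and> (\<forall>i<d. \<forall>j<d. C $$ (i,j) = C $$ (j,i)) \<and>
    op_bound {..<d} {..<d} (\<lambda>i j. C $$ (i,j)) \<eta>"
proof -
  let ?B = "spectral_clip \<eta> S"
  obtain u l where u: "orthonormal_system d u"
    and B': "\<forall>i<d. \<forall>j<d. ?B $$ (i,j) = spectral_sum d u (\<lambda>a. min (max (l a) (1 / \<eta>)) \<eta>) i j"
    and Bc: "?B \<in> carrier_mat d d"
    using spectral_clip_decomposition[OF assms(1,2), of \<eta>] by (elim conjE exE) (rule that; assumption)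
  note B = B'[rule_format]
  define g where "g a = min (max (l a) (1 / \<eta>)) \<eta>" for a
  have "1 / \<eta> < 1" using assms(3) by simp
  then have "1 / \<eta> \<le> \<eta>" using assms(3) by linarith
  then have g: "1 / \<eta> \<le> g a" for a
    by (auto simp: g_def min_def max_def)
  have gpos: "g a > 0" for a
  proof -
    have "0 < 1 / \<eta>" using assms(3) by simp
    then show ?thesis using g[of a] by linarith
  qed
  define D where "D = Matrix.mat d d (\<lambda>(i,j). spectral_sum d u (\<lambda>a. 1 / g a) i j)"
  have D: "D \<in> carrier_mat d d" by (simp add: D_def)
  have "D * ?B = 1\<^sub>m d"
  proof (rule eq_matI)
    fix i j assume "i < dim_row (1\<^sub>m d :: real mat)" "j < dim_col (1\<^sub>m d :: real mat)"
    then have ij: "i < d" "j < d" by auto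
    have "(D * ?B) $$ (i,j) = (\<Sum>k<d. spectral_sum d u (\<lambda>a. 1 / g a) i k * spectral_sum d u g k j)"
      using ij Bc by (simp add: scalar_prod_def atLeast0LessThan D_def B g_def[abs_def])
    also have "\<dots> = spectral_sum d u (\<lambda>a. 1 / g a * g a) i j" by (rule spectral_sum_mult[OF u ij])
    also have "\<dots> = (if i = j then 1 else 0)"
      using gpos by (intro spectral_sum_one[OF u ij]) (simp add: less_imp_neq[symmetric])
    finally show "(D * ?B) $$ (i,j) = 1\<^sub>m d $$ (i,j)" using ij by simp
  qed (use Bc D in auto)
  moreover from this have "?B * D = 1\<^sub>m d" using mat_mult_left_right_inverse[OF D Bc] by simp
  ultimately have "?B \<in> Units (ring_mat TYPE(real) d ())"
    using Bc D unfolding Units_def ring_mat_def by auto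
  then obtain C where C: "mat_inverse ?B = Some C"
    using mat_inverse(1)[OF Bc, where b = "()"] by (cases "mat_inverse ?B") auto
  have C': "C * ?B = 1\<^sub>m d" "C \<in> carrier_mat d d" using mat_inverse(2)[OF Bc C] by simp_all
  have "C = D"
  proof -
    have "C = C * (?B * D)" using right_mult_one_mat[OF C'(2)] \<open>?B * D = 1\<^sub>m d\<close> by simp
    also have "\<dots> = (C * ?B) * D" by (rule assoc_mult_mat[OF C'(2) Bc D, symmetric])
    finally show ?thesis using C'(1) left_mult_one_mat[OF D] by simp
  qed
  moreover have "op_bound {..<d} {..<d} (\<lambda>i j. D $$ (i,j)) \<eta>"
  proof -
    have "\<bar>1 / g a\<bar> \<le> \<eta>" for a
      using g[of a] gpos[of a] assms(3) by (simp add: field_simps)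
    then have "op_bound {..<d} {..<d} (spectral_sum d u (\<lambda>a. 1 / g a)) \<eta>"
      using assms(3) by (intro op_bound_spectral_sum u) auto
    then show ?thesis by (rule op_bound_cong[THEN iffD1, rotated]) (simp add: D_def)
  qed
  moreover have "\<forall>i<d. \<forall>j<d. D $$ (i,j) = D $$ (j,i)" by (simp add: D_def spectral_sum_sym)
  ultimately show ?thesis using C C' by blast
qed

section \<open>Banded approximation of the precision matrix\<close>

text \<open>Each coefficient \<open>l a\<close> belongs to the spectrum, with eigenvector
  \<open>u a\<close>, so the bounds on the extreme eigenvalues become bounds on the form.\<close>

lemma precision_class_quad:
  assumes Om: "\<Omega> \<in> precision_class p \<alpha> \<eta> M"
  shows "1 / \<eta> * (\<Sum>i<p. (x i)\<^sup>2) \<le> quad {..<p} (\<lambda>i j. \<Omega> $$ (i,j)) x"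
    and "quad {..<p} (\<lambda>i j. \<Omega> $$ (i,j)) x \<le> \<eta> * (\<Sum>i<p. (x i)\<^sup>2)"
    and "\<exists>u l. orthonormal_system p u \<and> (\<forall>i<p. \<forall>j<p. \<Omega> $$ (i,j) = spectral_sum p u l i j) \<and>
      (\<forall>a<p. 1 / \<eta> \<le> l a \<and> l a \<le> \<eta>)"
proof -
  have Oc: "\<Omega> \<in> carrier_mat p p" and sym: "\<Omega>\<^sup>T = \<Omega>"
    and mn: "1 / \<eta> \<le> Min (spectrum \<Omega>)" and mx: "Max (spectrum \<Omega>) < \<eta>"
    using Om by (auto simp: precision_class_def)
  obtain u l where u: "orthonormal_system p u"
    and Ol: "\<And>i j. i < p \<Longrightarrow> j < p \<Longrightarrow> \<Omega> $$ (i,j) = spectral_sum p u l i j"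
    using spectral_decomposition[OF Oc sym] by metis
  have l: "1 / \<eta> \<le> l a \<and> l a \<le> \<eta>" if a: "a < p" for a
  proof -
    let ?v = "Matrix.vec p (u a)"
    have "(\<Sum>j<p. \<Omega> $$ (i,j) * u a j) = l a * u a i" if i: "i < p" for i
    proof -
      have "(\<Sum>j<p. \<Omega> $$ (i,j) * u a j) = (\<Sum>j<p. \<Sum>b<p. l b * u b i * (u b j * u a j))"
      proof (intro sum.cong refl)
        fix j assume "j \<in> {..<p}"
        then have j: "j < p" by simp
        show "\<Omega> $$ (i,j) * u a j = (\<Sum>b<p. l b * u b i * (u b j * u a j))"
          unfolding Ol[OF i j] spectral_sum_def sum_distrib_right by (simp add: mult.assoc)
      qed
      also have "\<dots> = (\<Sum>b<p. l b * u b i * (\<Sum>j<p. u b j * u a j))"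
        by (subst sum.swap) (simp add: sum_distrib_left)
      also have "\<dots> = (\<Sum>b<p. l b * u b i * (if b = a then 1 else 0))"
        using u a by (intro sum.cong refl) (simp add: orthonormal_system_def)
      also have "\<dots> = l a * u a i" using a by (simp add: if_distrib if_distribR cong: if_cong)
      finally show ?thesis .
    qed
    then have "\<Omega> *\<^sub>v ?v = l a \<cdot>\<^sub>v ?v"
      using Oc by (intro eq_vecI) (auto simp: scalar_prod_def atLeast0LessThan)
    moreover have "?v \<noteq> 0\<^sub>v p"
    proof
      assume z: "?v = 0\<^sub>v p"
      have "u a i = 0" if "i < p" for i using arg_cong[OF z, of "\<lambda>v. v $ i"] that by simp
      then have "(\<Sum>i<p. u a i * u a i) = 0" by simp
      then show False using u a by (simp add: orthonormal_system_def)
    qed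
    ultimately have mem: "l a \<in> spectrum \<Omega>"
      using Oc unfolding spectrum_def eigenvalue_def eigenvector_def
      by (auto intro!: exI[of _ ?v])
    have fin: "finite (spectrum \<Omega>)" by (rule card_finite_spectrum[OF Oc])
    show ?thesis using Min_le[OF fin mem] Max_ge[OF fin mem] mn mx by linarith
  qed
  have eq: "quad {..<p} (\<lambda>i j. \<Omega> $$ (i,j)) x = quad {..<p} (spectral_sum p u l) x"
    unfolding quad_def by (intro sum.cong refl) (simp add: Ol)
  show "1 / \<eta> * (\<Sum>i<p. (x i)\<^sup>2) \<le> quad {..<p} (\<lambda>i j. \<Omega> $$ (i,j)) x"
    unfolding eq using l by (intro quad_spectral_sum_ge u) auto
  show "quad {..<p} (\<lambda>i j. \<Omega> $$ (i,j)) x \<le> \<eta> * (\<Sum>i<p. (x i)\<^sup>2)"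
    unfolding eq using l by (intro quad_spectral_sum_le u) auto
  show "\<exists>u l. orthonormal_system p u \<and> (\<forall>i<p. \<forall>j<p. \<Omega> $$ (i,j) = spectral_sum p u l i j) \<and>
      (\<forall>a<p. 1 / \<eta> \<le> l a \<and> l a \<le> \<eta>)"
    by (intro exI[of _ u] exI[of _ l] conjI u) (use l Ol in auto)
qed

text \<open>Write \<open>|A i j|\<close> as
  \<open>sqrt (|A i j| * w i j) * sqrt (|A i j| / w i j)\<close> and apply Cauchy-Schwarz over all
  pairs. The weight may depend on both indices; below it is a function of the distance to the
  diagonal.\<close>

lemma weighted_schur_test:
  fixes w :: "nat \<Rightarrow> nat \<Rightarrow> real"
  assumes row: "\<And>i. i \<in> I \<Longrightarrow> (\<Sum>j\<in>J. \<bar>A i j\<bar> * w i j) \<le> c"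
    and col: "\<And>j. j \<in> J \<Longrightarrow> (\<Sum>i\<in>I. \<bar>A i j\<bar> / w i j) \<le> c"
    and w: "\<And>i j. i \<in> I \<Longrightarrow> j \<in> J \<Longrightarrow> A i j \<noteq> 0 \<Longrightarrow> w i j > 0"
    and c: "c \<ge> 0"
  shows "op_bound I J A c"
proof (rule op_boundI_bilinear[OF _ c])
  fix x y :: "nat \<Rightarrow> real"
  define f where "f = (\<lambda>(i,j). sqrt (\<bar>A i j\<bar> * w i j) * \<bar>x i\<bar>)"
  define g where "g = (\<lambda>(i,j). sqrt (\<bar>A i j\<bar> / w i j) * \<bar>y j\<bar>)"
  have "\<bar>\<Sum>i\<in>I. \<Sum>j\<in>J. x i * A i j * y j\<bar> \<le> (\<Sum>i\<in>I. \<Sum>j\<in>J. \<bar>x i * A i j * y j\<bar>)"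
    by (rule order_trans[OF sum_abs]) (intro sum_mono sum_abs)
  also have "\<dots> = (\<Sum>i\<in>I. \<Sum>j\<in>J. \<bar>f (i,j)\<bar> * \<bar>g (i,j)\<bar>)"
  proof (intro sum.cong refl)
    fix i j assume ij: "i \<in> I" "j \<in> J"
    show "\<bar>x i * A i j * y j\<bar> = \<bar>f (i,j)\<bar> * \<bar>g (i,j)\<bar>"
    proof (cases "A i j = 0")
      case False
      have "sqrt (\<bar>A i j\<bar> * w i j) * sqrt (\<bar>A i j\<bar> / w i j) = \<bar>A i j\<bar>"
        using w[OF ij False] by (simp add: real_sqrt_mult[symmetric])
      then have "\<bar>A i j\<bar> * \<bar>x i\<bar> * \<bar>y j\<bar> = sqrt (\<bar>A i j\<bar> * w i j) * sqrt (\<bar>A i j\<bar> / w i j) * \<bar>x i\<bar> * \<bar>y j\<bar>"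
        by simp
      then show ?thesis using w[OF ij False] by (simp add: f_def g_def abs_mult mult_ac)
    qed (simp add: f_def)
  qed
  also have "\<dots> = (\<Sum>z\<in>I \<times> J. \<bar>f z\<bar> * \<bar>g z\<bar>)" by (simp add: sum.cartesian_product)
  also have "\<dots> \<le> L2_set f (I \<times> J) * L2_set g (I \<times> J)" by (rule L2_set_mult_ineq)
  also have "\<dots> \<le> (sqrt c * L2_set x I) * (sqrt c * L2_set y J)"
  proof (intro mult_mono)
    have "(\<Sum>z\<in>I \<times> J. (f z)\<^sup>2) = (\<Sum>i\<in>I. \<Sum>j\<in>J. (f (i,j))\<^sup>2)" by (simp add: sum.cartesian_product)
    also have "\<dots> = (\<Sum>i\<in>I. (\<Sum>j\<in>J. \<bar>A i j\<bar> * w i j) * (x i)\<^sup>2)"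
      unfolding sum_distrib_right
    proof (intro sum.cong refl)
      fix i j assume ij: "i \<in> I" "j \<in> J"
      have "\<bar>A i j\<bar> * w i j \<ge> 0" using w[OF ij] by (cases "A i j = 0") auto
      then show "(f (i,j))\<^sup>2 = \<bar>A i j\<bar> * w i j * (x i)\<^sup>2" by (simp add: f_def power_mult_distrib)
    qed
    also have "\<dots> \<le> c * (\<Sum>i\<in>I. (x i)\<^sup>2)"
      unfolding sum_distrib_left by (intro sum_mono mult_right_mono row) auto
    finally show "L2_set f (I \<times> J) \<le> sqrt c * L2_set x I"
      by (simp add: L2_set_def real_sqrt_mult[symmetric])
    have "(\<Sum>z\<in>I \<times> J. (g z)\<^sup>2) = (\<Sum>i\<in>I. \<Sum>j\<in>J. (g (i,j))\<^sup>2)" by (simp add: sum.cartesian_product)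
    also have "\<dots> = (\<Sum>j\<in>J. \<Sum>i\<in>I. (g (i,j))\<^sup>2)" by (rule sum.swap)
    also have "\<dots> = (\<Sum>j\<in>J. (\<Sum>i\<in>I. \<bar>A i j\<bar> / w i j) * (y j)\<^sup>2)"
      unfolding sum_distrib_right
    proof (intro sum.cong refl)
      fix i j assume ij: "i \<in> I" "j \<in> J"
      have "\<bar>A i j\<bar> / w i j \<ge> 0" using w[OF ij] by (cases "A i j = 0") auto
      then show "(g (i,j))\<^sup>2 = \<bar>A i j\<bar> / w i j * (y j)\<^sup>2" by (simp add: g_def power_mult_distrib)
    qed
    also have "\<dots> \<le> c * (\<Sum>j\<in>J. (y j)\<^sup>2)"
      unfolding sum_distrib_left by (intro sum_mono mult_right_mono col) auto
    finally show "L2_set g (I \<times> J) \<le> sqrt c * L2_set y J"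
      by (simp add: L2_set_def real_sqrt_mult[symmetric])
  qed (use c in auto)
  also have "\<dots> = c * L2_set x I * L2_set y J" using c by (simp add: mult_ac)
  finally show "\<bar>\<Sum>i\<in>I. \<Sum>j\<in>J. x i * A i j * y j\<bar> \<le> c * L2_set x I * L2_set y J" .
qed

lemma powr_diff_ge:
  fixes s x :: real
  assumes "s > 0" "x > 0"
  shows "s * (x + 1) powr (- 1 - s) \<le> x powr (- s) - (x + 1) powr (- s)"
proof -
  have "\<exists>z. x < z \<and> z < x + 1 \<and> (x + 1) powr (- s) - x powr (- s) = (x + 1 - x) * ((- s) * z powr (- s - 1))"
    using assms by (intro MVT2) (auto intro!: derivative_eq_intros simp: field_simps powr_diff)
  then obtain z where z: "x < z" "z < x + 1" "(x + 1) powr (- s) - x powr (- s) = - s * z powr (- s - 1)"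
    by auto
  have "(x + 1) powr (- s - 1) \<le> z powr (- s - 1)"
    using z assms by (intro powr_mono2') auto
  then have "s * (x + 1) powr (- s - 1) \<le> s * z powr (- s - 1)" using assms by simp
  moreover have eq: "- s - 1 = - 1 - s" by simp
  ultimately show ?thesis using z(3) unfolding eq by simp
qed

text \<open>The integral test, done by telescoping \<open>powr_diff_ge\<close>. The term at
  \<open>k\<close> accounts for the 1, the telescoped rest for \<open>1 / s\<close>.\<close>

lemma sum_powr_tail_le:
  fixes s :: real
  assumes "s > 0" "k \<ge> 1"
  shows "(\<Sum>e=k..N. real e powr (- 1 - s)) \<le> (1 + 1 / s) * real k powr (- s)"
proof (cases "k \<le> N")
  case True
  have "(\<Sum>e=k..N. real e powr (- 1 - s)) \<le> real k powr (- 1 - s) + 1 / s * (real k powr (- s) - real N powr (- s))"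
    using True
  proof (induction N rule: dec_induct)
    case (step n)
    have "s * real (Suc n) powr (- 1 - s) \<le> real n powr (- s) - real (Suc n) powr (- s)"
      using powr_diff_ge[of s "real n"] assms step by (simp add: add.commute)
    then have "real (Suc n) powr (- 1 - s) \<le> 1 / s * (real n powr (- s) - real (Suc n) powr (- s))"
      using assms(1) by (simp add: field_simps)
    then show ?case using step by (simp add: algebra_simps)
  qed simp
  also have "\<dots> \<le> real k powr (- s) + 1 / s * real k powr (- s)"
    using assms by (intro add_mono powr_mono mult_left_mono) auto
  finally show ?thesis by (simp add: algebra_simps)
qed (use assms in auto)

lemma powr_div_sqrt: "x > 0 \<Longrightarrow> x powr a / sqrt x = x powr (a - 1 / 2)" for x a :: real
  by (simp add: powr_half_sqrt[symmetric] powr_diff)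

lemma sqrt_Suc_diff_le: "e \<ge> 1 \<Longrightarrow> sqrt (real (Suc e)) - sqrt (real e) \<le> 1 / sqrt (real e)"
proof -
  assume e: "e \<ge> 1"
  have "(sqrt (real (Suc e)) - sqrt (real e)) * sqrt (real e)
      \<le> (sqrt (real (Suc e)) - sqrt (real e)) * (sqrt (real (Suc e)) + sqrt (real e))"
    by (intro mult_left_mono) auto
  also have "\<dots> = 1" by (simp add: algebra_simps)
  finally show ?thesis using e by (simp add: field_simps)
qed

lemma sqrt_le_sum_inverse_sqrt:
  assumes "k \<ge> 1" "k \<le> d"
  shows "sqrt (real d) \<le> sqrt (real k) + (\<Sum>e=k..<d. 1 / sqrt (real e))"
  using assms(2)
proof (induction d rule: dec_induct)
  case (step n)
  then show ?case using sqrt_Suc_diff_le[of n] assms(1) by simp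
qed simp

text \<open>Summation by parts, since only tails of a row are controlled. The weight is at most
  \<open>sqrt k\<close> plus the sum of \<open>1 / sqrt e\<close> over
  \<open>k \<le> e < i - j\<close>; exchanging the sums produces the tails at every
  \<open>e\<close>. The \<open>sqrt k\<close> part contributes 1 to the constant, the series over
  \<open>e\<close> contributes \<open>1 + 1 / (\<alpha> - 1/2)\<close>.\<close>

lemma weighted_row_sum_le:
  fixes a :: "nat \<Rightarrow> real"
  assumes a: "\<And>j. a j \<ge> 0" and k: "k \<ge> 1" and al: "\<alpha> > 1 / 2" and M: "M \<ge> 0"
    and R: "\<And>e. e \<ge> 1 \<Longrightarrow> (\<Sum>j | j + e < i. a j) \<le> M * real e powr (- \<alpha>)"
  shows "(\<Sum>j | j + k < i. a j * sqrt (real (i - j))) \<le> M * (2 + 1 / (\<alpha> - 1 / 2)) * real k powr (1 / 2 - \<alpha>)"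
proof -
  define s where "s = \<alpha> - 1 / 2"
  have s: "s > 0" using al by (simp add: s_def)
  have fin: "finite {j. j + e < i}" for e by (rule finite_subset[of _ "{..<i}"]) auto
  have "- \<alpha> - 1 / 2 = - 1 - s" by (simp add: s_def)
  then have kk: "real e powr (- \<alpha>) / sqrt (real e) = real e powr (- 1 - s)" if "e \<ge> 1" for e
    using that powr_div_sqrt[of "real e" "- \<alpha>"] by simp
  have "(\<Sum>j | j + k < i. a j * sqrt (real (i - j)))
      \<le> (\<Sum>j | j + k < i. a j * (sqrt (real k) + (\<Sum>e=k..<i. if j + e < i then 1 / sqrt (real e) else 0)))"
  proof (intro sum_mono mult_left_mono a)
    fix j assume j: "j \<in> {j. j + k < i}"
    have "sqrt (real (i - j)) \<le> sqrt (real k) + (\<Sum>e=k..<i - j. 1 / sqrt (real e))"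
      using k j by (intro sqrt_le_sum_inverse_sqrt) auto
    also have "(\<Sum>e=k..<i - j. 1 / sqrt (real e)) = (\<Sum>e=k..<i. if j + e < i then 1 / sqrt (real e) else 0)"
      by (rule sum.mono_neutral_cong_left) auto
    finally show "sqrt (real (i - j)) \<le> sqrt (real k) + (\<Sum>e=k..<i. if j + e < i then 1 / sqrt (real e) else 0)" .
  qed
  also have "\<dots> = sqrt (real k) * (\<Sum>j | j + k < i. a j)
      + (\<Sum>j | j + k < i. \<Sum>e=k..<i. if j + e < i then a j / sqrt (real e) else 0)"
    unfolding distrib_left sum.distrib sum_distrib_left
    by (intro arg_cong2[of _ _ _ _ "(+)"] sum.cong refl) auto
  also have "(\<Sum>j | j + k < i. \<Sum>e=k..<i. if j + e < i then a j / sqrt (real e) else 0)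
      = (\<Sum>e=k..<i. \<Sum>j | j + k < i. if j + e < i then a j / sqrt (real e) else 0)" by (rule sum.swap)
  also have "\<dots> = (\<Sum>e=k..<i. (\<Sum>j | j + e < i. a j) / sqrt (real e))"
  proof (intro sum.cong refl)
    fix e assume "e \<in> {k..<i}"
    then show "(\<Sum>j | j + k < i. if j + e < i then a j / sqrt (real e) else 0) = (\<Sum>j | j + e < i. a j) / sqrt (real e)"
      unfolding sum_divide_distrib using fin by (intro sum.mono_neutral_cong_right) auto
  qed
  also have "\<dots> \<le> (\<Sum>e=k..<i. M * real e powr (- 1 - s))"
  proof (intro sum_mono)
    fix e assume "e \<in> {k..<i}"
    then have e: "e \<ge> 1" using k by auto
    have "(\<Sum>j | j + e < i. a j) / sqrt (real e) \<le> M * real e powr (- \<alpha>) / sqrt (real e)"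
      by (intro divide_right_mono R e) auto
    then show "(\<Sum>j | j + e < i. a j) / sqrt (real e) \<le> M * real e powr (- 1 - s)"
      using kk[OF e] by (simp add: mult.assoc times_divide_eq_right[symmetric] del: times_divide_eq_right)
  qed
  also have "\<dots> \<le> (\<Sum>e=k..i. M * real e powr (- 1 - s))"
    using M by (intro sum_mono2) auto
  also have "\<dots> \<le> M * ((1 + 1 / s) * real k powr (- s))"
    unfolding sum_distrib_left[symmetric] by (intro mult_left_mono sum_powr_tail_le s k M)
  also have "sqrt (real k) * (\<Sum>j | j + k < i. a j) \<le> sqrt (real k) * (M * real k powr (- \<alpha>))"
    by (intro mult_left_mono R k) auto
  also have "\<dots> = M * real k powr (- s)"
    using k by (simp add: powr_half_sqrt[symmetric] powr_add[symmetric] s_def mult_ac)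
  finally show ?thesis by (simp add: s_def algebra_simps)
qed

text \<open>A column has no summability of its own. Each entry is at most a tail of its row, of
  order \<open>e powr (- \<alpha>)\<close>, and dividing by the weight supplies the
  \<open>e powr (- 1/2)\<close> that makes these bounds summable.\<close>

lemma weighted_col_sum_le:
  fixes A :: "nat \<Rightarrow> nat \<Rightarrow> real"
  assumes k: "k \<ge> 1" and al: "\<alpha> > 1 / 2" and M: "M \<ge> 0"
    and R: "\<And>e i. e \<ge> 1 \<Longrightarrow> i < p \<Longrightarrow> (\<Sum>j | j + e < i. \<bar>A i j\<bar>) \<le> M * real e powr (- \<alpha>)"
  shows "(\<Sum>i | i < p \<and> j + k < i. \<bar>A i j\<bar> / sqrt (real (i - j)))
    \<le> M * (2 + 1 / (\<alpha> - 1 / 2)) * real k powr (1 / 2 - \<alpha>)"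
proof -
  define s where "s = \<alpha> - 1 / 2"
  have s: "s > 0" using al by (simp add: s_def)
  have "(\<Sum>i | i < p \<and> j + k < i. \<bar>A i j\<bar> / sqrt (real (i - j)))
      \<le> (\<Sum>i | i < p \<and> j + k < i. M * real (i - j - 1) powr (- 1 - s))"
  proof (intro sum_mono)
    fix i assume i: "i \<in> {i. i < p \<and> j + k < i}"
    \<comment> \<open>The largest \<open>e\<close> with \<open>j + e < i\<close>, so that the tail
      at \<open>e\<close> still contains the entry at \<open>j\<close>. It is at least
      \<open>k\<close>, hence positive.\<close>
    define e where "e = i - j - 1"
    have e: "e \<ge> 1" "j + e < i" "e \<le> i - j" using i k by (auto simp: e_def)
    have fin: "finite {j. j + e < i}" for e by (rule finite_subset[of _ "{..<i}"]) auto
    have "\<bar>A i j\<bar> \<le> (\<Sum>j | j + e < i. \<bar>A i j\<bar>)"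
      using e fin by (intro member_le_sum[of j "{j. j + e < i}" "\<lambda>j. \<bar>A i j\<bar>"]) auto
    also have "\<dots> \<le> M * real e powr (- \<alpha>)" using i e by (intro R) auto
    finally have "\<bar>A i j\<bar> / sqrt (real (i - j)) \<le> (M * real e powr (- \<alpha>)) / sqrt (real e)"
      using e M by (intro frac_le) auto
    also have "\<dots> = M * (real e powr (- \<alpha>) / sqrt (real e))" by simp
    also have "real e powr (- \<alpha>) / sqrt (real e) = real e powr (- \<alpha> - 1 / 2)"
      using e by (intro powr_div_sqrt) auto
    also have "- \<alpha> - 1 / 2 = - 1 - s" by (simp add: s_def)
    finally show "\<bar>A i j\<bar> / sqrt (real (i - j)) \<le> M * real (i - j - 1) powr (- 1 - s)" by (simp add: e_def)
  qed
  also have "\<dots> = (\<Sum>e\<in>(\<lambda>i. i - j - 1) ` {i. i < p \<and> j + k < i}. M * real e powr (- 1 - s))"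
    by (subst sum.reindex) (auto simp: inj_on_def)
  also have "\<dots> \<le> (\<Sum>e=k..p. M * real e powr (- 1 - s))"
    using M by (intro sum_mono2) auto
  also have "\<dots> \<le> M * ((1 + 1 / s) * real k powr (- s))"
    unfolding sum_distrib_left[symmetric] by (intro mult_left_mono sum_powr_tail_le s k M)
  also have "\<dots> \<le> M * ((2 + 1 / s) * real k powr (- s))"
    using M by (intro mult_left_mono mult_right_mono) auto
  finally show ?thesis by (simp add: s_def mult.assoc)
qed

text \<open>The weight \<open>sqrt (i - j)\<close> balances the rows, whose tail sums decay by hypothesis, against
  the columns, where only the single entries are controlled.\<close>

lemma op_bound_off_band:
  fixes A :: "nat \<Rightarrow> nat \<Rightarrow> real"
  assumes k: "k \<ge> 1" and al: "\<alpha> > 1 / 2" and M: "M \<ge> 0"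
    and R: "\<And>e i. e \<ge> 1 \<Longrightarrow> i < p \<Longrightarrow> (\<Sum>j | j + e < i. \<bar>A i j\<bar>) \<le> M * real e powr (- \<alpha>)"
  shows "op_bound {..<p} {..<p} (\<lambda>i j. if j + k < i then A i j else 0)
    (M * (2 + 1 / (\<alpha> - 1 / 2)) * real k powr (1 / 2 - \<alpha>))"
proof (rule weighted_schur_test[where w = "\<lambda>i j. sqrt (real (i - j))"])
  fix i assume "i \<in> {..<p}"
  then have i: "i < p" by simp
  have "(\<Sum>j<p. \<bar>if j + k < i then A i j else 0\<bar> * sqrt (real (i - j))) = (\<Sum>j | j + k < i. \<bar>A i j\<bar> * sqrt (real (i - j)))"
    using i by (intro sum.mono_neutral_cong_right) auto
  also have "\<dots> \<le> M * (2 + 1 / (\<alpha> - 1 / 2)) * real k powr (1 / 2 - \<alpha>)"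
    using i by (intro weighted_row_sum_le k al M R) auto
  finally show "(\<Sum>j<p. \<bar>if j + k < i then A i j else 0\<bar> * sqrt (real (i - j)))
    \<le> M * (2 + 1 / (\<alpha> - 1 / 2)) * real k powr (1 / 2 - \<alpha>)" .
next
  fix j
  have "(\<Sum>i<p. \<bar>if j + k < i then A i j else 0\<bar> / sqrt (real (i - j)))
      = (\<Sum>i | i < p \<and> j + k < i. \<bar>A i j\<bar> / sqrt (real (i - j)))"
    by (intro sum.mono_neutral_cong_right) auto
  also have "\<dots> \<le> M * (2 + 1 / (\<alpha> - 1 / 2)) * real k powr (1 / 2 - \<alpha>)"
    by (intro weighted_col_sum_le k al M R)
  finally show "(\<Sum>i<p. \<bar>if j + k < i then A i j else 0\<bar> / sqrt (real (i - j)))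
    \<le> M * (2 + 1 / (\<alpha> - 1 / 2)) * real k powr (1 / 2 - \<alpha>)" .
qed (use M al in \<open>auto split: if_splits\<close>)

lemma cholesky_entries:
  assumes "cholesky_decomp p \<Omega> A d" "i < p" "j < p"
  shows "\<Omega> $$ (i,j) = (\<Sum>l<p. (of_bool (l = i) - A $$ (l,i)) * (of_bool (l = j) - A $$ (l,j)) / d l)"
proof -
  have A: "A \<in> carrier_mat p p"
    and Om: "\<Omega> = (1\<^sub>m p - A)\<^sup>T * mat_diag p (\<lambda>i. 1 / d i) * (1\<^sub>m p - A)"
    using assms(1) by (auto simp: cholesky_decomp_def)
  have "(1\<^sub>m p - A)\<^sup>T * mat_diag p (\<lambda>i. 1 / d i)
      = Matrix.mat p p (\<lambda>(i,j). (1\<^sub>m p - A)\<^sup>T $$ (i,j) * (1 / d j))"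
    using A by (intro mat_diag_mult_right) auto
  then show ?thesis
    unfolding Om using A assms(2,3)
    by (simp add: scalar_prod_def atLeast0LessThan)
       (intro sum.cong refl, auto)
qed

text \<open>With \<open>G = D^(-1/2) (I - A)\<close> one has \<open>\<Omega> = G^T G\<close>, and
  \<open>E\<close> is the correction that removes the far entries of \<open>A\<close> from
  \<open>G\<close>. Both have norms controlled through \<open>\<eta>\<close>: the form of
  \<open>\<Omega>\<close> bounds \<open>G\<close>, and its diagonal bounds
  \<open>1 / d\<close>.\<close>

lemma banded_approximation:
  assumes Om: "\<Omega> \<in> precision_class p \<alpha> \<eta> M" and k: "k \<ge> 1" and al: "\<alpha> > 1 / 2" and M: "M > 0" and eta: "\<eta> > 1"
    and c0: "c0 = M * (2 + 1 / (\<alpha> - 1 / 2))"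
  shows "\<exists>B. (\<forall>i<p. \<forall>j<p. i + k < j \<or> j + k < i \<longrightarrow> B i j = 0) \<and>
    op_bound {..<p} {..<p} (\<lambda>i j. \<Omega> $$ (i,j) - B i j) (\<eta> * c0 * (2 + c0) * real k powr (1 / 2 - \<alpha>))"
proof -
  obtain A d where ch: "cholesky_decomp p \<Omega> A d"
    and mx: "\<And>k. k \<in> {1..p} \<Longrightarrow> Max ((\<lambda>i. \<Sum>j | j + k < i. \<bar>A $$ (i,j)\<bar>) ` {..<p}) < M * real k powr (- \<alpha>)"
    using Om unfolding precision_class_def by blast
  have lower: "\<And>i j. i < p \<Longrightarrow> j < p \<Longrightarrow> i \<le> j \<Longrightarrow> A $$ (i,j) = 0" and d: "\<And>i. i < p \<Longrightarrow> d i > 0"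
    using ch by (auto simp: cholesky_decomp_def)
  \<comment> \<open>The class speaks of distances up to \<open>p\<close> only; beyond that the tails
    are empty.\<close>
  have R: "(\<Sum>j | j + e < i. \<bar>A $$ (i,j)\<bar>) \<le> M * real e powr (- \<alpha>)" if "e \<ge> 1" "i < p" for e i
  proof (cases "e \<le> p")
    case True
    have "(\<Sum>j | j + e < i. \<bar>A $$ (i,j)\<bar>) \<le> Max ((\<lambda>i. \<Sum>j | j + e < i. \<bar>A $$ (i,j)\<bar>) ` {..<p})"
      using that by (intro Max_ge) auto
    also have "\<dots> < M * real e powr (- \<alpha>)" using True that by (intro mx) auto
    finally show ?thesis by simp
  next
    case False
    then have "{j. j + e < i} = {}" using that by auto
    then show ?thesis using M by simp
  qed
  define c where "c = c0 * real k powr (1 / 2 - \<alpha>)"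
  have c0_pos: "c0 > 0" using M al by (simp add: c0 add_pos_pos)
  \<comment> \<open>\<open>c \<le> c0\<close> lets the quadratic error \<open>c * c\<close> be
    absorbed into the linear order, which gives the factor \<open>2 + c0\<close>.\<close>
  have "real k powr (1 / 2 - \<alpha>) \<le> real k powr 0" using k al by (intro powr_mono) auto
  then have c: "c \<ge> 0" "c \<le> c0"
    using c0_pos k by (auto simp: c_def mult_le_cancel_left2)
  define L where "L l i = of_bool (l = i) - A $$ (l,i)" for l i
  define A2 where "A2 l i = (if i + k < l then A $$ (l,i) else 0)" for l i
  define L1 where "L1 l i = L l i + A2 l i" for l i
  define G where "G l i = L l i / sqrt (d l)" for l i
  define E where "E l i = A2 l i / sqrt (d l)" for l i
  define B where "B i j = (\<Sum>l<p. (G l i + E l i) * (G l j + E l j))" for i j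
  let ?P = "{..<p}"
  have OmG: "\<Omega> $$ (i,j) = (\<Sum>l<p. G l i * G l j)" if "i < p" "j < p" for i j
    unfolding cholesky_entries[OF ch that]
    by (intro sum.cong refl) (use d in \<open>auto simp: G_def L_def real_sqrt_mult[symmetric] less_imp_le\<close>)
  \<comment> \<open>The unit diagonal of \<open>I - A\<close> makes \<open>1 / d i\<close> one of
    the squares that add up to the diagonal entry of \<open>\<Omega>\<close>.\<close>
  have dinv: "1 / d i \<le> \<eta>" if i: "i < p" for i
  proof -
    have "1 / d i = (G i i)\<^sup>2" using d[OF i] lower[OF i i] by (simp add: G_def L_def power_divide)
    also have "\<dots> \<le> (\<Sum>l<p. (G l i)\<^sup>2)" using i by (intro member_le_sum) auto
    also have "\<dots> = \<Omega> $$ (i,i)" using OmG[OF i i] by (simp add: power2_eq_square)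
    also have "\<dots> = quad ?P (\<lambda>i j. \<Omega> $$ (i,j)) (\<lambda>j. if j = i then 1 else 0)"
      using i by (simp add: quad_def if_distrib[of "\<lambda>x. x * _"] if_distrib[of "\<lambda>x. _ * x"] cong: if_cong)
    also have "\<dots> \<le> \<eta> * (\<Sum>j<p. (if j = i then 1 else 0)\<^sup>2)" by (rule precision_class_quad(2)[OF Om])
    also have "\<dots> = \<eta>" using i by (simp add: if_distrib[of "\<lambda>x. x\<^sup>2"] cong: if_cong)
    finally show ?thesis .
  qed
  have G: "op_bound ?P ?P G (sqrt \<eta>)"
    unfolding op_bound_def
  proof
    fix x :: "nat \<Rightarrow> real"
    have "(\<Sum>l<p. (\<Sum>i<p. G l i * x i)\<^sup>2) = (\<Sum>l<p. \<Sum>i<p. \<Sum>j<p. x i * (G l i * G l j) * x j)"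
      by (simp add: power2_eq_square sum_product mult_ac)
    also have "\<dots> = (\<Sum>i<p. \<Sum>l<p. \<Sum>j<p. x i * (G l i * G l j) * x j)" by (rule sum.swap)
    also have "\<dots> = (\<Sum>i<p. \<Sum>j<p. \<Sum>l<p. x i * (G l i * G l j) * x j)" by (intro sum.cong refl sum.swap)
    also have "\<dots> = quad ?P (\<lambda>i j. \<Omega> $$ (i,j)) x"
      unfolding quad_def by (intro sum.cong refl) (simp add: OmG sum_distrib_left sum_distrib_right)
    also have "\<dots> \<le> \<eta> * (\<Sum>i<p. (x i)\<^sup>2)" by (rule precision_class_quad(2)[OF Om])
    finally show "L2_set (\<lambda>l. \<Sum>i<p. G l i * x i) ?P \<le> sqrt \<eta> * L2_set x ?P"
      by (simp add: L2_set_def real_sqrt_mult[symmetric])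
  qed
  have A2: "op_bound ?P ?P A2 c"
    using op_bound_off_band[OF k al _ R, of p] M unfolding A2_def[abs_def] c_def c0 by simp
  have E: "op_bound ?P ?P E (sqrt \<eta> * c)"
    unfolding op_bound_def
  proof
    fix x :: "nat \<Rightarrow> real"
    have "(\<Sum>l<p. (\<Sum>i<p. E l i * x i)\<^sup>2) = (\<Sum>l<p. 1 / d l * (\<Sum>i<p. A2 l i * x i)\<^sup>2)"
    proof (intro sum.cong refl)
      fix l assume "l \<in> {..<p}"
      then have "(\<Sum>i<p. E l i * x i) = (\<Sum>i<p. A2 l i * x i) / sqrt (d l)" "d l > 0"
        using d by (auto simp: E_def sum_divide_distrib)
      then show "(\<Sum>i<p. E l i * x i)\<^sup>2 = 1 / d l * (\<Sum>i<p. A2 l i * x i)\<^sup>2" by (simp add: power_divide)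
    qed
    also have "\<dots> \<le> \<eta> * (\<Sum>l<p. (\<Sum>i<p. A2 l i * x i)\<^sup>2)"
      unfolding sum_distrib_left using dinv by (intro sum_mono mult_right_mono) auto
    finally have "L2_set (\<lambda>l. \<Sum>i<p. E l i * x i) ?P \<le> sqrt \<eta> * L2_set (\<lambda>l. \<Sum>i<p. A2 l i * x i) ?P"
      by (simp add: L2_set_def real_sqrt_mult[symmetric])
    also have "\<dots> \<le> sqrt \<eta> * (c * L2_set x ?P)"
      using eta by (intro mult_left_mono op_boundD[OF A2]) auto
    finally show "L2_set (\<lambda>l. \<Sum>i<p. E l i * x i) ?P \<le> sqrt \<eta> * c * L2_set x ?P" by simp
  qed
  have Gt: "op_bound ?P ?P (\<lambda>i l. G l i) (sqrt \<eta>)" and Et: "op_bound ?P ?P (\<lambda>i l. E l i) (sqrt \<eta> * c)"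
    using op_bound_transpose[OF G] op_bound_transpose[OF E] eta c by auto
  have c1: "0 \<le> sqrt \<eta> * c" and e1: "0 \<le> sqrt \<eta>" using eta c by auto
  \<comment> \<open>Since \<open>B = (G + E)^T (G + E)\<close>, the difference
    \<open>\<Omega> - B\<close> is minus the two mixed products and the square of
    \<open>E\<close>.\<close>
  have "op_bound ?P ?P (\<lambda>i j. -1 * (((\<Sum>l<p. G l i * E l j) + (\<Sum>l<p. E l i * G l j)) + (\<Sum>l<p. E l i * E l j)))
    (\<bar>-1\<bar> * ((sqrt \<eta> * (sqrt \<eta> * c) + sqrt \<eta> * c * sqrt \<eta>) + sqrt \<eta> * c * (sqrt \<eta> * c)))"
    by (rule op_bound_cmult[OF op_bound_add[OF op_bound_add[OF op_bound_comp[OF Gt E e1] op_bound_comp[OF Et G c1]]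
        op_bound_comp[OF Et E c1]]])
  also have "\<bar>-1\<bar> * ((sqrt \<eta> * (sqrt \<eta> * c) + sqrt \<eta> * c * sqrt \<eta>) + sqrt \<eta> * c * (sqrt \<eta> * c)) = \<eta> * c * (2 + c)"
    using eta by (simp add: algebra_simps flip: power2_eq_square)
  finally have "op_bound ?P ?P (\<lambda>i j. \<Omega> $$ (i,j) - B i j) (\<eta> * c * (2 + c))"
    by (rule op_bound_cong[THEN iffD1, rotated])
       (simp add: OmG B_def distrib_left distrib_right sum.distrib)
  moreover have "\<eta> * c * (2 + c) \<le> \<eta> * c0 * (2 + c0) * real k powr (1 / 2 - \<alpha>)"
  proof -
    have "\<eta> * c * (2 + c) \<le> \<eta> * c * (2 + c0)" using c eta by (intro mult_left_mono) auto
    also have "\<dots> = \<eta> * c0 * (2 + c0) * real k powr (1 / 2 - \<alpha>)" by (simp add: c_def)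
    finally show ?thesis .
  qed
  ultimately have nearB: "op_bound ?P ?P (\<lambda>i j. \<Omega> $$ (i,j) - B i j) (\<eta> * c0 * (2 + c0) * real k powr (1 / 2 - \<alpha>))"
    by (rule op_bound_mono)
  have band: "B i j = 0" if ij: "i < p" "j < p" "i + k < j" for i j
    unfolding B_def
  proof (intro sum.neutral ballI)
    fix l assume "l \<in> {..<p}"
    then have l: "l < p" by simp
    \<comment> \<open>Column \<open>i\<close> of the cut factor lives in the rows from
      \<open>i\<close> to \<open>i + k\<close>, column \<open>j\<close> in the rows from
      \<open>j\<close> on; as \<open>i + k < j\<close>, no row meets both.\<close>
    have "G l i + E l i = 0 \<or> G l j + E l j = 0"
    proof (cases "i + k < l")
      case True
      then show ?thesis by (simp add: G_def E_def L_def A2_def flip: add_divide_distrib)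
    next
      case False
      then show ?thesis using ij l lower[of l j] by (simp add: G_def E_def L_def A2_def)
    qed
    then show "(G l i + E l i) * (G l j + E l j) = 0" by auto
  qed
  have sym: "B i j = B j i" for i j unfolding B_def by (simp add: mult.commute)
  have "\<forall>i<p. \<forall>j<p. i + k < j \<or> j + k < i \<longrightarrow> B i j = 0" using band sym by metis
  then show ?thesis using nearB by (intro exI[of _ B] conjI)
qed

section \<open>Error of the cropping estimator\<close>

text \<open>For \<open>p \<ge> 1\<close> there is a unit vector, and \<open>c\<close> bounds the
  set, so the supremum in \<open>op_norm\<close> is a true one and not a default value.\<close>

lemma op_norm_le:
  assumes M: "M \<in> carrier_mat p p" and p: "p \<ge> 1"
    and b: "op_bound {..<p} {..<p} (\<lambda>i j. M $$ (i,j)) c"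
  shows "0 \<le> op_norm M" "op_norm M \<le> c"
proof -
  have le: "sqrt ((M *\<^sub>v v) \<bullet> (M *\<^sub>v v)) \<le> c" if v: "v \<in> unit_vecs p" for v
  proof -
    have vc: "v \<in> carrier_vec p" "v \<bullet> v = 1" using v by (auto simp: unit_vecs_def)
    have "L2_set (\<lambda>i. v $ i) {..<p} = 1"
      using vc by (simp add: L2_set_def scalar_prod_def atLeast0LessThan power2_eq_square)
    moreover have "sqrt ((M *\<^sub>v v) \<bullet> (M *\<^sub>v v)) = L2_set (\<lambda>i. \<Sum>j<p. M $$ (i,j) * v $ j) {..<p}"
      using M vc(1) by (simp add: L2_set_def scalar_prod_def atLeast0LessThan power2_eq_square)
    ultimately show ?thesis using op_boundD[OF b, of "\<lambda>i. v $ i"] by simp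
  qed
  have u: "unit_vec p 0 \<in> unit_vecs p" using p by (simp add: unit_vecs_def)
  have d: "dim_col M = p" using M by simp
  show "op_norm M \<le> c" unfolding op_norm_def d using u le by (intro cSUP_least) auto
  have "0 \<le> (M *\<^sub>v unit_vec p 0) \<bullet> (M *\<^sub>v unit_vec p 0)"
    by (auto simp: scalar_prod_def intro!: sum_nonneg)
  then have "0 \<le> sqrt ((M *\<^sub>v unit_vec p 0) \<bullet> (M *\<^sub>v unit_vec p 0))" by simp
  also have "\<dots> \<le> op_norm M"
    unfolding op_norm_def d using u le by (intro cSUP_upper bdd_aboveI2)
  finally show "0 \<le> op_norm M" .
qed

section \<open>Positions inside an index set and submatrices\<close>

lemma pos_bij:
  assumes "finite J"
  shows "bij_betw (pos J) J {..<card J}"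
proof -
  have inj: "inj_on (pos J) J"
    by (rule inj_onI) (metis pick_card_in_set pos_def)
  have "pos J ` J \<subseteq> {..<card J}"
  proof
    fix y assume "y \<in> pos J ` J"
    then obtain i where i: "i \<in> J" "y = pos J i" by auto
    have "{a \<in> J. a < i} \<subset> J" using i by auto
    then show "y \<in> {..<card J}" using assms i by (simp add: pos_def psubset_card_mono)
  qed
  then have "pos J ` J = {..<card J}"
    using inj by (intro card_subset_eq) (auto simp: card_image)
  then show ?thesis using inj by (simp add: bij_betw_def)
qed

lemma sum_pos: "finite J \<Longrightarrow> (\<Sum>i<card J. f i) = (\<Sum>r\<in>J. f (pos J r))"
  using sum.reindex_bij_betw[OF pos_bij[of J], of f] by simp

lemma quad_pos:
  "finite J \<Longrightarrow> quad {..<card J} A x = quad J (\<lambda>r s. A (pos J r) (pos J s)) (\<lambda>r. x (pos J r))"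
  by (simp add: quad_def sum_pos)

lemma op_bound_pos:
  assumes J: "finite J" and b: "op_bound {..<card J} {..<card J} A c"
  shows "op_bound J J (\<lambda>r s. A (pos J r) (pos J s)) c"
  unfolding op_bound_def
proof
  fix x :: "nat \<Rightarrow> real"
  define y where "y = x \<circ> inv_into J (pos J)"
  have y: "y (pos J r) = x r" if "r \<in> J" for r
    using pos_bij[OF J] that by (simp add: y_def bij_betw_def)
  show "L2_set (\<lambda>i. \<Sum>j\<in>J. A (pos J i) (pos J j) * x j) J \<le> c * L2_set x J"
    using op_boundD[OF b, of y] J by (simp add: L2_set_def sum_pos y cong: sum.cong)
qed

lemma quad_subset:
  assumes "J \<subseteq> P" "finite P"
  shows "quad J A x = quad P A (\<lambda>i. if i \<in> J then x i else 0)"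
  unfolding quad_def
proof -
  have "(\<Sum>j\<in>J. x i * A i j * x j) = (\<Sum>j\<in>P. x i * A i j * (if j \<in> J then x j else 0))" for i
    using assms by (intro sum.mono_neutral_cong_left) auto
  then show "(\<Sum>i\<in>J. \<Sum>j\<in>J. x i * A i j * x j) =
    (\<Sum>i\<in>P. \<Sum>j\<in>P. (if i \<in> J then x i else 0) * A i j * (if j \<in> J then x j else 0))"
    using assms by (intro sum.mono_neutral_cong_left) auto
qed

lemma sum_sq_subset:
  assumes "J \<subseteq> P" "finite P"
  shows "(\<Sum>i\<in>J. (x i)\<^sup>2) = (\<Sum>i\<in>P. (if i \<in> J then x i else (0::real))\<^sup>2)"
  using assms by (intro sum.mono_neutral_cong_left) auto

lemma finite_window [simp]: "finite (window p l u)"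
  by (rule finite_subset[of _ "{..<p}"]) (auto simp: window_def)

lemma window_subset: "window p l u \<subseteq> {..<p}"
  by (auto simp: window_def)

text \<open>The estimator takes submatrices twice, on \<open>J\<close> and then on the positions of
  \<open>I\<close> inside \<open>J\<close>. As \<open>pos J\<close> is strictly increasing on
  \<open>J\<close>, the two renumberings compose to the one of \<open>I\<close>.\<close>

lemma pos_image_entry:
  assumes IJ: "I \<subseteq> J" "finite J" and r: "r \<in> I"
  shows "pos (pos J ` I) (pos J r) = pos I r"
proof -
  have less: "pos J a < pos J b \<longleftrightarrow> a < b" if "a \<in> J" "b \<in> J" for a b
  proof -
    have "pos J a < pos J b" if "a < b" "a \<in> J" for a b
      unfolding pos_def using that IJ(2) by (intro psubset_card_mono) auto
    then show ?thesis using that by (metis less_asym linorder_neqE_nat)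
  qed
  have inj: "inj_on (pos J) I" using pos_bij[OF IJ(2)] IJ(1) by (auto simp: bij_betw_def intro: inj_on_subset)
  have "{a \<in> pos J ` I. a < pos J r} = pos J ` {a \<in> I. a < r}"
    using less IJ r by auto
  then show ?thesis
    using inj by (simp add: pos_def[of "pos J ` I"] pos_def[of I] card_image inj_on_subset[of "pos J" I])
qed

lemma submatrix_pos:
  assumes S: "S \<in> carrier_mat p p" and J: "J \<subseteq> {..<p}"
  shows "submatrix S J J \<in> carrier_mat (card J) (card J)"
    and "r \<in> J \<Longrightarrow> s \<in> J \<Longrightarrow> submatrix S J J $$ (pos J r, pos J s) = S $$ (r,s)"
proof -
  have "{i. i < p \<and> i \<in> J} = J" using J by auto
  then show "submatrix S J J \<in> carrier_mat (card J) (card J)"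
    using S by (intro carrier_matI) (simp_all add: dim_submatrix)
  show "submatrix S J J $$ (pos J r, pos J s) = S $$ (r,s)" if "r \<in> J" "s \<in> J"
    unfolding pos_def using S J that by (intro submatrix_index_card) auto
qed

lemma sym_of_pos:
  assumes A: "A \<in> carrier_mat (card J) (card J)" and J: "finite J"
    and "\<And>r s. r \<in> J \<Longrightarrow> s \<in> J \<Longrightarrow> A $$ (pos J r, pos J s) = A $$ (pos J s, pos J r)"
  shows "A\<^sup>T = A"
proof (rule eq_matI)
  fix i j assume "i < dim_row A" "j < dim_col A"
  then have ij: "i \<in> pos J ` J" "j \<in> pos J ` J" using A pos_bij[OF J] by (auto simp: bij_betw_def)
  then show "A\<^sup>T $$ (i,j) = A $$ (i,j)" using assms(3) A \<open>i < dim_row A\<close> \<open>j < dim_col A\<close> by auto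
qed (use A in auto)

text \<open>Brings the embedded block back to the original indices, in which blocks of different
  windows are compared.\<close>

lemma local_precision_entry:
  fixes p b :: nat and m :: int
  defines "J \<equiv> window p (m - int b) (m + 2 * int b - 1)"
    and "I \<equiv> window p m (m + int b - 1)"
  assumes C: "mat_inverse (spectral_clip \<eta> (submatrix S J J)) = Some C" "C \<in> carrier_mat (card J) (card J)"
    and r: "r < p" and s: "s < p"
  shows "embed_block p b m (local_precision \<eta> p S b m) $$ (r,s) =
    (if r \<in> I \<and> s \<in> I then C $$ (pos J r, pos J s) else 0)"
proof -
  have IJ: "I \<subseteq> J" by (auto simp: I_def J_def window_def)
  have J: "finite J" by (simp add: J_def)
  have lp: "local_precision \<eta> p S b m = submatrix C (pos J ` I) (pos J ` I)"
    using C(1) by (simp add: local_precision_def Let_def J_def I_def)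
  have sub: "pos J ` I \<subseteq> {..<card J}" using pos_bij[OF J] IJ by (auto simp: bij_betw_def)
  have "submatrix C (pos J ` I) (pos J ` I) $$ (pos I r, pos I s) = C $$ (pos J r, pos J s)"
    if "r \<in> I" "s \<in> I"
    using submatrix_pos(2)[OF C(2) sub, of "pos J r" "pos J s"] that
    by (simp add: pos_image_entry[OF IJ J])
  then show ?thesis using r s by (simp add: embed_block_def Let_def lp I_def[symmetric])
qed

text \<open>The deterministic half of the argument: \<open>Sg\<close> is the covariance,
  \<open>Om\<close> its inverse and \<open>B\<close> the banded approximation. Neither a law nor a
  Cholesky factor enters.\<close>

locale local_cropping =
  fixes p k :: nat and \<eta> \<delta> :: real and Om Sg B :: "nat \<Rightarrow> nat \<Rightarrow> real"
  assumes eta: "\<eta> > 1" and k: "k \<ge> 1" and delta: "\<delta> \<ge> 0"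
    and Sg_sym: "\<And>i j. i < p \<Longrightarrow> j < p \<Longrightarrow> Sg i j = Sg j i"
    and Sg_ge: "\<And>x. 1 / \<eta> * (\<Sum>i<p. (x i)\<^sup>2) \<le> quad {..<p} Sg x"
    and Sg_le: "\<And>x. quad {..<p} Sg x \<le> \<eta> * (\<Sum>i<p. (x i)\<^sup>2)"
    and Sg_Om: "\<And>i j. i < p \<Longrightarrow> j < p \<Longrightarrow> (\<Sum>l<p. Sg i l * Om l j) = (if i = j then 1 else 0)"
    and Om: "op_bound {..<p} {..<p} Om \<eta>"
    and band: "\<And>i j. i < p \<Longrightarrow> j < p \<Longrightarrow> i + k < j \<or> j + k < i \<Longrightarrow> B i j = 0"
    and near: "op_bound {..<p} {..<p} (\<lambda>i j. Om i j - B i j) \<delta>"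
begin

lemma Sg: "op_bound {..<p} {..<p} Sg \<eta>"
proof (rule op_boundI_quad)
  fix x
  have "0 \<le> 1 / \<eta> * (\<Sum>i<p. (x i)\<^sup>2)" using eta by (intro mult_nonneg_nonneg sum_nonneg) auto
  then show "\<bar>quad {..<p} Sg x\<bar> \<le> \<eta> * (\<Sum>i<p. (x i)\<^sup>2)" using Sg_ge[of x] Sg_le[of x] by linarith
qed (use eta Sg_sym in auto)

lemma B: "op_bound {..<p} {..<p} B (\<eta> + \<delta>)"
  using op_bound_diff[OF Om near] by simp

text \<open>The first summand bounds the effect of the local covariance error: an inverse of norm at
  most \<open>\<eta>\<close>, an error of at most \<open>2 * \<epsilon>\<close> from sampling and
  clipping, and \<open>B\<close> of norm at most \<open>\<eta> + \<delta>\<close>. The second bounds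
  the effect of replacing \<open>Om\<close> by \<open>B\<close>, multiplied by that inverse and by
  \<open>Sg\<close>.\<close>

definition local_error :: "real \<Rightarrow> real" where
  "local_error \<epsilon> = \<eta> * (2 * \<epsilon> * (\<eta> + \<delta>)) + \<eta> * (\<eta> * \<delta>)"

text \<open>With \<open>C\<close> the inverse of the clipped local covariance \<open>T\<close>, one has
  \<open>C - B = C (\<Sigma> - T) B + C \<Sigma> (\<Omega> - B)\<close> on the columns in \<open>I\<close>, because these columns of the
  banded matrix \<open>B\<close> are supported in \<open>J\<close>.\<close>

lemma local_precision_error:
  fixes b :: nat and m :: int
  defines "J \<equiv> window p (m - int b) (m + 2 * int b - 1)"
    and "I \<equiv> window p m (m + int b - 1)"
  assumes S: "S \<in> carrier_mat p p" and sym: "\<And>i j. i < p \<Longrightarrow> j < p \<Longrightarrow> S $$ (i,j) = S $$ (j,i)"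
    and b: "k \<le> b" and eps: "\<epsilon> \<ge> 0"
    and dev: "\<And>x. \<bar>quad J (\<lambda>i j. S $$ (i,j) - Sg i j) x\<bar> \<le> \<epsilon> * (\<Sum>i\<in>J. (x i)\<^sup>2)"
  shows "op_bound I I (\<lambda>r s. embed_block p b m (local_precision \<eta> p S b m) $$ (r,s) - B r s) (local_error \<epsilon>)"
    and "r < p \<Longrightarrow> s < p \<Longrightarrow> embed_block p b m (local_precision \<eta> p S b m) $$ (r,s) =
      embed_block p b m (local_precision \<eta> p S b m) $$ (s,r)"
    and "r < p \<Longrightarrow> s < p \<Longrightarrow> \<not> (r \<in> I \<and> s \<in> I) \<Longrightarrow>
      embed_block p b m (local_precision \<eta> p S b m) $$ (r,s) = 0"
proof -
  let ?P = "{..<p}"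
  have IJ: "I \<subseteq> J" and JP: "J \<subseteq> ?P" and IP: "I \<subseteq> ?P" by (auto simp: I_def J_def window_def)
  have fin: "finite J" "finite I" by (simp_all add: J_def I_def)
  define SJ where "SJ = submatrix S J J"
  define d where "d = card J"
  note SJ = submatrix_pos[OF S JP, folded SJ_def d_def]
  have SJ_sym: "SJ\<^sup>T = SJ"
    by (rule sym_of_pos[OF SJ(1)[unfolded d_def] fin(1)]) (use JP in \<open>auto simp: SJ(2) intro!: sym\<close>)
  define q where "q = inv_into J (pos J)"
  have q: "q (pos J r) = r" if "r \<in> J" for r
    using pos_bij[OF fin(1)] that by (simp add: q_def bij_betw_def)
  \<comment> \<open>The true covariance on \<open>J\<close> in submatrix numbering. Extension by
    zero passes the spectral bounds of \<open>Sg\<close> on to it, so it is a legitimate comparison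
    matrix for the clipping.\<close>
  define T where "T i j = Sg (q i) (q j)" for i j
  define T' where "T' = spectral_clip \<eta> SJ"
  have quadT: "quad {..<d} T x = quad ?P Sg (\<lambda>i. if i \<in> J then x (pos J i) else 0)" for x
  proof -
    have "quad {..<d} T x = quad J Sg (\<lambda>r. x (pos J r))"
      unfolding d_def quad_pos[OF fin(1)] by (simp add: quad_def T_def q cong: sum.cong)
    then show ?thesis using quad_subset[OF JP] by simp
  qed
  have sumT: "(\<Sum>i<d. (x i)\<^sup>2) = (\<Sum>i<p. (if i \<in> J then x (pos J i) else (0::real))\<^sup>2)" for x
    unfolding d_def sum_pos[OF fin(1)] by (rule sum_sq_subset[OF JP]) simp
  have "op_bound {..<d} {..<d} (\<lambda>i j. T' $$ (i,j) - SJ $$ (i,j)) \<epsilon>"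
    unfolding T'_def
  proof (rule spectral_clip_approx[OF SJ(1) SJ_sym])
    fix x
    show "1 / \<eta> * (\<Sum>i<d. (x i)\<^sup>2) \<le> quad {..<d} T x" unfolding quadT sumT by (rule Sg_ge)
    show "quad {..<d} T x \<le> \<eta> * (\<Sum>i<d. (x i)\<^sup>2)" unfolding quadT sumT by (rule Sg_le)
    have "quad {..<d} (\<lambda>i j. SJ $$ (i,j) - T i j) x = quad J (\<lambda>i j. S $$ (i,j) - Sg i j) (\<lambda>r. x (pos J r))"
      unfolding d_def quad_pos[OF fin(1)] by (simp add: quad_def T_def q SJ cong: sum.cong)
    then show "\<bar>quad {..<d} (\<lambda>i j. SJ $$ (i,j) - T i j) x\<bar> \<le> \<epsilon> * (\<Sum>i<d. (x i)\<^sup>2)"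
      using dev[of "\<lambda>r. x (pos J r)"] by (simp add: d_def sum_pos[OF fin(1)])
  qed (rule eps)
  from op_bound_pos[OF fin(1) this[unfolded d_def]]
  have T'S: "op_bound J J (\<lambda>r s. T' $$ (pos J r, pos J s) - S $$ (r,s)) \<epsilon>"
    by (rule op_bound_cong[THEN iffD1, rotated]) (simp add: SJ)
  have "op_bound J J (\<lambda>i j. S $$ (i,j) - Sg i j) \<epsilon>"
  proof (rule op_boundI_quad)
    fix i j assume "i \<in> J" "j \<in> J"
    then have "i < p" "j < p" using JP by auto
    then show "S $$ (i,j) - Sg i j = S $$ (j,i) - Sg j i" using sym Sg_sym by simp
  qed (use dev eps fin in auto)
  \<comment> \<open>One \<open>\<epsilon>\<close> stems from clipping, the other from
    sampling.\<close>
  from op_bound_cmult[OF op_bound_add[OF T'S this], of "-1"]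
  have SgT: "op_bound J J (\<lambda>r s. Sg r s - T' $$ (pos J r, pos J s)) (2 * \<epsilon>)" by simp
  obtain C where inv: "mat_inverse T' = Some C" and C: "C \<in> carrier_mat d d" and CT: "C * T' = 1\<^sub>m d"
    and C_sym: "\<forall>i<d. \<forall>j<d. C $$ (i,j) = C $$ (j,i)"
    and Cb: "op_bound {..<d} {..<d} (\<lambda>i j. C $$ (i,j)) \<eta>"
    using spectral_clip_inverse[OF SJ(1) SJ_sym eta] unfolding T'_def by blast
  have T'c: "T' \<in> carrier_mat d d"
    using spectral_clip_decomposition[OF SJ(1) SJ_sym, of \<eta>] unfolding T'_def by blast
  define C' where "C' r s = C $$ (pos J r, pos J s)" for r s
  have C': "op_bound J J C' \<eta>"
    using op_bound_pos[OF fin(1) Cb[unfolded d_def]] by (simp add: C'_def[abs_def])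
  have posd: "pos J r < d" if "r \<in> J" for r
    using pos_bij[OF fin(1)] that by (auto simp: d_def bij_betw_def)
  note entry = local_precision_entry[OF inv[unfolded T'_def SJ_def J_def] C[unfolded d_def J_def],
      folded J_def I_def C'_def]
  have CT': "(\<Sum>s\<in>J. C' r s * T' $$ (pos J s, pos J t)) = (if r = t then 1 else 0)" if "r \<in> J" "t \<in> J" for r t
  proof -
    have "(\<Sum>s\<in>J. C' r s * T' $$ (pos J s, pos J t)) = (\<Sum>i<d. C $$ (pos J r, i) * T' $$ (i, pos J t))"
      by (simp add: d_def sum_pos[OF fin(1)] C'_def)
    also have "\<dots> = (C * T') $$ (pos J r, pos J t)"
      using C T'c posd that by (simp add: scalar_prod_def atLeast0LessThan)
    also have "\<dots> = (if r = t then 1 else 0)"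
      unfolding CT using posd that q by (auto, metis q)
    finally show ?thesis .
  qed
  have id: "C' r t - B r t = (\<Sum>s\<in>J. C' r s * (\<Sum>u\<in>J. (Sg s u - T' $$ (pos J s, pos J u)) * B u t))
      + (\<Sum>s\<in>J. C' r s * (\<Sum>u<p. Sg s u * (Om u t - B u t)))" if r: "r \<in> I" and t: "t \<in> I" for r t
  proof -
    have rt: "r \<in> J" "t \<in> J" "t < p" using r t IJ IP by auto
    \<comment> \<open>\<open>J\<close> exceeds \<open>I\<close> by \<open>b \<ge> k\<close> on both
      sides; cutting it to the valid indices removes no row that exists.\<close>
    have bandJ: "B u t = 0" if u: "u < p" "u \<notin> J" for u
      using u t b rt(3) by (intro band) (auto simp: J_def I_def window_def)
    have in1: "(\<Sum>u<p. Sg s u * (Om u t - B u t)) = (if s = t then 1 else 0) - (\<Sum>u\<in>J. Sg s u * B u t)" if s: "s \<in> J" for s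
    proof -
      have "(\<Sum>u<p. Sg s u * B u t) = (\<Sum>u\<in>J. Sg s u * B u t)"
        using JP bandJ by (intro sum.mono_neutral_right) auto
      then show ?thesis using Sg_Om[of s t] s rt JP by (auto simp: right_diff_distrib sum_subtractf)
    qed
    \<comment> \<open>The terms with \<open>Sg\<close> cancel and leave \<open>1 - T' B\<close>.
      Multiplication by \<open>C'\<close> from the left, with \<open>C' T' = 1\<close>, then gives
      \<open>C' - B\<close>.\<close>
    have "(\<Sum>u\<in>J. (Sg s u - T' $$ (pos J s, pos J u)) * B u t) + (\<Sum>u<p. Sg s u * (Om u t - B u t))
        = (if s = t then 1 else 0) - (\<Sum>u\<in>J. T' $$ (pos J s, pos J u) * B u t)" if s: "s \<in> J" for s
      unfolding in1[OF s] by (simp add: left_diff_distrib sum_subtractf)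
    then have "(\<Sum>s\<in>J. C' r s * (\<Sum>u\<in>J. (Sg s u - T' $$ (pos J s, pos J u)) * B u t))
      + (\<Sum>s\<in>J. C' r s * (\<Sum>u<p. Sg s u * (Om u t - B u t)))
      = (\<Sum>s\<in>J. C' r s * ((if s = t then 1 else 0) - (\<Sum>u\<in>J. T' $$ (pos J s, pos J u) * B u t)))"
      unfolding sum.distrib[symmetric] distrib_left[symmetric] by (intro sum.cong refl) simp
    also have "\<dots> = (\<Sum>s\<in>J. if s = t then C' r s else 0) - (\<Sum>s\<in>J. C' r s * (\<Sum>u\<in>J. T' $$ (pos J s, pos J u) * B u t))"
      unfolding sum_subtractf[symmetric] by (intro sum.cong refl) (simp add: right_diff_distrib)
    also have "\<dots> = C' r t - (\<Sum>s\<in>J. \<Sum>u\<in>J. C' r s * T' $$ (pos J s, pos J u) * B u t)"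
      using rt fin by (simp add: sum_distrib_left mult.assoc)
    also have "(\<Sum>s\<in>J. \<Sum>u\<in>J. C' r s * T' $$ (pos J s, pos J u) * B u t)
        = (\<Sum>u\<in>J. (\<Sum>s\<in>J. C' r s * T' $$ (pos J s, pos J u)) * B u t)"
      by (subst sum.swap) (simp add: sum_distrib_right)
    also have "\<dots> = (\<Sum>u\<in>J. (if r = u then 1 else 0) * B u t)"
      using CT' rt by (intro sum.cong refl) simp
    also have "\<dots> = B r t" using rt fin by (simp add: if_distrib if_distribR cong: if_cong)
    finally show ?thesis by simp
  qed
  have "op_bound I I (\<lambda>r t. (\<Sum>s\<in>J. C' r s * (\<Sum>u\<in>J. (Sg s u - T' $$ (pos J s, pos J u)) * B u t))
      + (\<Sum>s\<in>J. C' r s * (\<Sum>u<p. Sg s u * (Om u t - B u t))))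
      (\<eta> * (2 * \<epsilon> * (\<eta> + \<delta>)) + \<eta> * (\<eta> * \<delta>))"
  proof (intro op_bound_add op_bound_comp)
    show "op_bound I J C' \<eta>" using IJ fin by (intro op_bound_subset[OF C']) auto
    then show "op_bound I J C' \<eta>" .
    show "op_bound J I B (\<eta> + \<delta>)" using IP JP by (intro op_bound_subset[OF B]) auto
    show "op_bound J ?P Sg \<eta>" using JP by (intro op_bound_subset[OF Sg]) auto
    show "op_bound ?P I (\<lambda>i j. Om i j - B i j) \<delta>" using IP by (intro op_bound_subset[OF near]) auto
  qed (use SgT eps eta in auto)
  then have "op_bound I I (\<lambda>r t. C' r t - B r t) (local_error \<epsilon>)"
    unfolding local_error_def by (rule op_bound_cong[THEN iffD1, rotated]) (simp add: id)
  then show "op_bound I I (\<lambda>r s. embed_block p b m (local_precision \<eta> p S b m) $$ (r,s) - B r s) (local_error \<epsilon>)"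
  proof (rule op_bound_cong[THEN iffD1, rotated])
    fix r s assume rs: "r \<in> I" "s \<in> I"
    then have "r < p" "s < p" using IP by auto
    then show "C' r s - B r s = embed_block p b m (local_precision \<eta> p S b m) $$ (r,s) - B r s"
      using rs by (simp add: entry)
  qed
  show "embed_block p b m (local_precision \<eta> p S b m) $$ (r,s) =
      embed_block p b m (local_precision \<eta> p S b m) $$ (s,r)" if "r < p" "s < p"
    using that C_sym posd IJ by (auto simp: entry C'_def)
  show "embed_block p b m (local_precision \<eta> p S b m) $$ (r,s) = 0" if "r < p" "s < p" "\<not> (r \<in> I \<and> s \<in> I)"
    using that by (auto simp: entry)
qed

end

section \<open>Counting windows and averaging the blocks\<close>

lemma card_windows_single:
  assumes "r < p"
  shows "card {m \<in> {2 - int b..int p}. r \<in> window p m (m + int b - 1)} = b"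
proof -
  \<comment> \<open>The start \<open>2 - b\<close> belongs to the first window that reaches a valid
    index, so indices near the boundary are covered as often as the others.\<close>
  have "{m \<in> {2 - int b..int p}. r \<in> window p m (m + int b - 1)} = {int r + 2 - int b..int r + 1}"
    using assms by (auto simp: window_def)
  then show ?thesis by simp
qed

text \<open>This count is the origin of the cropping weights: the counts for \<open>2 * k\<close>
  and for \<open>k\<close> differ by exactly \<open>k\<close> as long as the distance of
  \<open>r\<close> and \<open>s\<close> is at most \<open>k\<close>.\<close>

lemma card_windows_pair:
  assumes "r < p" "s < p"
  shows "card {m \<in> {2 - int b..int p}. r \<in> window p m (m + int b - 1) \<and> s \<in> window p m (m + int b - 1)}
    = nat (int b - \<bar>int r - int s\<bar>)"
proof -
  have "{m \<in> {2 - int b..int p}. r \<in> window p m (m + int b - 1) \<and> s \<in> window p m (m + int b - 1)}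
      = {int (max r s) + 2 - int b..int (min r s) + 1}"
    using assms by (auto simp: window_def)
  then have "card {m \<in> {2 - int b..int p}. r \<in> window p m (m + int b - 1) \<and> s \<in> window p m (m + int b - 1)}
      = nat (int (min r s) + 1 - (int (max r s) + 2 - int b) + 1)" by (simp only: card_atLeastAtMost_int)
  also have "int (min r s) + 1 - (int (max r s) + 2 - int b) + 1 = int b - \<bar>int r - int s\<bar>" by (simp add: min_def max_def)
  finally show ?thesis .
qed

text \<open>Every index lies in exactly \<open>b\<close> windows of length \<open>b\<close>.\<close>

lemma op_bound_block_sum:
  fixes E :: "int \<Rightarrow> nat \<Rightarrow> nat \<Rightarrow> real"
  assumes E: "\<And>m. m \<in> {2 - int b..int p} \<Longrightarrow>
      op_bound (window p m (m + int b - 1)) (window p m (m + int b - 1)) (E m) c" and c: "c \<ge> 0"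
    and supp: "\<And>m r s. r < p \<Longrightarrow> s < p \<Longrightarrow>
      \<not> (r \<in> window p m (m + int b - 1) \<and> s \<in> window p m (m + int b - 1)) \<Longrightarrow> E m r s = 0"
  shows "op_bound {..<p} {..<p} (\<lambda>r s. \<Sum>m = 2 - int b..int p. E m r s) (real b * c)"
proof (rule op_boundI_bilinear)
  fix x y :: "nat \<Rightarrow> real"
  let ?M = "{2 - int b..int p}" and ?I = "\<lambda>m. window p m (m + int b - 1)"
  have norm: "L2_set (\<lambda>m. L2_set z (?I m)) ?M = sqrt (real b) * L2_set z {..<p}" for z :: "nat \<Rightarrow> real"
  proof -
    have "(\<Sum>m\<in>?M. (L2_set z (?I m))\<^sup>2) = (\<Sum>m\<in>?M. \<Sum>r<p. if r \<in> ?I m then (z r)\<^sup>2 else 0)"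
      unfolding L2_set_sq
      by (intro sum.cong refl sum.mono_neutral_cong_left) (use window_subset in auto)
    also have "\<dots> = (\<Sum>r<p. \<Sum>m\<in>?M. if r \<in> ?I m then (z r)\<^sup>2 else 0)" by (rule sum.swap)
    also have "\<dots> = (\<Sum>r<p. real b * (z r)\<^sup>2)"
    proof (intro sum.cong refl)
      fix r assume "r \<in> {..<p}"
      then have "card {m \<in> ?M. r \<in> ?I m} = b" by (intro card_windows_single) simp
      then show "(\<Sum>m\<in>?M. if r \<in> ?I m then (z r)\<^sup>2 else 0) = real b * (z r)\<^sup>2"
        by (subst sum.inter_filter[symmetric]) simp_all
    qed
    finally show ?thesis
      by (simp add: L2_set_def sum_distrib_left[symmetric] real_sqrt_mult)
  qed
  have "(\<Sum>r<p. \<Sum>s<p. x r * (\<Sum>m\<in>?M. E m r s) * y s) = (\<Sum>r<p. \<Sum>s<p. \<Sum>m\<in>?M. x r * E m r s * y s)"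
    by (simp add: sum_distrib_left sum_distrib_right)
  also have "\<dots> = (\<Sum>r<p. \<Sum>m\<in>?M. \<Sum>s<p. x r * E m r s * y s)" by (intro sum.cong refl sum.swap)
  also have "\<dots> = (\<Sum>m\<in>?M. \<Sum>r<p. \<Sum>s<p. x r * E m r s * y s)" by (rule sum.swap)
  also have "\<dots> = (\<Sum>m\<in>?M. \<Sum>r\<in>?I m. \<Sum>s\<in>?I m. x r * E m r s * y s)"
  proof (rule sum.cong[OF refl])
    fix m
    have "(\<Sum>r<p. \<Sum>s<p. x r * E m r s * y s) = (\<Sum>r\<in>?I m. \<Sum>s<p. x r * E m r s * y s)"
      using window_subset[of p m "m + int b - 1"] supp by (intro sum.mono_neutral_right) auto
    also have "\<dots> = (\<Sum>r\<in>?I m. \<Sum>s\<in>?I m. x r * E m r s * y s)"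
      using window_subset[of p m "m + int b - 1"] supp by (intro sum.cong[OF refl] sum.mono_neutral_right) auto
    finally show "(\<Sum>r<p. \<Sum>s<p. x r * E m r s * y s) = (\<Sum>r\<in>?I m. \<Sum>s\<in>?I m. x r * E m r s * y s)" .
  qed
  finally have "\<bar>\<Sum>r<p. \<Sum>s<p. x r * (\<Sum>m\<in>?M. E m r s) * y s\<bar>
      \<le> (\<Sum>m\<in>?M. \<bar>\<Sum>r\<in>?I m. \<Sum>s\<in>?I m. x r * E m r s * y s\<bar>)" by (simp only: sum_abs)
  also have "\<dots> \<le> (\<Sum>m\<in>?M. c * L2_set x (?I m) * L2_set y (?I m))"
    by (intro sum_mono op_bound_bilinear E)
  also have "\<dots> = c * (\<Sum>m\<in>?M. \<bar>L2_set x (?I m)\<bar> * \<bar>L2_set y (?I m)\<bar>)"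
    by (simp add: sum_distrib_left mult.assoc)
  \<comment> \<open>Cauchy-Schwarz over the windows: the price is the overlap \<open>b\<close> and
    not the number of windows.\<close>
  also have "\<dots> \<le> c * ((sqrt (real b) * L2_set x {..<p}) * (sqrt (real b) * L2_set y {..<p}))"
    unfolding norm[symmetric] by (intro mult_left_mono L2_set_mult_ineq c)
  also have "\<dots> = real b * c * L2_set x {..<p} * L2_set y {..<p}" by (simp add: mult_ac)
  finally show "\<bar>\<Sum>r<p. \<Sum>s<p. x r * (\<Sum>m\<in>?M. E m r s) * y s\<bar> \<le> real b * c * L2_set x {..<p} * L2_set y {..<p}" .
qed (use c in simp)

lemma sum_banded_windows:
  assumes "r < p" "s < p"
  shows "(\<Sum>m = 2 - int b..int p. if r \<in> window p m (m + int b - 1) \<and> s \<in> window p m (m + int b - 1) then c else 0)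
    = real (nat (int b - \<bar>int r - int s\<bar>)) * c"
  unfolding card_windows_pair[OF assms, symmetric] by (subst sum.inter_filter[symmetric]) simp_all

context local_cropping begin

lemma cropping_error:
  assumes p: "p \<ge> 1" and Omega: "\<Omega> \<in> carrier_mat p p" "\<And>i j. i < p \<Longrightarrow> j < p \<Longrightarrow> \<Omega> $$ (i,j) = Om i j"
    and Om_ge: "\<And>x. 1 / \<eta> * (\<Sum>i<p. (x i)\<^sup>2) \<le> quad {..<p} Om x"
    and Om_le: "\<And>x. quad {..<p} Om x \<le> \<eta> * (\<Sum>i<p. (x i)\<^sup>2)"
    and eps: "\<epsilon> \<ge> 0"
    and dev: "\<And>b m x. b \<in> {k, 2 * k} \<Longrightarrow> m \<in> {2 - int b..int p} \<Longrightarrow>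
      \<bar>quad (window p (m - int b) (m + 2 * int b - 1)) (\<lambda>i j. sample_cov n p z $$ (i,j) - Sg i j) x\<bar>
        \<le> \<epsilon> * (\<Sum>i\<in>window p (m - int b) (m + 2 * int b - 1). (x i)\<^sup>2)"
  shows "0 \<le> op_norm (cropping_estimator \<eta> n p k z - \<Omega>)"
    and "op_norm (cropping_estimator \<eta> n p k z - \<Omega>) \<le> 2 * (3 * local_error \<epsilon> + \<delta>)"
    and "op_norm (cropping_estimator \<eta> n p k z - \<Omega>) \<le> 2 * \<eta>"
proof -
  let ?P = "{..<p}"
  define S where "S = sample_cov n p z"
  have S: "S \<in> carrier_mat p p"
    unfolding S_def sample_cov_def Let_def by (intro smult_carrier_mat mult_carrier_mat[of _ p n]) auto
  have S_sym: "S $$ (i,j) = S $$ (j,i)" if "i < p" "j < p" for i j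
    using that by (simp add: S_def sample_cov_def Let_def scalar_prod_def mult.commute)
  define L where "L b m r s = embed_block p b m (local_precision \<eta> p S b m) $$ (r,s)" for b m r s
  let ?I = "\<lambda>b m. window p m (m + int b - 1)"
  have loc: "op_bound (?I b m) (?I b m) (\<lambda>r s. L b m r s - B r s) (local_error \<epsilon>)"
    "\<And>r s. r < p \<Longrightarrow> s < p \<Longrightarrow> L b m r s = L b m s r"
    "\<And>r s. r < p \<Longrightarrow> s < p \<Longrightarrow> \<not> (r \<in> ?I b m \<and> s \<in> ?I b m) \<Longrightarrow> L b m r s = 0"
    if b: "b \<in> {k, 2 * k}" and m: "m \<in> {2 - int b..int p}" for b m
  proof -
    have "k \<le> b" using b by auto
    note l = local_precision_error[OF S S_sym this eps dev[OF b m, folded S_def]]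
    show "op_bound (?I b m) (?I b m) (\<lambda>r s. L b m r s - B r s) (local_error \<epsilon>)"
      using l(1) by (simp add: L_def)
    show "\<And>r s. r < p \<Longrightarrow> s < p \<Longrightarrow> L b m r s = L b m s r"
      using l(2) by (simp add: L_def)
    show "\<And>r s. r < p \<Longrightarrow> s < p \<Longrightarrow> \<not> (r \<in> ?I b m \<and> s \<in> ?I b m) \<Longrightarrow> L b m r s = 0"
      using l(3) by (simp add: L_def)
  qed
  define R where "R = (1 / real k) \<cdot>\<^sub>m (block_sum \<eta> p S (2 * k) - block_sum \<eta> p S k)"
  have est: "cropping_estimator \<eta> n p k z = spectral_clip \<eta> R"
    by (simp add: cropping_estimator_def Let_def R_def S_def)
  have R: "R \<in> carrier_mat p p"
    unfolding R_def by (intro smult_carrier_mat minus_carrier_mat) (simp_all add: block_sum_def)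
  have R_entry: "R $$ (r,s) = (1 / real k) * ((\<Sum>m = 2 - int (2 * k)..int p. L (2 * k) m r s) - (\<Sum>m = 2 - int k..int p. L k m r s))"
    if "r < p" "s < p" for r s
    using that by (simp add: R_def block_sum_def L_def)
  have "R\<^sup>T = R"
  proof (rule eq_matI)
    fix i j assume "i < dim_row R" "j < dim_col R"
    then have ij: "i < p" "j < p" using R by auto
    have LS: "(\<Sum>m = 2 - int b..int p. L b m j i) = (\<Sum>m = 2 - int b..int p. L b m i j)" if "b \<in> {k, 2 * k}" for b
      using loc(2)[OF that] ij by (intro sum.cong refl) blast
    then show "R\<^sup>T $$ (i,j) = R $$ (i,j)" using LS[of k] LS[of "2 * k"] ij R by (simp add: R_entry)
  qed (use R in auto)
  \<comment> \<open>Each block is compared with \<open>B\<close> cut to its window. The cut copies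
    of \<open>B\<close> add up to \<open>B\<close> with the window counts as weights.\<close>
  define E where "E b m r s = (if r \<in> ?I b m \<and> s \<in> ?I b m then L b m r s - B r s else 0)" for b m r s
  have le0: "local_error \<epsilon> \<ge> 0" using eta delta eps by (simp add: local_error_def)
  have E: "op_bound ?P ?P (\<lambda>r s. \<Sum>m = 2 - int b..int p. E b m r s) (real b * local_error \<epsilon>)"
    if b: "b \<in> {k, 2 * k}" for b
  proof (rule op_bound_block_sum)
    fix m assume "m \<in> {2 - int b..int p}"
    from loc(1)[OF b this] show "op_bound (?I b m) (?I b m) (E b m) (local_error \<epsilon>)"
      by (rule op_bound_cong[THEN iffD1, rotated]) (simp add: E_def)
  qed (use le0 in \<open>auto simp: E_def\<close>)
  have sumE: "(\<Sum>m = 2 - int b..int p. E b m r s) =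
      (\<Sum>m = 2 - int b..int p. L b m r s) - real (nat (int b - \<bar>int r - int s\<bar>)) * B r s"
    if b: "b \<in> {k, 2 * k}" and rs: "r < p" "s < p" for b r s
  proof -
    have "(\<Sum>m = 2 - int b..int p. E b m r s) = (\<Sum>m = 2 - int b..int p. L b m r s -
        (if r \<in> ?I b m \<and> s \<in> ?I b m then B r s else 0))"
      using loc(3)[OF b] rs by (intro sum.cong refl) (auto simp: E_def)
    then show ?thesis by (simp only: sum_subtractf sum_banded_windows[OF rs])
  qed
  \<comment> \<open>The large blocks contribute \<open>2 * k\<close> and the small ones
    \<open>k\<close>; division by \<open>k\<close> leaves 3.\<close>
  have "op_bound ?P ?P (\<lambda>r s. (1 / real k) * ((\<Sum>m = 2 - int (2 * k)..int p. E (2 * k) m r s) - (\<Sum>m = 2 - int k..int p. E k m r s)))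
      (\<bar>1 / real k\<bar> * (real (2 * k) * local_error \<epsilon> + real k * local_error \<epsilon>))"
    by (intro op_bound_cmult op_bound_diff E) auto
  also have "\<bar>1 / real k\<bar> * (real (2 * k) * local_error \<epsilon> + real k * local_error \<epsilon>) = 3 * local_error \<epsilon>"
    using k by (simp add: field_simps)
  finally have RB: "op_bound ?P ?P (\<lambda>r s. R $$ (r,s) - B r s) (3 * local_error \<epsilon>)"
  proof (rule op_bound_cong[THEN iffD1, rotated])
    fix r s assume "r \<in> ?P" "s \<in> ?P"
    then have rs: "r < p" "s < p" by auto
    \<comment> \<open>Up to distance \<open>k\<close> the weights differ by \<open>k\<close>; at
      larger distances the difference is smaller, but there \<open>B\<close> vanishes.\<close>
    have "(real (nat (int (2 * k) - \<bar>int r - int s\<bar>)) - real (nat (int k - \<bar>int r - int s\<bar>))) * B r s = real k * B r s"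
    proof (cases "\<bar>int r - int s\<bar> \<le> int k")
      case True
      then have "real (nat (int (2 * k) - \<bar>int r - int s\<bar>)) - real (nat (int k - \<bar>int r - int s\<bar>)) = real k"
        by (simp add: of_nat_nat)
      then show ?thesis by simp
    next
      case False
      then have "B r s = 0" using rs by (intro band) auto
      then show ?thesis by simp
    qed
    then show "1 / real k * ((\<Sum>m = 2 - int (2 * k)..int p. E (2 * k) m r s) - (\<Sum>m = 2 - int k..int p. E k m r s)) =
        R $$ (r,s) - B r s"
      using k by (simp add: sumE[OF _ rs] R_entry[OF rs] field_simps del: of_nat_mult)
  qed
  define c where "c = 3 * local_error \<epsilon> + \<delta>"
  have c: "c \<ge> 0" using le0 delta by (simp add: c_def)
  from op_bound_diff[OF RB near]
  have RO: "op_bound ?P ?P (\<lambda>r s. R $$ (r,s) - Om r s) c"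
    unfolding c_def by simp
  have "op_bound ?P ?P (\<lambda>i j. spectral_clip \<eta> R $$ (i,j) - R $$ (i,j)) c"
  proof (rule spectral_clip_approx[OF R \<open>R\<^sup>T = R\<close> Om_ge Om_le _ c])
    show "\<bar>quad ?P (\<lambda>i j. R $$ (i,j) - Om i j) x\<bar> \<le> c * (\<Sum>i<p. (x i)\<^sup>2)" for x
      using abs_quad_le[OF RO, of x] by (simp add: L2_set_sq)
  qed
  from op_bound_add[OF this RO]
  have fin: "op_bound ?P ?P (\<lambda>i j. (spectral_clip \<eta> R - \<Omega>) $$ (i,j)) (2 * c)"
    unfolding mult_2
    by (rule op_bound_cong[THEN iffD1, rotated])
       (use Omega in auto)
  have "spectral_clip \<eta> R - \<Omega> \<in> carrier_mat p p"
    using Omega(1) by (intro minus_carrier_mat) auto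
  note le = op_norm_le[OF this p]
  show "0 \<le> op_norm (cropping_estimator \<eta> n p k z - \<Omega>)"
    and "op_norm (cropping_estimator \<eta> n p k z - \<Omega>) \<le> 2 * (3 * local_error \<epsilon> + \<delta>)"
    using le[OF fin] by (simp_all add: est c_def)
  \<comment> \<open>A bound that holds for all data: the clipped matrix and \<open>\<Omega>\<close>
    both have norm at most \<open>\<eta>\<close>.\<close>
  from op_bound_diff[OF op_bound_spectral_clip[OF R \<open>R\<^sup>T = R\<close> eta] Om]
  have "op_bound ?P ?P (\<lambda>i j. (spectral_clip \<eta> R - \<Omega>) $$ (i,j)) (2 * \<eta>)"
    unfolding mult_2 by (rule op_bound_cong[THEN iffD1, rotated]) (use Omega in auto)
  from le(2)[OF this] show "op_norm (cropping_estimator \<eta> n p k z - \<Omega>) \<le> 2 * \<eta>"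
    by (simp add: est)
qed

end

section \<open>Exponential moments of sub-Gaussian laws\<close>

text \<open>The linear term is kept exact because its expectation vanishes for a centered
  variable.\<close>

lemma exp_second_order_le: "exp x \<le> 1 + x + x\<^sup>2 * exp \<bar>x\<bar>" for x :: real
proof (cases "x \<ge> 0")
  case True
  have "1 - x \<le> exp (- x)" using exp_ge_add_one_self[of "- x"] by simp
  then have "(1 - x) * exp x \<le> exp (- x) * exp x" by (intro mult_right_mono) auto
  then have a: "exp x - 1 \<le> x * exp x" by (simp add: exp_minus algebra_simps)
  have "x * (exp x - 1) \<le> x * (x * exp x)" by (rule mult_left_mono[OF a True])
  then show ?thesis using a True by (simp add: power2_eq_square algebra_simps)
next
  case False
  define y where "y = - x"
  have y: "y > 0" using False by (simp add: y_def)
  have "(1 + y) * exp (- y) \<le> exp y * exp (- y)" by (intro mult_right_mono exp_ge_add_one_self) auto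
  then have a: "y * exp (- y) \<le> 1 - exp (- y)" by (simp add: exp_minus algebra_simps)
  have "1 - exp (- y) \<le> y" using exp_ge_add_one_self[of "- y"] by simp
  then have "y * (1 - exp (- y)) \<le> y * y" by (rule mult_left_mono) (use y in simp)
  also have "\<dots> \<le> y * y * exp y" using y by (simp add: mult_le_cancel_left1)
  finally show ?thesis using a y False by (simp add: y_def power2_eq_square algebra_simps)
qed

lemma square_le_exp:
  fixes x a :: real
  assumes "x \<ge> 0" "a > 0"
  shows "x\<^sup>2 \<le> 2 * a\<^sup>2 * exp (x / a)"
proof -
  have "0 \<le> x / a" using assms by simp
  then have "(x / a)\<^sup>2 / 2 \<le> exp (x / a)"
    using exp_lower_Taylor_quadratic[of "x / a"] by linarith
  then have "(x / a)\<^sup>2 / 2 * (2 * a\<^sup>2) \<le> exp (x / a) * (2 * a\<^sup>2)" by (rule mult_right_mono) simp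
  then show ?thesis using assms by (simp add: power_divide mult_ac)
qed

definition lin :: "nat \<Rightarrow> (nat \<Rightarrow> real) \<Rightarrow> (nat \<Rightarrow> real) \<Rightarrow> real" where
  "lin p v x = (\<Sum>i<p. v i * x i)"

text \<open>The slicing sum \<open>e + (\<Sum>j. exp (j + 2) * 2 exp (- 2 (j + 1)))\<close>.\<close>

definition square_mgf_const :: real where
  "square_mgf_const = exp 1 + 2 / (1 - exp (- 1))"

text \<open>The factor \<open>128 * \<rho>^2\<close> is \<open>2 * (8 * \<rho>)^2\<close> from
  \<open>square_le_exp\<close>. The exponential of \<open>square_mgf_const\<close> pays for
  centering at the mean, the last factor is the exponential moment itself.\<close>

definition bernstein_const :: "real \<Rightarrow> real" where
  "bernstein_const \<rho> = 128 * \<rho>\<^sup>2 * exp square_mgf_const * square_mgf_const"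

lemma square_mgf_const_nonneg: "square_mgf_const \<ge> 0"
proof -
  have "0 < 1 - exp (- 1 :: real)" by simp
  then show ?thesis by (simp add: square_mgf_const_def)
qed

lemma bernstein_const_nonneg: "bernstein_const \<rho> \<ge> 0"
  by (simp add: bernstein_const_def square_mgf_const_nonneg)

locale sub_gaussian_law = prob_space \<mu> for \<mu> :: "(nat \<Rightarrow> real) measure" +
  fixes p :: nat and \<rho> :: real
  assumes sets_eq: "sets \<mu> = sets (\<Pi>\<^sub>M i\<in>{..<p}. (borel :: real measure))"
    and mean0: "mean_vec p \<mu> = 0\<^sub>v p" and sub: "sub_gaussian p \<rho> \<mu>" and rho: "\<rho> > 0"
begin

lemma coord_measurable [measurable]: "i < p \<Longrightarrow> (\<lambda>x. x i) \<in> borel_measurable \<mu>"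
  using measurable_component_singleton[of i "{..<p}" "\<lambda>_. borel :: real measure"]
    measurable_cong_sets[OF sets_eq refl, of "borel :: real measure"] by simp

lemma lin_measurable [measurable]: "lin p v \<in> borel_measurable \<mu>"
proof -
  have "(\<lambda>x. \<Sum>i<p. v i * x i) \<in> borel_measurable \<mu>"
    by (intro borel_measurable_sum borel_measurable_times borel_measurable_const coord_measurable) simp
  then show ?thesis by (simp add: lin_def[abs_def])
qed

text \<open>Net vectors lie in the ball and not on the sphere. Normalizing a nonzero
  \<open>v\<close> only enlarges the event; for \<open>v = 0\<close> it is empty.\<close>

lemma lin_tail:
  assumes v: "(\<Sum>i<p. (v i)\<^sup>2) \<le> 1" and t: "t > 0"
  shows "prob {x \<in> space \<mu>. \<bar>lin p v x\<bar> > t} \<le> 2 * exp (- t\<^sup>2 / (2 * \<rho>))"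
proof (cases "(\<Sum>i<p. (v i)\<^sup>2) = 0")
  case True
  then have "\<forall>i<p. v i = 0" by (subst (asm) sum_nonneg_eq_0_iff) auto
  then have "lin p v x = 0" for x by (simp add: lin_def)
  then show ?thesis using t by simp
next
  case False
  define r where "r = sqrt (\<Sum>i<p. (v i)\<^sup>2)"
  have "(\<Sum>i<p. (v i)\<^sup>2) \<ge> 0" by (intro sum_nonneg) auto
  then have r: "0 < r" "r \<le> 1" "r\<^sup>2 = (\<Sum>i<p. (v i)\<^sup>2)" using False v by (auto simp: r_def)
  define w where "w = Matrix.vec p (\<lambda>i. v i / r)"
  have "w \<bullet> w = (\<Sum>i<p. (v i)\<^sup>2) / r\<^sup>2"
    by (simp add: w_def scalar_prod_def atLeast0LessThan power2_eq_square sum_divide_distrib)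
  then have w: "w \<in> unit_vecs p" using r False by (simp add: unit_vecs_def w_def)
  have sp: "w \<bullet> (Matrix.vec p x - mean_vec p \<mu>) = lin p v x / r" for x
    unfolding mean0 by (simp add: w_def scalar_prod_def atLeast0LessThan lin_def sum_divide_distrib)
  have "prob {x \<in> space \<mu>. \<bar>lin p v x\<bar> > t} \<le> prob {x \<in> space \<mu>. \<bar>lin p v x / r\<bar> > t}"
  proof (rule finite_measure_mono)
    have "\<bar>lin p v x\<bar> \<le> \<bar>lin p v x / r\<bar>" for x
      using r by (simp add: pos_le_divide_eq mult_left_le)
    then show "{x \<in> space \<mu>. \<bar>lin p v x\<bar> > t} \<subseteq> {x \<in> space \<mu>. \<bar>lin p v x / r\<bar> > t}"
      by (auto intro: less_le_trans)
  qed measurable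
  also have "\<dots> \<le> 2 * exp (- t\<^sup>2 / (2 * \<rho>))"
    using sub w t unfolding sub_gaussian_def sp[symmetric] by blast
  finally show ?thesis .
qed

text \<open>Slicing by the integer part of \<open>y = (lin p v x)^2 / (4 * \<rho>)\<close>. With the
  scale \<open>4 * \<rho>\<close> the tail of \<open>y\<close> decays like
  \<open>exp (- 2 y)\<close>, twice as fast as \<open>exp y\<close> grows, so the slices form a
  geometric series with ratio \<open>exp (- 1)\<close>.\<close>

lemma exp_square_lin:
  assumes v: "(\<Sum>i<p. (v i)\<^sup>2) \<le> 1"
  shows "(\<integral>\<^sup>+x. ennreal (exp ((lin p v x)\<^sup>2 / (4 * \<rho>))) \<partial>\<mu>) \<le> ennreal square_mgf_const"
proof -
  define A where "A j = {x \<in> space \<mu>. \<bar>lin p v x\<bar> > sqrt (4 * \<rho> * real (Suc j))}" for j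
  have [measurable]: "A j \<in> sets \<mu>" for j unfolding A_def by measurable
  have pt: "ennreal (exp ((lin p v x)\<^sup>2 / (4 * \<rho>)))
      \<le> ennreal (exp 1) + (\<Sum>j. ennreal (exp (real j + 2)) * indicator (A j) x)" if x: "x \<in> space \<mu>" for x
  proof -
    define y where "y = (lin p v x)\<^sup>2 / (4 * \<rho>)"
    have y0: "y \<ge> 0" using rho by (simp add: y_def)
    show ?thesis
    proof (cases "y \<le> 1")
      case True
      then have "ennreal (exp y) \<le> ennreal (exp 1)" by (intro ennreal_leI) simp
      then show ?thesis unfolding y_def[symmetric] by (rule order_trans) simp
    next
      case False
      \<comment> \<open>The slice with \<open>j + 1 < y \<le> j + 2\<close>: the lower end places
        \<open>x\<close> in \<open>A j\<close>, the upper end bounds \<open>exp y\<close>.\<close>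
      define j where "j = nat (\<lceil>y\<rceil> - 2)"
      have "\<lceil>y\<rceil> \<ge> 2" using False by linarith
      then have j: "real j + 1 < y" "y \<le> real j + 2" by (auto simp: j_def of_nat_nat) linarith+
      have "4 * \<rho> * real (Suc j) < (lin p v x)\<^sup>2"
        using j(1) rho by (simp add: y_def field_simps)
      then have "sqrt (4 * \<rho> * real (Suc j)) < \<bar>lin p v x\<bar>"
        using real_sqrt_less_mono by fastforce
      then have xA: "x \<in> A j" using x by (simp add: A_def)
      define h where "h i = ennreal (exp (real i + 2)) * indicator (A i) x" for i
      have "ennreal (exp y) \<le> ennreal (exp (real j + 2)) * indicator (A j) x"
        using j(2) xA by (simp add: ennreal_leI)
      also have "\<dots> = h j" by (simp add: h_def)
      also have "h j = sum h {j}" by simp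
      also have "\<dots> \<le> (\<Sum>j. h j)" by (intro sum_le_suminf) auto
      also have "\<dots> = (\<Sum>j. ennreal (exp (real j + 2)) * indicator (A j) x)" by (simp add: h_def)
      finally show ?thesis unfolding y_def[symmetric] by (rule order_trans) simp
    qed
  qed
  have PA: "emeasure \<mu> (A j) \<le> ennreal (2 * exp (- 2 * real (Suc j)))" for j
  proof -
    have "prob (A j) \<le> 2 * exp (- (sqrt (4 * \<rho> * real (Suc j)))\<^sup>2 / (2 * \<rho>))"
      unfolding A_def using rho by (intro lin_tail v) simp
    also have "- (sqrt (4 * \<rho> * real (Suc j)))\<^sup>2 / (2 * \<rho>) = - 2 * real (Suc j)"
      using rho by (simp add: field_simps)
    finally show ?thesis by (simp add: emeasure_eq_measure ennreal_leI)
  qed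
  have "(\<integral>\<^sup>+x. ennreal (exp ((lin p v x)\<^sup>2 / (4 * \<rho>))) \<partial>\<mu>)
      \<le> (\<integral>\<^sup>+x. ennreal (exp 1) + (\<Sum>j. ennreal (exp (real j + 2)) * indicator (A j) x) \<partial>\<mu>)"
    by (intro nn_integral_mono pt)
  also have "\<dots> = ennreal (exp 1) + (\<Sum>j. ennreal (exp (real j + 2)) * emeasure \<mu> (A j))"
    by (simp add: nn_integral_add nn_integral_suminf nn_integral_cmult emeasure_space_1)
  also have "\<dots> \<le> ennreal (exp 1) + (\<Sum>j. ennreal (2 * exp (- 1) ^ j))"
  proof (intro add_left_mono suminf_le allI)
    fix j
    have "ennreal (exp (real j + 2)) * emeasure \<mu> (A j) \<le> ennreal (exp (real j + 2)) * ennreal (2 * exp (- 2 * real (Suc j)))"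
      by (intro mult_left_mono PA) simp
    also have "\<dots> = ennreal (2 * exp (- 1) ^ j)"
      by (subst ennreal_mult[symmetric]) (simp_all add: exp_of_nat_mult[symmetric] mult.left_commute exp_add[symmetric])
    finally show "ennreal (exp (real j + 2)) * emeasure \<mu> (A j) \<le> ennreal (2 * exp (- 1) ^ j)" .
  qed auto
  also have "(\<Sum>j. ennreal (2 * exp (- 1) ^ j)) = ennreal (2 * (1 / (1 - exp (- 1))))"
    by (intro suminf_ennreal_eq sums_mult geometric_sums) auto
  also have "ennreal (exp 1) + \<dots> = ennreal square_mgf_const"
    by (subst ennreal_plus[symmetric]) (auto simp: square_mgf_const_def)
  finally show ?thesis .
qed

lemma exp_square_lin_integrable:
  assumes v: "(\<Sum>i<p. (v i)\<^sup>2) \<le> 1"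
  shows "integrable \<mu> (\<lambda>x. exp ((lin p v x)\<^sup>2 / (4 * \<rho>)))"
    and "expectation (\<lambda>x. exp ((lin p v x)\<^sup>2 / (4 * \<rho>))) \<le> square_mgf_const"
proof -
  show i: "integrable \<mu> (\<lambda>x. exp ((lin p v x)\<^sup>2 / (4 * \<rho>)))"
    using exp_square_lin[OF v] by (intro integrableI_nonneg) (auto intro: le_less_trans)
  show "expectation (\<lambda>x. exp ((lin p v x)\<^sup>2 / (4 * \<rho>))) \<le> square_mgf_const"
    using exp_square_lin[OF v] square_mgf_const_nonneg by (simp add: nn_integral_eq_integral[OF i])
qed

lemma square_lin_le_exp: "(lin p v x)\<^sup>2 \<le> 4 * \<rho> * exp ((lin p v x)\<^sup>2 / (4 * \<rho>))"
proof -
  have "(lin p v x)\<^sup>2 / (4 * \<rho>) \<le> exp ((lin p v x)\<^sup>2 / (4 * \<rho>))"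
    using exp_ge_add_one_self[of "(lin p v x)\<^sup>2 / (4 * \<rho>)"] by linarith
  then show ?thesis using rho by (simp add: field_simps)
qed

lemma square_lin_integrable:
  assumes v: "(\<Sum>i<p. (v i)\<^sup>2) \<le> 1"
  shows "integrable \<mu> (\<lambda>x. (lin p v x)\<^sup>2)"
    and "expectation (\<lambda>x. (lin p v x)\<^sup>2) \<le> 4 * \<rho> * square_mgf_const"
proof -
  have i: "integrable \<mu> (\<lambda>x. 4 * \<rho> * exp ((lin p v x)\<^sup>2 / (4 * \<rho>)))"
    using exp_square_lin_integrable(1)[OF v] by simp
  show j: "integrable \<mu> (\<lambda>x. (lin p v x)\<^sup>2)"
    by (rule Bochner_Integration.integrable_bound[OF i])
       (use square_lin_le_exp[of v] rho in \<open>auto simp: abs_mult\<close>)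
  have "expectation (\<lambda>x. (lin p v x)\<^sup>2) \<le> expectation (\<lambda>x. 4 * \<rho> * exp ((lin p v x)\<^sup>2 / (4 * \<rho>)))"
    by (intro integral_mono i j square_lin_le_exp)
  also have "\<dots> \<le> 4 * \<rho> * square_mgf_const"
    using exp_square_lin_integrable(2)[OF v] rho by simp
  finally show "expectation (\<lambda>x. (lin p v x)\<^sup>2) \<le> 4 * \<rho> * square_mgf_const" .
qed

lemma coord_products_integrable:
  assumes "i < p" "j < p"
  shows "integrable \<mu> (\<lambda>x. x i * x j)"
proof -
  have sq: "integrable \<mu> (\<lambda>x. (x i)\<^sup>2)" if "i < p" for i
  proof -
    have "(\<Sum>j<p. (of_bool (j = i))\<^sup>2) \<le> (1::real)" using that by (simp add: power2_eq_square)
    moreover have "lin p (\<lambda>j. of_bool (j = i)) x = x i" for x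
      using that by (simp add: lin_def of_bool_def if_distrib if_distribR cong: if_cong)
    ultimately show ?thesis using square_lin_integrable(1)[of "\<lambda>j. of_bool (j = i)"] by simp
  qed
  show ?thesis
  proof (rule Bochner_Integration.integrable_bound)
    show "integrable \<mu> (\<lambda>x. (x i)\<^sup>2 + (x j)\<^sup>2)" using sq assms by simp
    have "\<bar>a * b\<bar> \<le> a\<^sup>2 + b\<^sup>2" for a b :: real
    proof -
      have "0 \<le> \<bar>a\<bar> * \<bar>b\<bar>" by simp
      then show ?thesis using sum_squares_bound[of "\<bar>a\<bar>" "\<bar>b\<bar>"] unfolding abs_mult power2_abs by linarith
    qed
    then show "AE x in \<mu>. norm (x i * x j) \<le> norm ((x i)\<^sup>2 + (x j)\<^sup>2)" by (simp add: abs_of_nonneg)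
  qed (use assms in measurable)
qed

lemma cov_mat_entry:
  assumes "i < p" "j < p"
  shows "cov_mat p \<mu> $$ (i,j) = expectation (\<lambda>x. x i * x j)"
proof -
  have "expectation (\<lambda>x. x i) = 0" if "i < p" for i
    using arg_cong[OF mean0, of "\<lambda>v. v $ i"] that by (simp add: mean_vec_def)
  then show ?thesis using assms by (simp add: cov_mat_def)
qed

lemma expectation_square_lin:
  "expectation (\<lambda>x. (lin p v x)\<^sup>2) = (\<Sum>i<p. \<Sum>j<p. v i * cov_mat p \<mu> $$ (i,j) * v j)"
proof -
  have I: "integrable \<mu> (\<lambda>x. v i * v j * (x i * x j))" if "i < p" "j < p" for i j
    by (intro integrable_mult_right coord_products_integrable that)
  have "(lin p v x)\<^sup>2 = (\<Sum>i<p. \<Sum>j<p. v i * v j * (x i * x j))" for x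
    unfolding lin_def power2_eq_square sum_product by (intro sum.cong refl) (simp add: mult_ac)
  then have "expectation (\<lambda>x. (lin p v x)\<^sup>2) = expectation (\<lambda>x. \<Sum>i<p. \<Sum>j<p. v i * v j * (x i * x j))"
    by simp
  also have "\<dots> = (\<Sum>i<p. expectation (\<lambda>x. \<Sum>j<p. v i * v j * (x i * x j)))"
    by (rule Bochner_Integration.integral_sum) (auto intro!: Bochner_Integration.integrable_sum I)
  also have "\<dots> = (\<Sum>i<p. \<Sum>j<p. expectation (\<lambda>x. v i * v j * (x i * x j)))"
    by (intro sum.cong[OF refl] Bochner_Integration.integral_sum I) auto
  also have "\<dots> = (\<Sum>i<p. \<Sum>j<p. v i * v j * expectation (\<lambda>x. x i * x j))" by simp
  also have "\<dots> = (\<Sum>i<p. \<Sum>j<p. v i * cov_mat p \<mu> $$ (i,j) * v j)"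
    by (intro sum.cong refl) (simp add: cov_mat_entry)
  finally show ?thesis .
qed

text \<open>The available exponential moment has exponent \<open>1 / (4 * \<rho>)\<close>. One half
  of it absorbs the square in the second-order term, the other half the factor
  \<open>exp |l D|\<close>; hence the range \<open>|l| \<le> 1 / (8 * \<rho>)\<close>.\<close>

lemma centered_square_mgf:
  assumes v: "(\<Sum>i<p. (v i)\<^sup>2) \<le> 1" and l: "\<bar>l\<bar> \<le> 1 / (8 * \<rho>)"
  shows "(\<integral>\<^sup>+x. ennreal (exp (l * ((lin p v x)\<^sup>2 - expectation (\<lambda>x. (lin p v x)\<^sup>2)))) \<partial>\<mu>)
    \<le> ennreal (exp (bernstein_const \<rho> * l\<^sup>2))"
proof -
  define W where "W x = (lin p v x)\<^sup>2" for x
  define m where "m = expectation W"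
  have m: "0 \<le> m" "m \<le> 4 * \<rho> * square_mgf_const"
    using square_lin_integrable(2)[OF v] by (auto simp: m_def W_def[abs_def])
  have Wi: "integrable \<mu> W" using square_lin_integrable(1)[OF v] by (simp add: W_def[abs_def])
  have Ei: "integrable \<mu> (\<lambda>x. exp (W x / (4 * \<rho>)))"
    using exp_square_lin_integrable(1)[OF v] by (simp add: W_def[abs_def])
  define g where "g x = 1 + l * (W x - m) + l\<^sup>2 * (128 * \<rho>\<^sup>2 * exp square_mgf_const * exp (W x / (4 * \<rho>)))" for x
  have pt: "exp (l * (W x - m)) \<le> g x" for x
  proof -
    let ?D = "W x - m"
    have W0: "W x \<ge> 0" by (simp add: W_def)
    have "exp (l * ?D) \<le> 1 + l * ?D + (l * ?D)\<^sup>2 * exp \<bar>l * ?D\<bar>" by (rule exp_second_order_le)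
    also have "(l * ?D)\<^sup>2 * exp \<bar>l * ?D\<bar> = l\<^sup>2 * (\<bar>?D\<bar>\<^sup>2 * exp (\<bar>l\<bar> * \<bar>?D\<bar>))"
      by (simp add: power_mult_distrib abs_mult)
    also have "\<dots> \<le> l\<^sup>2 * ((2 * (8 * \<rho>)\<^sup>2 * exp (\<bar>?D\<bar> / (8 * \<rho>))) * exp (1 / (8 * \<rho>) * \<bar>?D\<bar>))"
    proof (intro mult_left_mono mult_mono)
      show "\<bar>?D\<bar>\<^sup>2 \<le> 2 * (8 * \<rho>)\<^sup>2 * exp (\<bar>?D\<bar> / (8 * \<rho>))" using rho by (intro square_le_exp) auto
      show "exp (\<bar>l\<bar> * \<bar>?D\<bar>) \<le> exp (1 / (8 * \<rho>) * \<bar>?D\<bar>)"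
        unfolding exp_le_cancel_iff by (intro mult_right_mono l) simp
    qed auto
    also have "\<dots> = l\<^sup>2 * (128 * \<rho>\<^sup>2 * exp (\<bar>?D\<bar> / (4 * \<rho>)))"
      by (simp add: power_mult_distrib mult.assoc exp_add[symmetric])
    also have "\<dots> \<le> l\<^sup>2 * (128 * \<rho>\<^sup>2 * exp (square_mgf_const + W x / (4 * \<rho>)))"
    proof -
      \<comment> \<open>Both \<open>W x\<close> and its mean are nonnegative, so centering costs at
        most the mean.\<close>
      have "\<bar>?D\<bar> \<le> 4 * \<rho> * square_mgf_const + W x" using m W0 by linarith
      then have "\<bar>?D\<bar> / (4 * \<rho>) \<le> (4 * \<rho> * square_mgf_const + W x) / (4 * \<rho>)" using rho by (intro divide_right_mono) auto
      also have "\<dots> = square_mgf_const + W x / (4 * \<rho>)" using rho by (simp add: add_divide_distrib)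
      finally show ?thesis by (intro mult_left_mono) auto
    qed
    finally show ?thesis by (simp add: g_def exp_add mult.assoc)
  qed
  have gi: "integrable \<mu> g" unfolding g_def[abs_def] using Wi Ei by simp
  have g0: "g x \<ge> 0" for x using pt[of x] by (meson exp_ge_zero order_trans)
  have Em: "expectation (\<lambda>x. W x - m) = 0" using Wi by (simp add: m_def prob_space)
  have "expectation g = 1 + l\<^sup>2 * (128 * \<rho>\<^sup>2 * exp square_mgf_const * expectation (\<lambda>x. exp (W x / (4 * \<rho>))))"
    unfolding g_def[abs_def] using Wi Ei Em by (simp add: prob_space)
  also have "\<dots> \<le> 1 + l\<^sup>2 * (128 * \<rho>\<^sup>2 * exp square_mgf_const * square_mgf_const)"
    using exp_square_lin_integrable(2)[OF v] by (intro add_left_mono mult_left_mono) (auto simp: W_def)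
  also have "\<dots> = 1 + bernstein_const \<rho> * l\<^sup>2" by (simp add: bernstein_const_def mult_ac)
  also have "\<dots> \<le> exp (bernstein_const \<rho> * l\<^sup>2)" by (rule exp_ge_add_one_self)
  finally have Eg: "expectation g \<le> exp (bernstein_const \<rho> * l\<^sup>2)" .
  have "(\<integral>\<^sup>+x. ennreal (exp (l * (W x - m))) \<partial>\<mu>) \<le> (\<integral>\<^sup>+x. ennreal (g x) \<partial>\<mu>)"
    by (intro nn_integral_mono ennreal_leI pt)
  also have "\<dots> = ennreal (expectation g)" using gi g0 by (intro nn_integral_eq_integral) auto
  also have "\<dots> \<le> ennreal (exp (bernstein_const \<rho> * l\<^sup>2))" by (intro ennreal_leI Eg)
  finally show ?thesis by (simp add: W_def[abs_def] m_def)
qed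

text \<open>Independence turns the moment into a product of \<open>n\<close> equal factors.\<close>

lemma sample_mgf:
  assumes v: "(\<Sum>i<p. (v i)\<^sup>2) \<le> 1" and l: "\<bar>l\<bar> \<le> 1 / (8 * \<rho>)"
  shows "(\<integral>\<^sup>+z. ennreal (exp (l * (\<Sum>a<n. (lin p v (z a))\<^sup>2 - expectation (\<lambda>x. (lin p v x)\<^sup>2))))
      \<partial>(\<Pi>\<^sub>M i\<in>{..<n}. \<mu>)) \<le> ennreal (exp (real n * bernstein_const \<rho> * l\<^sup>2))"
proof -
  interpret P: product_sigma_finite "\<lambda>_ :: nat. \<mu>" by unfold_locales
  define f where "f x = ennreal (exp (l * ((lin p v x)\<^sup>2 - expectation (\<lambda>x. (lin p v x)\<^sup>2))))" for x
  have [measurable]: "f \<in> borel_measurable \<mu>" unfolding f_def[abs_def] by measurable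
  have "(\<integral>\<^sup>+z. ennreal (exp (l * (\<Sum>a<n. (lin p v (z a))\<^sup>2 - expectation (\<lambda>x. (lin p v x)\<^sup>2)))) \<partial>(\<Pi>\<^sub>M i\<in>{..<n}. \<mu>))
      = (\<integral>\<^sup>+z. (\<Prod>a<n. f (z a)) \<partial>(\<Pi>\<^sub>M i\<in>{..<n}. \<mu>))"
    by (simp add: f_def sum_distrib_left exp_sum prod_ennreal)
  also have "\<dots> = (\<Prod>a<n. integral\<^sup>N \<mu> f)" by (intro P.product_nn_integral_prod) auto
  also have "\<dots> \<le> (\<Prod>a<n. ennreal (exp (bernstein_const \<rho> * l\<^sup>2)))"
    using centered_square_mgf[OF v l] by (intro prod_mono_ennreal) (simp add: f_def[abs_def])
  also have "\<dots> = ennreal (exp (real n * bernstein_const \<rho> * l\<^sup>2))"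
    by (simp add: ennreal_power exp_of_nat_mult[symmetric] mult.assoc)
  finally show ?thesis .
qed

end

section \<open>Lattice nets and the maximal deviation\<close>

lemma lattice_gaussian_sum_le: "(\<Sum>x\<in>{- int N..int N}. exp (- (real_of_int x)\<^sup>2)) \<le> 3"
proof -
  have half: "exp (- 1) \<le> (1 / 2 :: real)"
    using exp_ge_add_one_self[of 1] by (simp add: exp_minus field_simps)
  have ex: "exp (- (real k)\<^sup>2) \<le> (1 / 2) ^ k" for k
  proof -
    have "exp (- (real k)\<^sup>2) \<le> exp (- real k)"
      by (cases "k = 0") (auto simp: power2_eq_square)
    also have "\<dots> = exp (- 1) ^ k" by (simp add: exp_of_nat_mult[symmetric])
    also have "\<dots> \<le> (1 / 2) ^ k" using half by (intro power_mono) auto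
    finally show ?thesis .
  qed
  \<comment> \<open>The exact value of the dominating geometric sum, a bound strong enough for
    induction.\<close>
  have "(\<Sum>x\<in>{- int N..int N}. exp (- (real_of_int x)\<^sup>2)) \<le> 3 - 2 * (1 / 2) ^ N"
  proof (induction N)
    case (Suc N)
    have "{- int (Suc N)..int (Suc N)} = insert (int (Suc N)) (insert (- int (Suc N)) {- int N..int N})" by auto
    then have "(\<Sum>x\<in>{- int (Suc N)..int (Suc N)}. exp (- (real_of_int x)\<^sup>2))
        = 2 * exp (- (real (Suc N))\<^sup>2) + (\<Sum>x\<in>{- int N..int N}. exp (- (real_of_int x)\<^sup>2))"
      by (simp del: of_nat_Suc)
    also have "\<dots> \<le> 2 * (1 / 2) ^ Suc N + (3 - 2 * (1 / 2) ^ N)"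
      by (intro add_mono mult_left_mono ex Suc) simp
    finally show ?case by simp
  qed simp
  also have "\<dots> \<le> 3" by simp
  finally show ?thesis .
qed

text \<open>The integer points of the ball of radius \<open>4 * sqrt d\<close> with
  \<open>d = card J\<close>. The box around the ball gives finiteness and a product set over which
  the count factorizes.\<close>

definition lattice_ball :: "nat set \<Rightarrow> (nat \<Rightarrow> int) set" where
  "lattice_ball J = {x \<in> J \<rightarrow>\<^sub>E {- int (4 * card J)..int (4 * card J)}.
     (\<Sum>i\<in>J. (real_of_int (x i))\<^sup>2) \<le> 16 * real (card J)}"

text \<open>A quarter net of the unit ball of the coordinate space on \<open>J\<close>, made of lattice points.\<close>

definition ball_net :: "nat set \<Rightarrow> (nat \<Rightarrow> real) set" where
  "ball_net J = (\<lambda>x i. if i \<in> J then real_of_int (x i) / (4 * sqrt (real (card J))) else 0) ` lattice_ball J"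

lemma finite_ball_net: "finite J \<Longrightarrow> finite (ball_net J)"
  unfolding ball_net_def lattice_ball_def
  by (rule finite_imageI, rule finite_subset[OF Collect_restrict]) (simp add: finite_PiE)

text \<open>The cardinality is estimated by the Gaussian weight \<open>exp (16 d - |x|\<^sup>2) \<ge> 1\<close>.\<close>

lemma card_ball_net_le:
  assumes J: "finite J"
  shows "real (card (ball_net J)) \<le> exp (18 * real (card J))"
proof -
  define d where "d = card J"
  define N where "N = 4 * d"
  have fP: "finite (J \<rightarrow>\<^sub>E {- int N..int N})" using J by (intro finite_PiE) auto
  have lb: "lattice_ball J \<subseteq> J \<rightarrow>\<^sub>E {- int N..int N}" by (auto simp: lattice_ball_def N_def d_def)
  have "real (card (ball_net J)) \<le> real (card (lattice_ball J))"
    unfolding ball_net_def using finite_subset[OF lb fP] by (simp add: card_image_le)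
  also have "\<dots> = (\<Sum>x\<in>lattice_ball J. 1)" by simp
  also have "\<dots> \<le> (\<Sum>x\<in>lattice_ball J. exp (16 * real d - (\<Sum>i\<in>J. (real_of_int (x i))\<^sup>2)))"
    by (intro sum_mono) (auto simp: lattice_ball_def d_def)
  also have "\<dots> \<le> (\<Sum>x\<in>J \<rightarrow>\<^sub>E {- int N..int N}. exp (16 * real d - (\<Sum>i\<in>J. (real_of_int (x i))\<^sup>2)))"
    using lb fP by (intro sum_mono2) auto
  also have "\<dots> = exp (16 * real d) * (\<Sum>x\<in>J \<rightarrow>\<^sub>E {- int N..int N}. \<Prod>i\<in>J. exp (- (real_of_int (x i))\<^sup>2))"
    using J by (simp add: sum_distrib_left exp_diff exp_sum[symmetric] sum_negf divide_inverse exp_minus[symmetric])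
  \<comment> \<open>Over the box the Gaussian sum is a product of one-dimensional sums.\<close>
  also have "(\<Sum>x\<in>J \<rightarrow>\<^sub>E {- int N..int N}. \<Prod>i\<in>J. exp (- (real_of_int (x i))\<^sup>2))
      = (\<Prod>i\<in>J. \<Sum>y\<in>{- int N..int N}. exp (- (real_of_int y)\<^sup>2))"
    using J by (subst prod_sum_PiE) auto
  also have "\<dots> \<le> (\<Prod>i\<in>J. 3)" by (intro prod_mono conjI sum_nonneg lattice_gaussian_sum_le) auto
  also have "\<dots> = 3 ^ d" by (simp add: d_def)
  \<comment> \<open>\<open>3 \<le> exp 2\<close>; together with the 16 of the Gaussian weight this
    makes 18.\<close>
  also have "\<dots> \<le> exp 2 ^ d" using exp_ge_add_one_self[of 2] by (intro power_mono) auto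
  also have "exp (16 * real d) * exp 2 ^ d = exp (18 * real d)"
    by (simp add: exp_of_nat_mult[symmetric] exp_add[symmetric])
  finally show ?thesis by (simp add: d_def)
qed

lemma ball_net_props:
  assumes J: "finite J" and v: "v \<in> ball_net J"
  shows "\<And>i. i \<notin> J \<Longrightarrow> v i = 0" and "(\<Sum>i\<in>J. (v i)\<^sup>2) \<le> 1"
proof -
  obtain x where x: "x \<in> lattice_ball J"
    "v = (\<lambda>i. if i \<in> J then real_of_int (x i) / (4 * sqrt (real (card J))) else 0)"
    using v by (auto simp: ball_net_def)
  show "v i = 0" if "i \<notin> J" for i using x(2) that by simp
  have "(\<Sum>i\<in>J. (v i)\<^sup>2) = (\<Sum>i\<in>J. (real_of_int (x i))\<^sup>2) / (16 * real (card J))"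
    by (simp add: x(2) power_divide power_mult_distrib sum_divide_distrib)
  also have "\<dots> \<le> 1" using x(1) by (auto simp: lattice_ball_def divide_le_eq_1)
  finally show "(\<Sum>i\<in>J. (v i)\<^sup>2) \<le> 1" .
qed

text \<open>Rounding the coordinates towards zero keeps the point inside the ball.\<close>

lemma ball_net_approx:
  assumes J: "finite J" "J \<noteq> {}" and x: "(\<Sum>i\<in>J. (x i)\<^sup>2) = 1"
  shows "\<exists>v\<in>ball_net J. (\<Sum>i\<in>J. (x i - v i)\<^sup>2) \<le> 1 / 16"
proof -
  define d where "d = real (card J)"
  have d: "d \<ge> 1" using J by (simp add: d_def Suc_leI card_gt_0_iff)
  \<comment> \<open>On this scale \<open>d\<close> coordinate errors of at most \<open>1 / s\<close>
    have squares adding up to at most \<open>d / s^2 = 1 / 16\<close>.\<close>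
  define s where "s = 4 * sqrt d"
  have s: "s > 0" "s\<^sup>2 = 16 * d" using d by (auto simp: s_def power_mult_distrib)
  \<comment> \<open>The value \<open>undefined\<close> off \<open>J\<close> makes \<open>y\<close>
    extensional, as membership in \<open>lattice_ball\<close> demands.\<close>
  define y where "y i = (if i \<in> J then (if x i \<ge> 0 then \<lfloor>s * x i\<rfloor> else \<lceil>s * x i\<rceil>) else undefined)" for i
  have y: "\<bar>real_of_int (y i)\<bar> \<le> \<bar>s * x i\<bar>" "\<bar>s * x i - real_of_int (y i)\<bar> \<le> 1" if i: "i \<in> J" for i
  proof -
    show "\<bar>real_of_int (y i)\<bar> \<le> \<bar>s * x i\<bar>"
    proof (cases "x i \<ge> 0")
      case True
      then have "0 \<le> s * x i" using s by simp
      then show ?thesis using True i by (simp add: y_def)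
    next
      case False
      then have "s * x i \<le> 0" using s by (simp add: mult_le_0_iff)
      then show ?thesis using False i by (simp add: y_def)
    qed
    show "\<bar>s * x i - real_of_int (y i)\<bar> \<le> 1"
      using i by (simp add: y_def) linarith
  qed
  have ysq: "(\<Sum>i\<in>J. (real_of_int (y i))\<^sup>2) \<le> 16 * d"
  proof -
    have "(\<Sum>i\<in>J. (real_of_int (y i))\<^sup>2) \<le> (\<Sum>i\<in>J. (s * x i)\<^sup>2)"
      using y(1) by (intro sum_mono) (simp add: abs_le_square_iff)
    also have "\<dots> = s\<^sup>2 * (\<Sum>i\<in>J. (x i)\<^sup>2)" by (simp add: power_mult_distrib sum_distrib_left)
    also have "\<dots> = 16 * d" using x s by simp
    finally show ?thesis .
  qed
  have "y \<in> lattice_ball J"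
  proof -
    have "y i \<in> {- int (4 * card J)..int (4 * card J)}" if i: "i \<in> J" for i
    proof -
      have "(real_of_int (y i))\<^sup>2 \<le> (\<Sum>i\<in>J. (real_of_int (y i))\<^sup>2)"
        using i J by (intro member_le_sum) auto
      also have "\<dots> \<le> 16 * d" by (rule ysq)
      also have "\<dots> \<le> (4 * d)\<^sup>2" using d by (simp add: power2_eq_square)
      finally have "\<bar>real_of_int (y i)\<bar> \<le> \<bar>4 * d\<bar>" by (simp only: abs_le_square_iff)
      then have "\<bar>real_of_int (y i)\<bar> \<le> 4 * d" using d by linarith
      then have "\<bar>y i\<bar> \<le> int (4 * card J)" unfolding d_def by linarith
      then show ?thesis by auto
    qed
    then show ?thesis using ysq by (auto simp: lattice_ball_def d_def y_def)
  qed
  then have v: "(\<lambda>i. if i \<in> J then real_of_int (y i) / s else 0) \<in> ball_net J"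
    unfolding ball_net_def s_def d_def by (rule image_eqI[OF refl])
  have "(\<Sum>i\<in>J. (x i - (if i \<in> J then real_of_int (y i) / s else 0))\<^sup>2) \<le> (\<Sum>i\<in>J. 1 / s\<^sup>2)"
  proof (intro sum_mono)
    fix i assume i: "i \<in> J"
    have "x i - real_of_int (y i) / s = (s * x i - real_of_int (y i)) / s" using s by (simp add: field_simps)
    then have "(x i - real_of_int (y i) / s)\<^sup>2 = (s * x i - real_of_int (y i))\<^sup>2 / s\<^sup>2" by (simp add: power_divide)
    also have "\<dots> \<le> 1 / s\<^sup>2"
      using y(2)[OF i] by (intro divide_right_mono) (simp_all add: abs_square_le_1)
    finally show "(x i - (if i \<in> J then real_of_int (y i) / s else 0))\<^sup>2 \<le> 1 / s\<^sup>2" using i by simp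
  qed
  also have "\<dots> = 1 / 16" using d s by (simp add: d_def)
  finally show ?thesis by (intro bexI[OF _ v])
qed

section \<open>From the net to all vectors\<close>

lemma quad_cmult: "quad J A (\<lambda>i. c * x i) = c\<^sup>2 * quad J A x"
  by (simp add: quad_def sum_distrib_left power2_eq_square mult_ac)

text \<open>A bound \<open>c\<close> improves itself: for symmetric \<open>A\<close> the forms at
  \<open>x\<close> and \<open>v\<close> differ by the bilinear form at \<open>x - v\<close> and
  \<open>x + v\<close>, whose lengths are at most \<open>1/4\<close> and 2.\<close>

lemma quad_net_step:
  assumes J: "finite J" "J \<noteq> {}" and sym: "\<And>i j. i \<in> J \<Longrightarrow> j \<in> J \<Longrightarrow> A i j = A j i"
    and net: "\<And>v. v \<in> ball_net J \<Longrightarrow> \<bar>quad J A v\<bar> \<le> t"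
    and c: "c \<ge> 0" "\<And>x. \<bar>quad J A x\<bar> \<le> c * (\<Sum>i\<in>J. (x i)\<^sup>2)"
  shows "\<bar>quad J A x\<bar> \<le> (t + c / 2) * (\<Sum>i\<in>J. (x i)\<^sup>2)"
proof -
  have unit: "\<bar>quad J A x\<bar> \<le> t + c / 2" if x: "(\<Sum>i\<in>J. (x i)\<^sup>2) = 1" for x
  proof -
    obtain v where v: "v \<in> ball_net J" and d: "(\<Sum>i\<in>J. (x i - v i)\<^sup>2) \<le> 1 / 16"
      using ball_net_approx[OF J x] by blast
    have ob: "op_bound J J A c" using sym c J by (intro op_boundI_quad) auto
    have "quad J A x - quad J A v = (\<Sum>i\<in>J. \<Sum>j\<in>J. (x i - v i) * A i j * (x j + v j))"
    proof -
      have "(\<Sum>i\<in>J. \<Sum>j\<in>J. x i * A i j * v j) = (\<Sum>i\<in>J. \<Sum>j\<in>J. v i * A i j * x j)"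
        by (subst sum.swap, intro sum.cong refl) (use sym in \<open>simp add: mult_ac\<close>)
      moreover have "(\<Sum>i\<in>J. \<Sum>j\<in>J. (x i - v i) * A i j * (x j + v j))
          = quad J A x - quad J A v + ((\<Sum>i\<in>J. \<Sum>j\<in>J. x i * A i j * v j) - (\<Sum>i\<in>J. \<Sum>j\<in>J. v i * A i j * x j))"
        unfolding quad_def sum_subtractf[symmetric] sum.distrib[symmetric]
        by (intro sum.cong refl) (simp add: algebra_simps)
      ultimately show ?thesis by simp
    qed
    also have "\<bar>\<dots>\<bar> \<le> c * L2_set (\<lambda>i. x i - v i) J * L2_set (\<lambda>i. x i + v i) J"
      by (rule op_bound_bilinear[OF ob])
    also have "\<dots> \<le> c * (1 / 4) * 2"
    proof (intro mult_mono mult_left_mono c)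
      have "sqrt (\<Sum>i\<in>J. (x i - v i)\<^sup>2) \<le> sqrt (1 / 16)" using d by simp
      also have "sqrt (1 / 16) = 1 / (4 :: real)" by (simp add: real_sqrt_divide)
      finally show "L2_set (\<lambda>i. x i - v i) J \<le> 1 / 4" by (simp add: L2_set_def)
      have "L2_set (\<lambda>i. x i + v i) J \<le> L2_set x J + L2_set v J" by (rule L2_set_triangle_ineq)
      also have "\<dots> \<le> 1 + 1"
        using x ball_net_props(2)[OF J(1) v] by (intro add_mono) (auto simp: L2_set_def)
      finally show "L2_set (\<lambda>i. x i + v i) J \<le> 2" by simp
    qed (use c in auto)
    finally show ?thesis using net[OF v] by linarith
  qed
  show ?thesis
  proof (cases "(\<Sum>i\<in>J. (x i)\<^sup>2) = 0")
    case True
    then show ?thesis using c(2)[of x] by simp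
  next
    case False
    define r where "r = L2_set x J"
    have r: "r\<^sup>2 = (\<Sum>i\<in>J. (x i)\<^sup>2)" by (simp add: r_def L2_set_sq)
    then have r0: "r \<noteq> 0" using False by auto
    have "(\<Sum>i\<in>J. (1 / r * x i)\<^sup>2) = (1 / r)\<^sup>2 * (\<Sum>i\<in>J. (x i)\<^sup>2)"
      by (simp only: power_mult_distrib sum_distrib_left)
    also have "\<dots> = 1" using r0 by (simp add: r[symmetric] power_divide)
    finally have "(\<Sum>i\<in>J. (1 / r * x i)\<^sup>2) = 1" .
    then have "\<bar>quad J A (\<lambda>i. 1 / r * x i)\<bar> \<le> t + c / 2" by (rule unit)
    then have "(1 / r)\<^sup>2 * \<bar>quad J A x\<bar> \<le> t + c / 2" unfolding quad_cmult by (simp add: abs_mult)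
    then have "r\<^sup>2 * ((1 / r)\<^sup>2 * \<bar>quad J A x\<bar>) \<le> r\<^sup>2 * (t + c / 2)" by (intro mult_left_mono) auto
    then show ?thesis using r0 by (simp add: r[symmetric] power_divide mult.commute)
  qed
qed

text \<open>Applying the improvement to the least admissible bound \<open>c\<close> gives
  \<open>c \<le> t + c / 2\<close>, that is \<open>c \<le> 2 * t\<close>.\<close>

lemma quad_le_twice_net:
  assumes J: "finite J" and sym: "\<And>i j. i \<in> J \<Longrightarrow> j \<in> J \<Longrightarrow> A i j = A j i"
    and net: "\<And>v. v \<in> ball_net J \<Longrightarrow> \<bar>quad J A v\<bar> \<le> t"
  shows "\<bar>quad J A x\<bar> \<le> 2 * t * (\<Sum>i\<in>J. (x i)\<^sup>2)"
proof (cases "J = {}")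
  case False
  define S where "S = {c. c \<ge> 0 \<and> (\<forall>x. \<bar>quad J A x\<bar> \<le> c * (\<Sum>i\<in>J. (x i)\<^sup>2))}"
  have bdd: "bdd_below S" by (intro bdd_belowI[of _ 0]) (auto simp: S_def)
  \<comment> \<open>A crude finite bound, so that the infimum is taken over a nonempty set.\<close>
  have "(\<Sum>i\<in>J. \<Sum>j\<in>J. \<bar>A i j\<bar>) \<in> S"
  proof -
    have "\<bar>quad J A x\<bar> \<le> (\<Sum>i\<in>J. \<Sum>j\<in>J. \<bar>A i j\<bar>) * (\<Sum>i\<in>J. (x i)\<^sup>2)" for x
    proof -
      have "\<bar>quad J A x\<bar> \<le> (\<Sum>i\<in>J. \<Sum>j\<in>J. \<bar>x i * A i j * x j\<bar>)"
        unfolding quad_def by (rule order_trans[OF sum_abs]) (intro sum_mono sum_abs)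
      also have "\<dots> \<le> (\<Sum>i\<in>J. \<Sum>j\<in>J. \<bar>A i j\<bar> * (\<Sum>i\<in>J. (x i)\<^sup>2))"
      proof (intro sum_mono)
        fix i j assume ij: "i \<in> J" "j \<in> J"
        have le: "\<bar>x i\<bar> \<le> L2_set x J" if "i \<in> J" for i
        proof -
          have "(x i)\<^sup>2 \<le> (\<Sum>i\<in>J. (x i)\<^sup>2)" using J that by (intro member_le_sum) auto
          then have "sqrt ((x i)\<^sup>2) \<le> L2_set x J" unfolding L2_set_def by (rule real_sqrt_le_mono)
          then show ?thesis by simp
        qed
        have "\<bar>x i\<bar> * \<bar>x j\<bar> \<le> L2_set x J * L2_set x J" using le ij by (intro mult_mono) auto
        also have "\<dots> = (\<Sum>i\<in>J. (x i)\<^sup>2)" using L2_set_sq[of x J] by (simp add: power2_eq_square)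
        finally have "\<bar>A i j\<bar> * (\<bar>x i\<bar> * \<bar>x j\<bar>) \<le> \<bar>A i j\<bar> * (\<Sum>i\<in>J. (x i)\<^sup>2)" by (intro mult_left_mono) auto
        then show "\<bar>x i * A i j * x j\<bar> \<le> \<bar>A i j\<bar> * (\<Sum>i\<in>J. (x i)\<^sup>2)" by (simp add: abs_mult mult_ac)
      qed
      also have "\<dots> = (\<Sum>i\<in>J. \<Sum>j\<in>J. \<bar>A i j\<bar>) * (\<Sum>i\<in>J. (x i)\<^sup>2)" by (simp add: sum_distrib_right)
      finally show ?thesis .
    qed
    then show ?thesis by (auto simp: S_def intro!: sum_nonneg)
  qed
  then have ne: "S \<noteq> {}" by blast
  define c where "c = Inf S"
  have c0: "c \<ge> 0" unfolding c_def using ne by (intro cInf_greatest) (auto simp: S_def)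
  have cq: "\<bar>quad J A x\<bar> \<le> c * (\<Sum>i\<in>J. (x i)\<^sup>2)" for x
  proof (cases "(\<Sum>i\<in>J. (x i)\<^sup>2) = 0")
    case True
    obtain c' where "c' \<in> S" using ne by blast
    then have "\<bar>quad J A x\<bar> \<le> c' * (\<Sum>i\<in>J. (x i)\<^sup>2)" by (simp add: S_def)
    then show ?thesis using True by simp
  next
    case False
    then have pos: "(\<Sum>i\<in>J. (x i)\<^sup>2) > 0" by (simp add: less_le sum_nonneg)
    have "\<bar>quad J A x\<bar> / (\<Sum>i\<in>J. (x i)\<^sup>2) \<le> c"
      unfolding c_def using ne pos by (intro cInf_greatest) (auto simp: S_def divide_le_eq)
    then show ?thesis using pos by (simp add: divide_le_eq)
  qed
  obtain v where v: "v \<in> ball_net J"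
  proof -
    have "(\<lambda>i. if i \<in> J then 0 else undefined) \<in> lattice_ball J" by (auto simp: lattice_ball_def)
    then show ?thesis using that by (auto simp: ball_net_def)
  qed
  have "t \<ge> 0" using net[OF v] by linarith
  moreover have "\<bar>quad J A x\<bar> \<le> (t + c / 2) * (\<Sum>i\<in>J. (x i)\<^sup>2)" for x
    by (rule quad_net_step[OF J False sym net c0 cq])
  ultimately have "t + c / 2 \<in> S" using c0 by (simp add: S_def)
  then have "c \<le> t + c / 2" unfolding c_def using bdd by (intro cInf_lower)
  then have "c \<le> 2 * t" by simp
  then have "c * (\<Sum>i\<in>J. (x i)\<^sup>2) \<le> 2 * t * (\<Sum>i\<in>J. (x i)\<^sup>2)" by (intro mult_right_mono sum_nonneg) auto
  then show ?thesis using cq[of x] by linarith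
qed (simp add: quad_def)

text \<open>Converts an exponential moment of \<open>u\<close> of size \<open>exp K\<close> into a
  second moment of at most \<open>4 * K^2 + 8\<close>.\<close>

lemma square_le_exp_shift:
  fixes u K :: real
  assumes "u \<ge> 0" "K \<ge> 0"
  shows "u\<^sup>2 \<le> 4 * K\<^sup>2 + 8 * exp (u - K)"
proof (cases "u \<le> 2 * K")
  case True
  then have "u\<^sup>2 \<le> (2 * K)\<^sup>2" using assms by (intro power_mono) auto
  also have "\<dots> \<le> 4 * K\<^sup>2 + 8 * exp (u - K)" by (simp add: power_mult_distrib)
  finally show ?thesis .
next
  case False
  have "u\<^sup>2 \<le> 2 * 2\<^sup>2 * exp (u / 2)" using square_le_exp[of u 2] assms by simp
  also have "\<dots> \<le> 8 * exp (u - K)" using False by simp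
  also have "\<dots> \<le> 4 * K\<^sup>2 + 8 * exp (u - K)" by simp
  finally show ?thesis .
qed

text \<open>This is \<open>(4 * \<kappa>^2 + 8) / l0^2\<close> with
  \<open>l0 = 1 / (8 * \<rho>)\<close> and
  \<open>\<kappa> = c + bernstein_const \<rho> * l0^2\<close>, where \<open>c\<close> measures the
  logarithm of the number of vectors.\<close>

definition deviation_const :: "real \<Rightarrow> real \<Rightarrow> real" where
  "deviation_const \<rho> c = (4 * (c + bernstein_const \<rho> / (64 * \<rho>\<^sup>2))\<^sup>2 + 8) * (64 * \<rho>\<^sup>2)"

lemma deviation_const_nonneg: "deviation_const \<rho> c \<ge> 0"
  by (simp add: deviation_const_def)

context sub_gaussian_law begin

definition dev :: "nat \<Rightarrow> (nat \<Rightarrow> real) \<Rightarrow> (nat \<Rightarrow> nat \<Rightarrow> real) \<Rightarrow> real" where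
  "dev n v z = 1 / real n * (\<Sum>a<n. (lin p v (z a))\<^sup>2 - expectation (\<lambda>x. (lin p v x)\<^sup>2))"

text \<open>As \<open>v\<close> vanishes off \<open>J\<close>, the form on the window is a centered
  mean of squares of one linear functional; the window disappears from the probabilistic
  part.\<close>

lemma quad_sample_cov:
  assumes J: "J \<subseteq> {..<p}" and v: "\<And>i. i \<notin> J \<Longrightarrow> v i = 0" and n: "n \<ge> 1"
  shows "quad J (\<lambda>i j. sample_cov n p z $$ (i,j) - cov_mat p \<mu> $$ (i,j)) v = dev n v z"
proof -
  have S: "sample_cov n p z $$ (i,j) = 1 / real n * (\<Sum>a<n. z a i * z a j)" if "i < p" "j < p" for i j
    using that by (simp add: sample_cov_def Let_def scalar_prod_def atLeast0LessThan)
  have "(\<lambda>i. if i \<in> J then v i else 0) = v" using v by auto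
  then have "quad J (\<lambda>i j. sample_cov n p z $$ (i,j) - cov_mat p \<mu> $$ (i,j)) v
      = quad {..<p} (\<lambda>i j. sample_cov n p z $$ (i,j) - cov_mat p \<mu> $$ (i,j)) v"
    using quad_subset[OF J, of _ v] by simp
  also have "\<dots> = (\<Sum>i<p. \<Sum>j<p. \<Sum>a<n. 1 / real n * (v i * z a i * (v j * z a j)))
      - (\<Sum>i<p. \<Sum>j<p. v i * cov_mat p \<mu> $$ (i,j) * v j)"
    unfolding quad_def sum_subtractf[symmetric]
    by (intro sum.cong refl) (simp add: S left_diff_distrib right_diff_distrib sum_distrib_left sum_distrib_right sum_divide_distrib mult_ac)
  also have "(\<Sum>i<p. \<Sum>j<p. \<Sum>a<n. 1 / real n * (v i * z a i * (v j * z a j)))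
      = (\<Sum>i<p. \<Sum>a<n. \<Sum>j<p. 1 / real n * (v i * z a i * (v j * z a j)))" by (intro sum.cong refl sum.swap)
  also have "\<dots> = (\<Sum>a<n. \<Sum>i<p. \<Sum>j<p. 1 / real n * (v i * z a i * (v j * z a j)))" by (rule sum.swap)
  also have "\<dots> = 1 / real n * (\<Sum>a<n. \<Sum>i<p. \<Sum>j<p. v i * z a i * (v j * z a j))"
    by (simp only: sum_distrib_left)
  also have "\<dots> = 1 / real n * (\<Sum>a<n. (lin p v (z a))\<^sup>2)"
    by (simp only: lin_def power2_eq_square sum_product)
  also have "(\<Sum>i<p. \<Sum>j<p. v i * cov_mat p \<mu> $$ (i,j) * v j) = expectation (\<lambda>x. (lin p v x)\<^sup>2)"
    by (rule expectation_square_lin[symmetric])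
  finally show ?thesis using n by (simp add: dev_def sum_subtractf right_diff_distrib)
qed

lemma dev_measurable: "dev n v \<in> borel_measurable (\<Pi>\<^sub>M i\<in>{..<n}. \<mu>)"
proof -
  have "(\<lambda>z. lin p v (z a)) \<in> borel_measurable (\<Pi>\<^sub>M i\<in>{..<n}. \<mu>)" if "a < n" for a
    using measurable_compose[OF measurable_component_singleton[of a "{..<n}" "\<lambda>_. \<mu>"] lin_measurable] that by simp
  then show ?thesis unfolding dev_def[abs_def]
    by (intro borel_measurable_times borel_measurable_const borel_measurable_sum borel_measurable_diff borel_measurable_power) auto
qed

text \<open>With \<open>\<lambda> = sqrt (L / n) / (8 \<rho>)\<close>, all exponential moments of \<open>n \<lambda> dev\<close> together are at most
  \<open>exp K\<close> for a \<open>K\<close> proportional to \<open>L\<close>, which bounds the second moment of the maximum.\<close>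

lemma max_deviation:
  assumes V: "finite V" "V \<noteq> {}" "\<And>v. v \<in> V \<Longrightarrow> (\<Sum>i<p. (v i)\<^sup>2) \<le> 1"
    and card: "2 * real (card V) \<le> exp (c * L)" and L: "1 \<le> L" "L \<le> real n" and c: "c \<ge> 0"
  shows "(\<integral>\<^sup>+z. ennreal ((Max ((\<lambda>v. \<bar>dev n v z\<bar>) ` V))\<^sup>2) \<partial>(\<Pi>\<^sub>M i\<in>{..<n}. \<mu>))
    \<le> ennreal (deviation_const \<rho> c * (L / real n))"
proof -
  let ?P = "\<Pi>\<^sub>M i\<in>{..<n}. \<mu>"
  interpret P: prob_space ?P by (intro prob_space_PiM prob_space_axioms)
  define l0 where "l0 = 1 / (8 * \<rho>)"
  \<comment> \<open>\<open>L \<le> n\<close> keeps \<open>l\<close> in the admissible range, and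
    \<open>n * l^2 = l0^2 * L\<close> puts the moment on the same scale as the logarithm of the
    number of vectors.\<close>
  define l where "l = l0 * sqrt (L / real n)"
  have n: "real n > 0" using L by linarith
  have l0: "l0 > 0" using rho by (simp add: l0_def)
  have l: "l > 0" "l \<le> l0" using l0 L n by (auto simp: l_def mult_le_cancel_left1)
  have nl: "real n * l\<^sup>2 = l0\<^sup>2 * L" using L n by (simp add: l_def power_mult_distrib)
  note b0 = bernstein_const_nonneg
  \<comment> \<open>The part with \<open>c\<close> counts the vectors, each with both signs; the
    rest is the exponent of a single moment.\<close>
  define K where "K = (c + bernstein_const \<rho> * l0\<^sup>2) * L"
  have K: "K \<ge> 0" using c b0 L by (simp add: K_def)
  \<comment> \<open>Summing over all vectors and both signs dominates the exponential of the
    maximum.\<close>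
  define G where "G z = (\<Sum>v\<in>V. exp (l * (real n * dev n v z)) + exp (- l * (real n * dev n v z)))" for z
  define T where "T z = Max ((\<lambda>v. \<bar>dev n v z\<bar>) ` V)" for z
  \<comment> \<open>The square of the factor \<open>n * l\<close> by which the maximum
    \<open>T z\<close> is scaled to \<open>u\<close>.\<close>
  define q where "q = real n * l0\<^sup>2 * L"
  have q: "q > 0" using n l0 L by (simp add: q_def)
  have G0: "G z \<ge> 0" for z unfolding G_def by (intro sum_nonneg) auto
  have pt: "(T z)\<^sup>2 \<le> 4 * K\<^sup>2 / q + 8 * exp (- K) / q * G z" for z
  proof -
    have "T z \<in> (\<lambda>v. \<bar>dev n v z\<bar>) ` V" unfolding T_def using V by (intro Max_in) auto
    then obtain v where v: "v \<in> V" "T z = \<bar>dev n v z\<bar>" by auto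
    define u where "u = real n * l * T z"
    have u0: "u \<ge> 0" using l n v by (simp add: u_def)
    have "u = l * (real n * dev n v z) \<or> u = - l * (real n * dev n v z)"
      using v(2) by (auto simp: u_def abs_if)
    then have "exp u \<le> exp (l * (real n * dev n v z)) + exp (- l * (real n * dev n v z))" by auto
    also have "\<dots> \<le> G z" unfolding G_def using v V by (intro member_le_sum) (auto intro: add_nonneg_nonneg)
    finally have eu: "exp u \<le> G z" .
    have "u\<^sup>2 \<le> 4 * K\<^sup>2 + 8 * exp (u - K)" by (rule square_le_exp_shift[OF u0 K])
    also have "exp (u - K) = exp (- K) * exp u" by (simp add: exp_diff exp_minus divide_inverse mult.commute)
    also have "4 * K\<^sup>2 + 8 * (exp (- K) * exp u) \<le> 4 * K\<^sup>2 + 8 * (exp (- K) * G z)"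
      using eu by (intro add_left_mono mult_left_mono) auto
    finally have "u\<^sup>2 / q \<le> (4 * K\<^sup>2 + 8 * (exp (- K) * G z)) / q" using q by (intro divide_right_mono) auto
    moreover have "u\<^sup>2 = q * (T z)\<^sup>2"
      using nl by (simp add: u_def q_def power_mult_distrib power2_eq_square[of "real n"] mult_ac)
    ultimately show ?thesis using q by (simp add: add_divide_distrib mult_ac)
  qed
  note [measurable] = dev_measurable
  have mgf: "(\<integral>\<^sup>+z. ennreal (exp (s * (real n * dev n v z))) \<partial>?P) \<le> ennreal (exp (bernstein_const \<rho> * l0\<^sup>2 * L))"
    if v: "v \<in> V" and s: "s = l \<or> s = - l" for v s
  proof -
    have ls: "\<bar>s\<bar> \<le> 1 / (8 * \<rho>)" using s l by (auto simp: l0_def)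
    have "real n * dev n v z = (\<Sum>a<n. (lin p v (z a))\<^sup>2 - expectation (\<lambda>x. (lin p v x)\<^sup>2))" for z
      using n by (simp add: dev_def)
    then have "(\<integral>\<^sup>+z. ennreal (exp (s * (real n * dev n v z))) \<partial>?P) \<le> ennreal (exp (real n * bernstein_const \<rho> * s\<^sup>2))"
      using sample_mgf[OF V(3)[OF v] ls, of n] by simp
    also have "real n * bernstein_const \<rho> * s\<^sup>2 = bernstein_const \<rho> * (real n * l\<^sup>2)" using s by auto
    also have "\<dots> = bernstein_const \<rho> * l0\<^sup>2 * L" by (simp add: nl)
    finally show ?thesis .
  qed
  have "(\<integral>\<^sup>+z. ennreal (G z) \<partial>?P)
      = (\<Sum>v\<in>V. (\<integral>\<^sup>+z. ennreal (exp (l * (real n * dev n v z))) \<partial>?P) + (\<integral>\<^sup>+z. ennreal (exp (- l * (real n * dev n v z))) \<partial>?P))"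
  proof -
    have "ennreal (G z) = (\<Sum>v\<in>V. ennreal (exp (l * (real n * dev n v z))) + ennreal (exp (- l * (real n * dev n v z))))" for z
      unfolding G_def by (subst sum_ennreal[symmetric]) (auto intro!: add_nonneg_nonneg sum.cong ennreal_plus)
    then show ?thesis
      by (simp only:) (subst nn_integral_sum, measurable, intro sum.cong refl nn_integral_add, measurable)
  qed
  also have "\<dots> \<le> (\<Sum>v\<in>V. ennreal (exp (bernstein_const \<rho> * l0\<^sup>2 * L)) + ennreal (exp (bernstein_const \<rho> * l0\<^sup>2 * L)))"
    by (intro sum_mono add_mono mgf) auto
  also have "\<dots> = ennreal (2 * real (card V) * exp (bernstein_const \<rho> * l0\<^sup>2 * L))"
  proof -
    define e where "e = exp (bernstein_const \<rho> * l0\<^sup>2 * L)"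
    have "ennreal e + ennreal e = ennreal (2 * e)" by (subst ennreal_plus[symmetric]) (auto simp: e_def)
    then have "(\<Sum>v\<in>V. ennreal e + ennreal e) = ennreal (real (card V)) * ennreal (2 * e)"
      by (simp add: ennreal_of_nat_eq_real_of_nat)
    also have "\<dots> = ennreal (2 * real (card V) * e)"
      by (subst ennreal_mult[symmetric]) (auto simp: e_def mult_ac)
    finally show ?thesis by (simp add: e_def)
  qed
  also have "\<dots> \<le> ennreal (exp (c * L) * exp (bernstein_const \<rho> * l0\<^sup>2 * L))"
    by (intro ennreal_leI mult_right_mono card) simp
  also have "exp (c * L) * exp (bernstein_const \<rho> * l0\<^sup>2 * L) = exp K" by (simp add: K_def exp_add[symmetric] distrib_right)
  finally have EG: "(\<integral>\<^sup>+z. ennreal (G z) \<partial>?P) \<le> ennreal (exp K)" .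
  have Gm: "G \<in> borel_measurable ?P" unfolding G_def[abs_def] by measurable
  have "(\<integral>\<^sup>+z. ennreal ((T z)\<^sup>2) \<partial>?P) \<le> (\<integral>\<^sup>+z. ennreal (4 * K\<^sup>2 / q) + ennreal (8 * exp (- K) / q) * ennreal (G z) \<partial>?P)"
  proof (intro nn_integral_mono)
    fix z
    have "ennreal ((T z)\<^sup>2) \<le> ennreal (4 * K\<^sup>2 / q + 8 * exp (- K) / q * G z)" by (intro ennreal_leI pt)
    also have "\<dots> = ennreal (4 * K\<^sup>2 / q) + ennreal (8 * exp (- K) / q) * ennreal (G z)"
      using q G0[of z] by (subst ennreal_plus; (subst ennreal_mult)?) auto
    finally show "ennreal ((T z)\<^sup>2) \<le> ennreal (4 * K\<^sup>2 / q) + ennreal (8 * exp (- K) / q) * ennreal (G z)" .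
  qed
  also have "\<dots> = ennreal (4 * K\<^sup>2 / q) + ennreal (8 * exp (- K) / q) * (\<integral>\<^sup>+z. ennreal (G z) \<partial>?P)"
    using Gm by (simp add: nn_integral_add nn_integral_cmult P.emeasure_space_1)
  also have "\<dots> \<le> ennreal (4 * K\<^sup>2 / q) + ennreal (8 * exp (- K) / q) * ennreal (exp K)"
    by (intro add_left_mono mult_left_mono EG) simp
  also have "\<dots> = ennreal ((4 * K\<^sup>2 + 8) / q)"
    using q by (simp add: ennreal_mult[symmetric] ennreal_plus[symmetric] exp_minus add_divide_distrib del: ennreal_plus)
  also have "\<dots> \<le> ennreal (deviation_const \<rho> c * (L / real n))"
  proof (intro ennreal_leI)
    let ?k = "c + bernstein_const \<rho> * l0\<^sup>2"
    \<comment> \<open>\<open>L \<ge> 1\<close> absorbs the 8; division by \<open>q\<close> then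
      leaves a single power of \<open>L\<close> over \<open>n\<close>.\<close>
    have "4 * K\<^sup>2 + 8 \<le> (4 * ?k\<^sup>2 + 8) * L\<^sup>2"
    proof -
      have "4 * K\<^sup>2 + 8 = 4 * ?k\<^sup>2 * L\<^sup>2 + 8" by (simp add: K_def power_mult_distrib)
      also have "\<dots> \<le> 4 * ?k\<^sup>2 * L\<^sup>2 + 8 * L\<^sup>2" using L by (simp add: one_le_power)
      finally show ?thesis by (simp add: distrib_right)
    qed
    then have "(4 * K\<^sup>2 + 8) / q \<le> (4 * ?k\<^sup>2 + 8) * L\<^sup>2 / q" using q by (intro divide_right_mono) auto
    also have "\<dots> = (4 * ?k\<^sup>2 + 8) * (1 / l0\<^sup>2) * (L / real n)"
      using L n l0 by (simp add: q_def power2_eq_square)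
    also have "1 / l0\<^sup>2 = 64 * \<rho>\<^sup>2" by (simp add: l0_def power_divide power_mult_distrib)
    also have "?k = c + bernstein_const \<rho> / (64 * \<rho>\<^sup>2)" by (simp add: l0_def power_divide power_mult_distrib)
    finally show "(4 * K\<^sup>2 + 8) / q \<le> deviation_const \<rho> c * (L / real n)" by (simp add: deviation_const_def)
  qed
  finally show ?thesis by (simp add: T_def)
qed

end

section \<open>Risk bound\<close>

text \<open>The spectral sum of the reciprocals is a right inverse of \<open>Om\<close>; multiplying
  \<open>Sg Om = 1\<close> by it from the right identifies it with \<open>Sg\<close>.\<close>

lemma inverse_spectral_sum:
  assumes u: "orthonormal_system p u"
    and Om: "\<And>i j. i < p \<Longrightarrow> j < p \<Longrightarrow> Om i j = spectral_sum p u l i j"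
    and l: "\<And>a. a < p \<Longrightarrow> l a \<noteq> 0"
    and inv: "\<And>i j. i < p \<Longrightarrow> j < p \<Longrightarrow> (\<Sum>k<p. Sg i k * Om k j) = (if i = j then 1 else 0)"
    and ij: "i < p" "j < p"
  shows "Sg i j = spectral_sum p u (\<lambda>a. 1 / l a) i j"
proof -
  let ?N = "spectral_sum p u (\<lambda>a. 1 / l a)"
  have OmN: "(\<Sum>m<p. Om k m * ?N m j) = (if k = j then 1 else 0)" if k: "k < p" for k
  proof -
    have "(\<Sum>m<p. Om k m * ?N m j) = (\<Sum>m<p. spectral_sum p u l k m * ?N m j)"
      using k by (intro sum.cong refl) (simp add: Om)
    also have "\<dots> = spectral_sum p u (\<lambda>a. l a * (1 / l a)) k j" by (rule spectral_sum_mult[OF u k ij(2)])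
    also have "\<dots> = (if k = j then 1 else 0)" using l by (intro spectral_sum_one u k ij) auto
    finally show ?thesis .
  qed
  have "Sg i j = (\<Sum>k<p. Sg i k * (if k = j then 1 else 0))"
    using ij by (simp add: if_distrib cong: if_cong)
  also have "\<dots> = (\<Sum>k<p. \<Sum>m<p. Sg i k * Om k m * ?N m j)"
    by (intro sum.cong refl) (simp add: OmN[symmetric] sum_distrib_left mult.assoc)
  also have "\<dots> = (\<Sum>m<p. (\<Sum>k<p. Sg i k * Om k m) * ?N m j)"
    by (subst sum.swap) (simp add: sum_distrib_right)
  also have "\<dots> = (\<Sum>m<p. (if i = m then 1 else 0) * ?N m j)"
    using ij by (intro sum.cong refl) (simp add: inv)
  also have "\<dots> = ?N i j" using ij by (simp add: if_distrib if_distribR cong: if_cong)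
  finally show ?thesis .
qed

text \<open>The interval from \<open>1 / \<eta>\<close> to \<open>\<eta>\<close> is mapped to itself
  by inversion, so the covariance inherits the spectral bounds of \<open>\<Omega>\<close>. This is
  what makes \<open>\<eta>\<close> the right level for clipping covariances as well.\<close>

lemma local_cropping_precision_class:
  assumes Om: "\<Omega> \<in> precision_class p \<alpha> \<eta> M" and mu: "\<mu> \<in> data_laws p \<rho> \<Omega>"
    and eta: "\<eta> > 1" and k: "k \<ge> 1" and delta: "\<delta> \<ge> 0"
    and band: "\<And>i j. i < p \<Longrightarrow> j < p \<Longrightarrow> i + k < j \<or> j + k < i \<Longrightarrow> B i j = 0"
    and near: "op_bound {..<p} {..<p} (\<lambda>i j. \<Omega> $$ (i,j) - B i j) \<delta>"
  shows "local_cropping p k \<eta> \<delta> (\<lambda>i j. \<Omega> $$ (i,j)) (\<lambda>i j. cov_mat p \<mu> $$ (i,j)) B"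
proof -
  obtain u l where u: "orthonormal_system p u"
    and Ol: "\<And>i j. i < p \<Longrightarrow> j < p \<Longrightarrow> \<Omega> $$ (i,j) = spectral_sum p u l i j"
    and l: "\<And>a. a < p \<Longrightarrow> 1 / \<eta> \<le> l a \<and> l a \<le> \<eta>"
    using precision_class_quad(3)[OF Om] by metis
  have Oc: "\<Omega> \<in> carrier_mat p p" using Om by (simp add: precision_class_def)
  have lpos: "l a > 0" if "a < p" for a
  proof -
    have "0 < 1 / \<eta>" using eta by simp
    then show ?thesis using l[OF that] by linarith
  qed
  have inv: "(\<Sum>m<p. cov_mat p \<mu> $$ (i,m) * \<Omega> $$ (m,j)) = (if i = j then 1 else 0)"
    if ij: "i < p" "j < p" for i j
  proof -
    have d: "cov_mat p \<mu> \<in> carrier_mat p p" by (simp add: cov_mat_def)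
    have "cov_mat p \<mu> * \<Omega> = 1\<^sub>m p"
      using mu d by (simp add: data_laws_def inverts_mat_def)
    then have "(cov_mat p \<mu> * \<Omega>) $$ (i,j) = (if i = j then 1 else 0)" using ij by simp
    then show ?thesis using ij Oc d by (simp add: scalar_prod_def atLeast0LessThan)
  qed
  have Sl: "cov_mat p \<mu> $$ (i,j) = spectral_sum p u (\<lambda>a. 1 / l a) i j" if "i < p" "j < p" for i j
    by (rule inverse_spectral_sum[OF u Ol _ inv that]) (use lpos in force)+
  have eq: "quad {..<p} (\<lambda>i j. cov_mat p \<mu> $$ (i,j)) x = quad {..<p} (spectral_sum p u (\<lambda>a. 1 / l a)) x" for x
    unfolding quad_def by (intro sum.cong refl) (simp add: Sl)
  show ?thesis
  proof
    show "cov_mat p \<mu> $$ (i,j) = cov_mat p \<mu> $$ (j,i)" if "i < p" "j < p" for i j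
      using Sl that spectral_sum_sym by metis
    show "1 / \<eta> * (\<Sum>i<p. (x i)\<^sup>2) \<le> quad {..<p} (\<lambda>i j. cov_mat p \<mu> $$ (i,j)) x" for x
      unfolding eq
    proof (intro quad_spectral_sum_ge u)
      fix a assume a: "a < p"
      show "1 / \<eta> \<le> 1 / l a"
        using l[OF a] lpos[OF a] eta by (intro divide_left_mono mult_pos_pos) auto
    qed
    show "quad {..<p} (\<lambda>i j. cov_mat p \<mu> $$ (i,j)) x \<le> \<eta> * (\<Sum>i<p. (x i)\<^sup>2)" for x
      unfolding eq
    proof (intro quad_spectral_sum_le u)
      fix a assume a: "a < p"
      then have "1 / \<eta> \<le> l a" using l by blast
      then show "1 / l a \<le> \<eta>" using lpos[OF a] eta by (simp add: field_simps)
    qed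
    show "op_bound {..<p} {..<p} (\<lambda>i j. \<Omega> $$ (i,j)) \<eta>"
    proof -
      have "\<bar>l a\<bar> \<le> \<eta>" if "a < p" for a using l[OF that] lpos[OF that] by linarith
      then have "op_bound {..<p} {..<p} (spectral_sum p u l) \<eta>"
        using eta by (intro op_bound_spectral_sum u) auto
      then show ?thesis by (rule op_bound_cong[THEN iffD1, rotated]) (simp add: Ol)
    qed
  qed (use eta k delta inv band near in auto)
qed

text \<open>One finite set for all windows of both block sizes, so that a single maximum controls
  every local deviation at once.\<close>

definition window_nets :: "nat \<Rightarrow> nat \<Rightarrow> (nat \<Rightarrow> real) set" where
  "window_nets p k = (\<Union>b\<in>{k, 2 * k}. \<Union>m\<in>{2 - int b..int p}.
     ball_net (window p (m - int b) (m + 2 * int b - 1)))"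

lemma finite_window_nets: "finite (window_nets p k)"
  by (simp add: window_nets_def finite_ball_net)

lemma zero_in_ball_net: "(\<lambda>_. 0) \<in> ball_net J"
proof -
  have "(\<lambda>i. if i \<in> J then 0 else undefined) \<in> lattice_ball J" by (auto simp: lattice_ball_def)
  then show ?thesis unfolding ball_net_def by (rule rev_image_eqI) auto
qed

lemma card_window_le: "card (window p l u) \<le> nat (u - l + 1)"
proof -
  have "inj_on (\<lambda>i. int i + 1) (window p l u)" by (simp add: inj_on_def)
  moreover have "(\<lambda>i. int i + 1) ` window p l u \<subseteq> {l..u}" by (auto simp: window_def)
  ultimately have "card (window p l u) \<le> card {l..u}" by (intro card_inj_on_le) auto
  then show ?thesis by simp
qed

text \<open>Here \<open>112 = 108 + 2 + 2\<close>. A window \<open>J\<close> has at most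
  \<open>6 * k\<close> indices, and \<open>18 * 6 = 108\<close>; the remaining factors are bounded
  by \<open>4 \<le> exp (2 * k)\<close> and \<open>p + 2 * k \<le> p * exp (2 * k)\<close>. Finally
  \<open>ln p\<close> is enlarged to \<open>112 * ln p\<close> to share the coefficient of
  \<open>k\<close>.\<close>

lemma card_window_nets:
  assumes p: "p \<ge> 1" and k: "k \<ge> 1"
  shows "2 * real (card (window_nets p k)) \<le> exp (112 * (ln (real p) + real k))"
proof -
  let ?J = "\<lambda>b m. window p (m - int b) (m + 2 * int b - 1)"
  have one: "real (card (\<Union>m\<in>{2 - int b..int p}. ball_net (?J b m))) \<le> real (p + 2 * k) * exp (108 * real k)"
    if b: "b \<in> {k, 2 * k}" for b
  proof -
    have "real (card (\<Union>m\<in>{2 - int b..int p}. ball_net (?J b m)))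
        \<le> real (\<Sum>m\<in>{2 - int b..int p}. card (ball_net (?J b m)))"
      by (intro of_nat_mono card_UN_le) simp
    also have "\<dots> = (\<Sum>m\<in>{2 - int b..int p}. real (card (ball_net (?J b m))))" by simp
    also have "\<dots> \<le> (\<Sum>m\<in>{2 - int b..int p}. exp (108 * real k))"
    proof (intro sum_mono)
      fix m
      have "card (?J b m) \<le> 3 * b" using card_window_le[of p "m - int b" "m + 2 * int b - 1"] by simp
      also have "\<dots> \<le> 6 * k" using b by auto
      finally have "18 * real (card (?J b m)) \<le> 108 * real k" by linarith
      then have "exp (18 * real (card (?J b m))) \<le> exp (108 * real k)" by simp
      then show "real (card (ball_net (?J b m))) \<le> exp (108 * real k)"
        by (rule order_trans[OF card_ball_net_le[OF finite_window]])
    qed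
    also have "\<dots> = real (nat (int p - (2 - int b) + 1)) * exp (108 * real k)" by simp
    also have "\<dots> \<le> real (p + 2 * k) * exp (108 * real k)"
      using b by (intro mult_right_mono of_nat_mono) auto
    finally show ?thesis .
  qed
  have "card (window_nets p k) \<le> (\<Sum>b\<in>{k, 2 * k}. card (\<Union>m\<in>{2 - int b..int p}. ball_net (?J b m)))"
    unfolding window_nets_def by (intro card_UN_le) simp
  then have "real (card (window_nets p k)) \<le> (\<Sum>b\<in>{k, 2 * k}. real (card (\<Union>m\<in>{2 - int b..int p}. ball_net (?J b m))))"
    unfolding of_nat_sum[symmetric] by (rule of_nat_mono)
  also have "\<dots> \<le> (\<Sum>b\<in>{k, 2 * k}. real (p + 2 * k) * exp (108 * real k))"
    by (intro sum_mono one)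
  also have "\<dots> = 2 * (real (p + 2 * k) * exp (108 * real k))" using k by simp
  finally have "2 * real (card (window_nets p k)) \<le> 2 * (2 * (real (p + 2 * k) * exp (108 * real k)))"
    by (intro mult_left_mono) auto
  also have "\<dots> = 4 * real (p + 2 * k) * exp (108 * real k)" by simp
  also have "\<dots> \<le> exp (2 * real k) * (real p * exp (2 * real k)) * exp (108 * real k)"
  proof (intro mult_right_mono mult_mono)
    have "exp 1 * exp 1 \<ge> (2 * 2 :: real)" using exp_ge_add_one_self[of 1] by (intro mult_mono) auto
    then have "4 \<le> exp (2 :: real)" by (simp add: exp_add[symmetric])
    also have "\<dots> \<le> exp (2 * real k)" using k by simp
    finally show "4 \<le> exp (2 * real k)" .
    have "real k * 1 \<le> real k * real p" using p by (intro mult_left_mono) auto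
    then have "real (p + 2 * k) \<le> real p * (1 + 2 * real k)" by (simp add: algebra_simps)
    also have "\<dots> \<le> real p * exp (2 * real k)" by (intro mult_left_mono exp_ge_add_one_self) auto
    finally show "real (p + 2 * k) \<le> real p * exp (2 * real k)" .
  qed auto
  also have "\<dots> = real p * exp (112 * real k)"
    by (simp add: mult_ac exp_add[symmetric])
  also have "real p = exp (ln (real p))" using p by simp
  also have "exp (ln (real p)) * exp (112 * real k) \<le> exp (112 * ln (real p)) * exp (112 * real k)"
  proof (intro mult_right_mono)
    have "0 \<le> ln (real p)" using p by simp
    then show "exp (ln (real p)) \<le> exp (112 * ln (real p))" unfolding exp_le_cancel_iff by linarith
  qed simp
  also have "\<dots> = exp (112 * (ln (real p) + real k))" by (simp add: exp_add[symmetric] distrib_left)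
  finally show ?thesis .
qed

lemma square_add_le: "(a + b)\<^sup>2 \<le> 2 * a\<^sup>2 + 2 * b\<^sup>2" for a b :: real
  using sum_squares_bound[of a b] by (simp add: power2_sum)

text \<open>Inserting \<open>\<epsilon> = 2 * T\<close> and \<open>\<delta> = D * w \<le> D\<close>
  into \<open>2 * (3 * local_error \<epsilon> + \<delta>)\<close> gives
  \<open>P1 * (2 * T) + P2 * w\<close>. Squaring yields the first two summands of \<open>C\<close>;
  the third is the square of the trivial bound \<open>2 * \<eta>\<close>.\<close>

lemma cropping_risk_le:
  fixes \<alpha> \<eta> M \<rho> :: real
  defines "c0 \<equiv> M * (2 + 1 / (\<alpha> - 1 / 2))"
  defines "D \<equiv> \<eta> * c0 * (2 + c0)"
  defines "P1 \<equiv> 12 * \<eta> * (\<eta> + D)" and "P2 \<equiv> (6 * \<eta>\<^sup>2 + 2) * D"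
  defines "C \<equiv> 8 * P1\<^sup>2 * deviation_const \<rho> 112 + 2 * P2\<^sup>2 + 4 * \<eta>\<^sup>2"
  assumes al: "\<alpha> > 1 / 2" and M: "M > 0" and eta: "\<eta> > 1" and rho: "\<rho> > 0"
    and Om: "\<Omega> \<in> precision_class p \<alpha> \<eta> M" and mu: "\<mu> \<in> data_laws p \<rho> \<Omega>"
    and n: "n \<ge> 1" and p: "p \<ge> 1" and k: "k \<ge> 1"
  shows "(\<integral>\<^sup>+z. ennreal ((op_norm (cropping_estimator \<eta> n p k z - \<Omega>))\<^sup>2) \<partial>(\<Pi>\<^sub>M i\<in>{..<n}. \<mu>))
    \<le> ennreal (C * real k powr (- 2 * \<alpha> + 1) + C * ((ln (real p) + real k) / real n))"
proof -
  let ?P = "\<Pi>\<^sub>M i\<in>{..<n}. \<mu>"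
  interpret sg: sub_gaussian_law \<mu> p \<rho>
    using mu rho unfolding data_laws_def sub_gaussian_law_def sub_gaussian_law_axioms_def by simp
  interpret P: prob_space ?P by (intro prob_space_PiM sg.prob_space_axioms)
  have c0: "c0 > 0" using M al by (simp add: c0_def add_pos_pos)
  have D: "D > 0" using c0 eta by (simp add: D_def)
  define w where "w = real k powr (1 / 2 - \<alpha>)"
  define \<delta> where "\<delta> = D * w"
  have w: "0 \<le> w" "w \<le> 1"
  proof -
    have "w \<le> real k powr 0" unfolding w_def using k al by (intro powr_mono) auto
    then show "w \<le> 1" using k by simp
  qed (simp add: w_def)
  have delta: "0 \<le> \<delta>" "\<delta> \<le> D" using D w by (auto simp: \<delta>_def mult_le_cancel_left2)
  obtain B where band': "\<forall>i<p. \<forall>j<p. i + k < j \<or> j + k < i \<longrightarrow> B i j = 0"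
    and near: "op_bound {..<p} {..<p} (\<lambda>i j. \<Omega> $$ (i,j) - B i j) \<delta>"
    using banded_approximation[OF Om k al M eta c0_def[THEN meta_eq_to_obj_eq], folded D_def w_def \<delta>_def]
    by (elim exE conjE)
  note band = band'[rule_format]
  interpret lc: local_cropping p k \<eta> \<delta> "\<lambda>i j. \<Omega> $$ (i,j)" "\<lambda>i j. cov_mat p \<mu> $$ (i,j)" B
    by (rule local_cropping_precision_class[OF Om mu eta k delta(1) band near])
  have Oc: "\<Omega> \<in> carrier_mat p p" using Om by (simp add: precision_class_def)
  define V where "V = window_nets p k"
  \<comment> \<open>Nonemptiness of \<open>V\<close> keeps \<open>Max\<close> from being
    unspecified.\<close>
  have "(\<lambda>_. 0) \<in> V"
    unfolding V_def window_nets_def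
    by (rule UN_I[of k], simp, rule UN_I[of 1]) (use p k zero_in_ball_net in auto)
  then have V: "finite V" "V \<noteq> {}" by (auto simp: V_def finite_window_nets)
  have Vn: "(\<Sum>i<p. (v i)\<^sup>2) \<le> 1" if "v \<in> V" for v
  proof -
    obtain b m where v: "v \<in> ball_net (window p (m - int b) (m + 2 * int b - 1))"
      using \<open>v \<in> V\<close> unfolding V_def window_nets_def by blast
    have "(\<Sum>i<p. (v i)\<^sup>2) = (\<Sum>i\<in>window p (m - int b) (m + 2 * int b - 1). (v i)\<^sup>2)"
      using window_subset ball_net_props(1)[OF _ v] by (intro sum.mono_neutral_right) auto
    then show ?thesis using ball_net_props(2)[OF _ v] by simp
  qed
  define T where "T z = Max ((\<lambda>v. \<bar>sg.dev n v z\<bar>) ` V)" for z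
  have T: "\<bar>sg.dev n v z\<bar> \<le> T z" if "v \<in> V" for v z
    unfolding T_def using V that by (intro Max_ge) auto
  have T0: "T z \<ge> 0" for z
  proof -
    obtain v where "v \<in> V" using V by blast
    then show ?thesis using T[of v z] by linarith
  qed
  define R where "R z = op_norm (cropping_estimator \<eta> n p k z - \<Omega>)" for z
  have est: "0 \<le> R z" "R z \<le> 2 * (3 * lc.local_error (2 * T z) + \<delta>)" "R z \<le> 2 * \<eta>" for z
  proof -
    \<comment> \<open>Passing from the quarter nets to all vectors costs a factor 2, so
      \<open>\<epsilon> = 2 * T z\<close> serves all windows.\<close>
    have dev: "\<bar>quad (window p (m - int b) (m + 2 * int b - 1)) (\<lambda>i j. sample_cov n p z $$ (i,j) - cov_mat p \<mu> $$ (i,j)) x\<bar>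
        \<le> 2 * T z * (\<Sum>i\<in>window p (m - int b) (m + 2 * int b - 1). (x i)\<^sup>2)"
      if b: "b \<in> {k, 2 * k}" and m: "m \<in> {2 - int b..int p}" for b m x
    proof (rule quad_le_twice_net)
      let ?J = "window p (m - int b) (m + 2 * int b - 1)"
      show "sample_cov n p z $$ (i,j) - cov_mat p \<mu> $$ (i,j) = sample_cov n p z $$ (j,i) - cov_mat p \<mu> $$ (j,i)"
        if "i \<in> ?J" "j \<in> ?J" for i j
      proof -
        have ij: "i < p" "j < p" using that by (auto simp: window_def)
        then have "sample_cov n p z $$ (i,j) = sample_cov n p z $$ (j,i)"
          by (simp add: sample_cov_def Let_def scalar_prod_def mult.commute)
        then show ?thesis using lc.Sg_sym[OF ij] by simp
      qed
      fix v assume v: "v \<in> ball_net ?J"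
      then have "v \<in> V" using b m unfolding V_def window_nets_def by blast
      moreover have "quad ?J (\<lambda>i j. sample_cov n p z $$ (i,j) - cov_mat p \<mu> $$ (i,j)) v = sg.dev n v z"
        by (rule sg.quad_sample_cov[OF window_subset ball_net_props(1)[OF finite_window v] n])
      ultimately show "\<bar>quad ?J (\<lambda>i j. sample_cov n p z $$ (i,j) - cov_mat p \<mu> $$ (i,j)) v\<bar> \<le> T z"
        using T by simp
    qed simp
    have "2 * T z \<ge> 0" using T0[of z] by simp
    note ce = lc.cropping_error[OF p Oc refl precision_class_quad(1)[OF Om] precision_class_quad(2)[OF Om] this dev]
    show "0 \<le> R z" "R z \<le> 2 * (3 * lc.local_error (2 * T z) + \<delta>)" "R z \<le> 2 * \<eta>"
      unfolding R_def using ce by simp_all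
  qed
  have R: "(R z)\<^sup>2 \<le> 8 * P1\<^sup>2 * (T z)\<^sup>2 + 2 * P2\<^sup>2 * w\<^sup>2" for z
  proof -
    have "R z \<le> 12 * \<eta> * (\<eta> + \<delta>) * (2 * T z) + (6 * \<eta>\<^sup>2 + 2) * \<delta>"
      using est(2)[of z] by (simp add: lc.local_error_def algebra_simps power2_eq_square)
    also have "\<dots> \<le> 12 * \<eta> * (\<eta> + D) * (2 * T z) + (6 * \<eta>\<^sup>2 + 2) * \<delta>"
      using eta delta T0[of z] by (intro add_right_mono mult_right_mono mult_left_mono) auto
    also have "\<dots> = P1 * (2 * T z) + P2 * w" by (simp add: P1_def P2_def \<delta>_def)
    finally have "(R z)\<^sup>2 \<le> (P1 * (2 * T z) + P2 * w)\<^sup>2" using est(1) by (intro power_mono) auto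
    also have "\<dots> \<le> 2 * (P1 * (2 * T z))\<^sup>2 + 2 * (P2 * w)\<^sup>2" by (rule square_add_le)
    also have "\<dots> = 8 * P1\<^sup>2 * (T z)\<^sup>2 + 2 * P2\<^sup>2 * w\<^sup>2" by (simp add: power_mult_distrib)
    finally show ?thesis .
  qed
  have ww: "w\<^sup>2 = real k powr (- 2 * \<alpha> + 1)"
    using k by (simp add: w_def power2_eq_square powr_add[symmetric])
  define L where "L = ln (real p) + real k"
  have L1: "1 \<le> L" using p k by (simp add: L_def add_increasing)
  note dc = deviation_const_nonneg[of \<rho> 112]
  have C: "8 * P1\<^sup>2 * deviation_const \<rho> 112 \<le> C" "2 * P2\<^sup>2 \<le> C" "4 * \<eta>\<^sup>2 \<le> C" "0 \<le> C"
    using dc by (auto simp: C_def)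
  have nn: "0 \<le> L / real n" using L1 by simp
  have goal: "(\<integral>\<^sup>+z. ennreal ((R z)\<^sup>2) \<partial>?P) \<le> ennreal (C * w\<^sup>2 + C * (L / real n))"
  proof (cases "L \<le> real n")
    case True
    have card: "2 * real (card V) \<le> exp (112 * L)"
      unfolding V_def L_def by (rule card_window_nets[OF p k])
    \<comment> \<open>Measurability is established for the dominating \<open>T\<close>. The
      estimator, which contains a choice, enters only through monotonicity of
      \<open>nn_integral\<close>, which holds for arbitrary integrands.\<close>
    have Tm: "T \<in> borel_measurable ?P"
      unfolding T_def[abs_def] using V(1) sg.dev_measurable
      by (intro borel_measurable_Max borel_measurable_abs) auto
    have "(\<integral>\<^sup>+z. ennreal ((R z)\<^sup>2) \<partial>?P)
        \<le> (\<integral>\<^sup>+z. ennreal (8 * P1\<^sup>2) * ennreal ((T z)\<^sup>2) + ennreal (2 * P2\<^sup>2 * w\<^sup>2) \<partial>?P)"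
    proof (intro nn_integral_mono)
      fix z
      have "ennreal ((R z)\<^sup>2) \<le> ennreal (8 * P1\<^sup>2 * (T z)\<^sup>2 + 2 * P2\<^sup>2 * w\<^sup>2)" by (intro ennreal_leI R)
      also have "\<dots> = ennreal (8 * P1\<^sup>2) * ennreal ((T z)\<^sup>2) + ennreal (2 * P2\<^sup>2 * w\<^sup>2)"
        by (subst ennreal_plus; (subst ennreal_mult)?) auto
      finally show "ennreal ((R z)\<^sup>2) \<le> ennreal (8 * P1\<^sup>2) * ennreal ((T z)\<^sup>2) + ennreal (2 * P2\<^sup>2 * w\<^sup>2)" .
    qed
    also have "\<dots> = ennreal (8 * P1\<^sup>2) * (\<integral>\<^sup>+z. ennreal ((T z)\<^sup>2) \<partial>?P) + ennreal (2 * P2\<^sup>2 * w\<^sup>2)"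
      using Tm by (simp add: nn_integral_add nn_integral_cmult P.emeasure_space_1)
    also have "\<dots> \<le> ennreal (8 * P1\<^sup>2) * ennreal (deviation_const \<rho> 112 * (L / real n)) + ennreal (2 * P2\<^sup>2 * w\<^sup>2)"
      unfolding T_def by (intro add_right_mono mult_left_mono sg.max_deviation V Vn card L1 True) auto
    also have "\<dots> = ennreal (8 * P1\<^sup>2 * deviation_const \<rho> 112 * (L / real n) + 2 * P2\<^sup>2 * w\<^sup>2)"
    proof -
      have e: "0 \<le> deviation_const \<rho> 112 * (L / real n)" using dc nn by (rule mult_nonneg_nonneg)
      have "ennreal (8 * P1\<^sup>2 * (deviation_const \<rho> 112 * (L / real n)) + 2 * P2\<^sup>2 * w\<^sup>2)
          = ennreal (8 * P1\<^sup>2 * (deviation_const \<rho> 112 * (L / real n))) + ennreal (2 * P2\<^sup>2 * w\<^sup>2)"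
        by (intro ennreal_plus mult_nonneg_nonneg e) auto
      also have "ennreal (8 * P1\<^sup>2 * (deviation_const \<rho> 112 * (L / real n)))
          = ennreal (8 * P1\<^sup>2) * ennreal (deviation_const \<rho> 112 * (L / real n))"
        by (intro ennreal_mult e) simp
      finally show ?thesis by (simp only: mult.assoc)
    qed
    also have "\<dots> \<le> ennreal (C * (L / real n) + C * w\<^sup>2)"
      by (intro ennreal_leI add_mono mult_right_mono C nn) simp
    finally show ?thesis by (simp add: add.commute)
  next
    case False
    have "(\<integral>\<^sup>+z. ennreal ((R z)\<^sup>2) \<partial>?P) \<le> (\<integral>\<^sup>+z. ennreal (4 * \<eta>\<^sup>2) \<partial>?P)"
    proof (intro nn_integral_mono ennreal_leI)
      fix z
      have "(R z)\<^sup>2 \<le> (2 * \<eta>)\<^sup>2" using est(1,3) by (intro power_mono) auto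
      then show "(R z)\<^sup>2 \<le> 4 * \<eta>\<^sup>2" by (simp add: power_mult_distrib)
    qed
    also have "\<dots> = ennreal (4 * \<eta>\<^sup>2)" by (simp add: P.emeasure_space_1)
    also have "\<dots> \<le> ennreal (C * w\<^sup>2 + C * (L / real n))"
    proof (intro ennreal_leI)
      have "1 \<le> L / real n" using False n by simp
      then have "C * 1 \<le> C * (L / real n)" using C(4) by (intro mult_left_mono) auto
      moreover have "0 \<le> C * w\<^sup>2" using C(4) by simp
      ultimately show "4 * \<eta>\<^sup>2 \<le> C * w\<^sup>2 + C * (L / real n)" using C(3) by linarith
    qed
    finally show ?thesis .
  qed
  then show ?thesis by (simp add: R_def ww L_def)
qed

theorem theorem3:
  fixes \<alpha> \<eta> M \<rho> :: real
  assumes "\<alpha> > 1 / 2" and "M > 0" and "\<eta> > 1" and "\<rho> > 0"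
  shows "\<exists>C>0. \<forall>n p :: nat. n \<ge> 1 \<and> \<lceil>real n powr (1 / (2 * \<alpha>))\<rceil> \<le> int p \<longrightarrow>
    (\<forall>k\<ge>1. max_risk \<alpha> \<eta> M \<rho> n p k
       \<le> ennreal (C * real k powr (- 2 * \<alpha> + 1) + C * ((ln (real p) + real k) / real n))) \<and>
    (\<forall>k :: nat. int k = \<lceil>real n powr (1 / (2 * \<alpha>))\<rceil> \<longrightarrow>
       max_risk \<alpha> \<eta> M \<rho> n p k
       \<le> ennreal (C * real n powr (- ((2 * \<alpha> - 1) / (2 * \<alpha>))) + C * (ln (real p) / real n)))"
proof -
  define c0 where "c0 = M * (2 + 1 / (\<alpha> - 1 / 2))"
  define D where "D = \<eta> * c0 * (2 + c0)"
  define C where "C = 8 * (12 * \<eta> * (\<eta> + D))\<^sup>2 * deviation_const \<rho> 112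
    + 2 * ((6 * \<eta>\<^sup>2 + 2) * D)\<^sup>2 + 4 * \<eta>\<^sup>2"
  have risk: "max_risk \<alpha> \<eta> M \<rho> n p k
       \<le> ennreal (C * real k powr (- 2 * \<alpha> + 1) + C * ((ln (real p) + real k) / real n))"
    if "n \<ge> 1" "p \<ge> 1" "k \<ge> 1" for n p k
    unfolding max_risk_def C_def D_def c0_def
    by (intro SUP_least cropping_risk_le assms that)
  have C: "C > 0"
    unfolding C_def using assms(3) deviation_const_nonneg[of \<rho> 112]
    by (intro add_nonneg_pos add_nonneg_nonneg) auto
  show ?thesis
  \<comment> \<open>The 3 is for the second bound: one \<open>C\<close> from the bias, two from
    \<open>k / n\<close>, because rounding up may double the bandwidth.\<close>
  proof (intro exI[of _ "3 * C"] conjI allI impI)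
    show "0 < 3 * C" using C by simp
  next
    fix n p k :: nat
    assume np: "n \<ge> 1 \<and> \<lceil>real n powr (1 / (2 * \<alpha>))\<rceil> \<le> int p" and k: "1 \<le> k"
    have np1: "1 \<le> real n powr (1 / (2 * \<alpha>))" using np assms(1) by (intro ge_one_powr_ge_zero) auto
    then have p: "p \<ge> 1" using np by linarith
    have "max_risk \<alpha> \<eta> M \<rho> n p k
       \<le> ennreal (C * real k powr (- 2 * \<alpha> + 1) + C * ((ln (real p) + real k) / real n))"
      using np p k by (intro risk) auto
    also have "\<dots> \<le> ennreal (3 * C * real k powr (- 2 * \<alpha> + 1) + 3 * C * ((ln (real p) + real k) / real n))"
      using C p by (intro ennreal_leI add_mono mult_right_mono) auto
    finally show "max_risk \<alpha> \<eta> M \<rho> n p k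
       \<le> ennreal (3 * C * real k powr (- 2 * \<alpha> + 1) + 3 * C * ((ln (real p) + real k) / real n))" .
  next
    fix n p k :: nat
    assume np: "n \<ge> 1 \<and> \<lceil>real n powr (1 / (2 * \<alpha>))\<rceil> \<le> int p"
      and k: "int k = \<lceil>real n powr (1 / (2 * \<alpha>))\<rceil>"
    define x where "x = real n powr (1 / (2 * \<alpha>))"
    define y where "y = real n powr (- ((2 * \<alpha> - 1) / (2 * \<alpha>)))"
    have n: "real n \<ge> 1" using np by simp
    have x: "1 \<le> x" unfolding x_def using n assms(1) by (intro ge_one_powr_ge_zero) auto
    \<comment> \<open>The ceiling is below \<open>x + 1\<close>, and
      \<open>x \<ge> 1\<close>.\<close>
    have kx: "x \<le> real k" "real k \<le> 2 * x" using k x unfolding x_def[symmetric] by linarith+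
    have p: "p \<ge> 1" using np x unfolding x_def[symmetric] by linarith
    have k1: "k \<ge> 1" using kx x by linarith
    have "real k powr (- 2 * \<alpha> + 1) \<le> x powr (- 2 * \<alpha> + 1)"
      using kx x assms(1) by (intro powr_mono2') auto
    also have "\<dots> = y"
    proof -
      have eq: "1 / (2 * \<alpha>) * (- 2 * \<alpha> + 1) = - ((2 * \<alpha> - 1) / (2 * \<alpha>))"
        using assms(1) by (simp add: field_simps)
      show ?thesis unfolding x_def y_def powr_powr eq ..
    qed
    finally have b1: "real k powr (- 2 * \<alpha> + 1) \<le> y" .
    \<comment> \<open>The bandwidth balances the two terms: with
      \<open>x = n powr (1 / (2 * \<alpha>))\<close>, both \<open>x powr (1 - 2 * \<alpha>)\<close>
      and \<open>x / n\<close> equal \<open>y\<close>.\<close>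
    have "x / real n = y"
    proof -
      have "x / real n = real n powr (1 / (2 * \<alpha>) - 1)" using n by (simp add: x_def powr_diff)
      also have "1 / (2 * \<alpha>) - 1 = - ((2 * \<alpha> - 1) / (2 * \<alpha>))" using assms(1) by (simp add: field_simps)
      finally show ?thesis by (simp add: y_def)
    qed
    moreover have "real k / real n \<le> 2 * x / real n" using kx(2) by (intro divide_right_mono) auto
    ultimately have b2: "real k / real n \<le> 2 * y" by simp
    have "max_risk \<alpha> \<eta> M \<rho> n p k
       \<le> ennreal (C * real k powr (- 2 * \<alpha> + 1) + C * ((ln (real p) + real k) / real n))"
      using np p k1 by (intro risk) auto
    also have "\<dots> \<le> ennreal (3 * C * y + 3 * C * (ln (real p) / real n))"
    proof (intro ennreal_leI)
      have "C * real k powr (- 2 * \<alpha> + 1) + C * ((ln (real p) + real k) / real n)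
          = C * real k powr (- 2 * \<alpha> + 1) + C * (real k / real n) + C * (ln (real p) / real n)"
        by (simp add: add_divide_distrib distrib_left)
      also have "\<dots> \<le> C * y + C * (2 * y) + 3 * C * (ln (real p) / real n)"
        using C p b1 b2 by (intro add_mono mult_left_mono mult_right_mono) auto
      finally show "C * real k powr (- 2 * \<alpha> + 1) + C * ((ln (real p) + real k) / real n)
          \<le> 3 * C * y + 3 * C * (ln (real p) / real n)" by simp
    qed
    finally show "max_risk \<alpha> \<eta> M \<rho> n p k
       \<le> ennreal (3 * C * real n powr (- ((2 * \<alpha> - 1) / (2 * \<alpha>))) + 3 * C * (ln (real p) / real n))"
      by (simp add: y_def)
  qed
qed

end
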